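(* Let $P$ be a program and $G$ a goal. If $\theta$ is a computed answer for the goal $G$ in $P$, then $$\mathcal{B}[\![G]\!]\,(\mathcal{P}[\![P]\!])\,[\{[\epsilon]_{\mathrm{vars}(G)}\},\mathrm{vars}(G)]\ \sqsupseteq_{\mathrm{Ps}}\ [\{[\theta]_{\mathrm{vars}(G)}\},\mathrm{vars}(G)].$$
   Context: **Syntax.** Fix a first-order signature (function symbols containing at least one constant and one symbol of arity $\ge 2$, and predicate symbols) and an infinite set $\mathcal V$ of variables. An atom is an atomic formula; a goal (or body) is a finite sequence of atoms, $\square$ being the empty one; a clause is $H\leftarrow B$ with $H$ an atom and $B$ a body; a program is a set of clauses. $\mathrm{vars}(o)$ is the set of variables of a syntactic object $o$. $\wp_f$ denotes finite subsets. **Substitutions.** A substitution is a map $\theta$ from $\mathcal V$ to terms with finite $\mathrm{dom}(\theta)=\{x\mid\theta(x)\ne x\}$, extended to terms; $\mathrm{rng}(\theta)=\bigcup_{x\in \mathrm{dom}(\theta)}\mathrm{vars}(\theta(x))$, $\mathrm{vars}(\theta)=\mathrm{dom}(\theta)\cup\mathrm{rng}(\theta)$; $\epsilon$ is the identity; $(\theta\circ\delta)(x)=\theta(\delta(x))$; $\theta_{|U}$ is the restriction of $\theta$ to $U$ (identity elsewhere). $\mathit{Subst}$ is the set of substitutions, $\mathit{ISubst}$ the set of idempotent ones ($\mathrm{dom}\cap\mathrm{rng}=\emptyset$), $\mathit{Ren}$ the set of renamings (substitutions that are bijections $\mathcal V\to\mathcal V$). For a set of equations $E$, $\mathrm{mgu}(E)$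 denotes an idempotent most general unifier with variables in $\mathrm{vars}(E)$, if $E$ is unifiable; $\mathrm{Eq}(\sigma)=\{x=\sigma(x)\mid x\in\mathrm{dom}(\sigma)\}$ and $\mathrm{mgu}(\sigma_1,\sigma_2)=\mathrm{mgu}(\mathrm{Eq}(\sigma_1)\cup\mathrm{Eq}(\sigma_2))$. **Existential substitutions.** For $U\in\wp_f(\mathcal V)$: $\theta_1\preceq_U\theta_2$ iff $\exists\delta\in\mathit{Subst}\ \forall u\in U.\ \theta_1(u)=\delta(\theta_2(u))$; $\theta_1\sim_U\theta_2$ iff $\exists\rho\in\mathit{Ren}\ \forall u\in U.\ \theta_1(u)=\rho(\theta_2(u))$. $[\theta]_U$ is the class of $\theta\in\mathit{ISubst}$ under $\sim_U$ (if $\theta$ is a non-idempotent substitution, $[\theta]_U$ is the class of any idempotent substitution $\sim_U$-equivalent to it; one always exists). $\mathit{ISubst}_{\sim_U}$ is the set of these classes. Operations: $\pi_V([\sigma]_U)=[\sigma]_{U\cap V}$; for a renaming $\rho$, $\rho([\sigma]_U)=[\rho\circ\sigma\circ\rho^{-1}]_{\rho(U)}$; $\mathrm{mgu}([\theta_1]_U,[\theta_2]_V)=[\mathrm{mgu}(\theta_1',\theta_2')]_{U\cup V}$, where $\theta_1\sim_U\theta_1'\in\mathit{ISubst}$, $\theta_2\sim_V\theta_2'\in\mathit{ISubst}$ and $(U\cup\mathrm{vars}(\theta_1'))\cap(V\cup\mathrm{vars}(\theta_2'))\subseteq U\cap V$ (undefined if $\theta_1',\theta_2'$ do not unify). These do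 not depend on representatives. **Concrete domain.** $\mathtt{Psub}=\{[\Theta,U]\mid\Theta\subseteq\mathit{ISubst}_{\sim_U},U\in\wp_f(\mathcal V)\}\cup\{\bot_{\mathrm{Ps}},\top_{\mathrm{Ps}}\}$, with bottom $\bot_{\mathrm{Ps}}$, top $\top_{\mathrm{Ps}}$ and $[\Theta_1,U_1]\sqsubseteq_{\mathrm{Ps}}[\Theta_2,U_2]$ iff $U_1=U_2$ and $\Theta_1\subseteq\Theta_2$; this is a complete lattice with join $\bigsqcup_{\mathrm{Ps}}$. Operators (each yields $\bot_{\mathrm{Ps}}$ if some argument is $\bot_{\mathrm{Ps}}$, otherwise $\top_{\mathrm{Ps}}$ if some argument is $\top_{\mathrm{Ps}}$; only defined mgu's are collected): $\rho([\Theta,U])=[\{\rho(c)\mid c\in\Theta\},\rho(U)]$; $\pi_{\mathrm{Ps}}([\Theta,U],V)=[\{\pi_V(c)\mid c\in\Theta\},U\cap V]$; for $\delta\in\mathit{ISubst}$, $\mathsf{unif}_{\mathrm{Ps}}([\Theta,U],\delta)=[\{\mathrm{mgu}(c,[\delta]_{\mathrm{vars}(\delta)})\mid c\in\Theta\},U\cup\mathrm{vars}(\delta)]$; $\mathsf{match}_{\mathrm{Ps}}([\Theta_1,U_1],[\Theta_2,U_2])=[\{\mathrm{mgu}([\theta_1]_{U_1},[\theta_2]_{U_2})\mid [\theta_i]_{U_i}\in\Theta_i,\ \theta_1\preceq_{U_1\cap U_2}\theta_2\},U_1\cup U_2]$. Forward unification: $\mathbf U^f_{\mathrm{Ps}}([\Theta,U],A_1,A_2)=\pi_{\mathrm{Ps}}(\mathsf{unif}_{\mathrm{Ps}}(\rho([\Theta,U]),\mathrm{mgu}(\rho(A_1)=A_2)),\mathrm{vars}(A_2))$,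 $\rho$ any renaming with $\rho(U\cup\mathrm{vars}(A_1))\cap\mathrm{vars}(A_2)=\emptyset$. Backward unification: $\mathbf U^b_{\mathrm{Ps}}([\Theta_1,U_1],[\Theta_2,U_2],A_1,A_2)=\pi_{\mathrm{Ps}}(\mathsf{match}_{\mathrm{Ps}}(\rho([\Theta_1,U_1]),\mathsf{unif}_{\mathrm{Ps}}([\Theta_2,U_2],\mathrm{mgu}(\rho(A_1)=A_2))),U_2\cup\mathrm{vars}(A_2))$, $\rho$ any renaming with $\rho(U_1\cup\mathrm{vars}(A_1))\cap(U_2\cup\mathrm{vars}(A_2))=\emptyset$. If $\rho(A_1)$ and $A_2$ do not unify the result of either operation is $\bot_{\mathrm{Ps}}$. The results do not depend on $\rho$. **Semantics.** A denotation is a map $d$ assigning to each atom a continuous map $\mathtt{Psub}\to\mathtt{Psub}$, ordered pointwise. For a denotation $d$, atom $A$ and $\chi\in\mathtt{Psub}$: $\mathcal B[\![\square]\!]\,d\,\chi=\chi$; $\mathcal B[\![A,B]\!]\,d\,\chi=\mathcal B[\![B]\!]\,d\,(d\,A\,\chi)$; $\mathcal C[\![H\leftarrow B]\!]\,d\,A\,\chi=\mathbf U^b_{\mathrm{Ps}}(\mathcal B[\![B]\!]\,d\,(\mathbf U^f_{\mathrm{Ps}}(\chi,A,H)),\chi,H,A)$; $\mathcal P[\![P]\!]$ is the least fixed point of $d\mapsto\bigsqcup_{\mathrm{Ps}}{}_{cl\in P}\,\mathcal C[\![cl]\!]\,d$ (join taken pointwise). **Computed answers.** For a goal $G=g_1\ldots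 g_k$ and a clause $cl=H\leftarrow B$ with $\mathrm{vars}(G)\cap\mathrm{vars}(cl)=\emptyset$, one has a step $G\to(g_1\ldots g_{i-1}\,B\,g_{i+1}\ldots g_k)\sigma$ with clause $cl$ and substitution $\sigma$ when $\sigma=\mathrm{mgu}(g_i=H)$. An SLD-derivation of $G$ in $P$ is a sequence of such steps with clauses $cl_1,\dots,cl_n$ and idempotent substitutions $\sigma_1,\dots,\sigma_n$, each $cl_i$ being a renaming of a clause of $P$ apart from $G,cl_1,\dots,cl_{i-1}$. A substitution $\theta$ is a computed answer for $G$ in $P$ if some SLD-derivation from $G$ ends in $\square$ and $\theta=(\sigma_n\circ\cdots\circ\sigma_1)_{|\mathrm{vars}(G)}$. *)

theory Defs
  imports "HOL-Library.Infinite_Typeclass" "HOL-Library.Complete_Partial_Order2"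
begin

section \<open>Signatures, terms, atoms, clauses\<close>

text \<open>
  A first-order signature is given by a type of function symbols and a type of predicate symbols,
  each with an arity. Raw terms and atoms need not respect arities; the \<open>wf\<close> predicates below
  single out those that do, and only well-formed terms occur in substitutions.
\<close>

class ranked =
  fixes arity :: "'a \<Rightarrow> nat"

class func_symbols = ranked +
  assumes ex_constant: "\<exists>c. arity c = 0"
    and ex_arity_ge_2: "\<exists>f. 2 \<le> arity f"

datatype (funs_trm: 'f, vars_trm: 'v) trm =
  Var 'v | Fun 'f "('f, 'v) trm list"

datatype ('p, 'f, 'v) atom = Atom 'p "('f, 'v) trm list"

datatype ('p, 'f, 'v) clause =
  Clause (head: "('p, 'f, 'v) atom") (body: "('p, 'f, 'v) atom list")

type_synonym ('f, 'v) subst = "'v \<Rightarrow> ('f, 'v) trm"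

fun wf_trm :: "('f::ranked, 'v) trm \<Rightarrow> bool" where
  "wf_trm (Var x) \<longleftrightarrow> True"
| "wf_trm (Fun f ts) \<longleftrightarrow> length ts = arity f \<and> (\<forall>t\<in>set ts. wf_trm t)"

primrec wf_atom :: "('p::ranked, 'f::ranked, 'v) atom \<Rightarrow> bool" where
  "wf_atom (Atom p ts) \<longleftrightarrow> length ts = arity p \<and> (\<forall>t\<in>set ts. wf_trm t)"

definition wf_goal :: "('p::ranked, 'f::ranked, 'v) atom list \<Rightarrow> bool" where
  "wf_goal G \<longleftrightarrow> (\<forall>A\<in>set G. wf_atom A)"

definition wf_program :: "('p::ranked, 'f::ranked, 'v) clause set \<Rightarrow> bool" where
  "wf_program P \<longleftrightarrow> (\<forall>cl\<in>P. wf_atom (head cl) \<and> wf_goal (body cl))"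

primrec vars_atom :: "('p, 'f, 'v) atom \<Rightarrow> 'v set" where
  "vars_atom (Atom p ts) = (\<Union>t\<in>set ts. vars_trm t)"

definition vars_goal :: "('p, 'f, 'v) atom list \<Rightarrow> 'v set" where
  "vars_goal G = (\<Union>A\<in>set G. vars_atom A)"

definition vars_clause :: "('p, 'f, 'v) clause \<Rightarrow> 'v set" where
  "vars_clause cl = vars_atom (head cl) \<union> vars_goal (body cl)"


section \<open>Substitutions\<close>

primrec app_trm :: "('f, 'v) subst \<Rightarrow> ('f, 'v) trm \<Rightarrow> ('f, 'v) trm" where
  "app_trm \<sigma> (Var x) = \<sigma> x"
| "app_trm \<sigma> (Fun f ts) = Fun f (map (app_trm \<sigma>) ts)"

primrec app_atom :: "('f, 'v) subst \<Rightarrow> ('p, 'f, 'v) atom \<Rightarrow> ('p, 'f, 'v) atom" where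
  "app_atom \<sigma> (Atom p ts) = Atom p (map (app_trm \<sigma>) ts)"

definition app_goal :: "('f, 'v) subst \<Rightarrow> ('p, 'f, 'v) atom list \<Rightarrow> ('p, 'f, 'v) atom list" where
  "app_goal \<sigma> = map (app_atom \<sigma>)"

definition app_clause :: "('f, 'v) subst \<Rightarrow> ('p, 'f, 'v) clause \<Rightarrow> ('p, 'f, 'v) clause" where
  "app_clause \<sigma> cl = Clause (app_atom \<sigma> (head cl)) (app_goal \<sigma> (body cl))"

definition subst_dom :: "('f, 'v) subst \<Rightarrow> 'v set" where
  "subst_dom \<theta> = {x. \<theta> x \<noteq> Var x}"

definition subst_rng :: "('f, 'v) subst \<Rightarrow> 'v set" where
  "subst_rng \<theta> = (\<Union>x\<in>subst_dom \<theta>. vars_trm (\<theta> x))"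

definition subst_vars :: "('f, 'v) subst \<Rightarrow> 'v set" where
  "subst_vars \<theta> = subst_dom \<theta> \<union> subst_rng \<theta>"

definition Subst :: "('f::ranked, 'v) subst set" where
  "Subst = {\<theta>. finite (subst_dom \<theta>) \<and> (\<forall>x. wf_trm (\<theta> x))}"

definition ISubst :: "('f::ranked, 'v) subst set" where
  "ISubst = {\<theta> \<in> Subst. subst_dom \<theta> \<inter> subst_rng \<theta> = {}}"

definition subst_comp :: "('f, 'v) subst \<Rightarrow> ('f, 'v) subst \<Rightarrow> ('f, 'v) subst"  (infixr "\<circ>\<^sub>s" 75) where
  "\<theta> \<circ>\<^sub>s \<delta> = (\<lambda>x. app_trm \<theta> (\<delta> x))"

definition subst_restrict :: "('f, 'v) subst \<Rightarrow> 'v set \<Rightarrow> ('f, 'v) subst" where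
  "subst_restrict \<theta> U = (\<lambda>x. if x \<in> U then \<theta> x else Var x)"

definition Ren :: "('f::ranked, 'v) subst set" where
  "Ren = {\<rho> \<in> Subst. \<exists>f. bij f \<and> \<rho> = (\<lambda>x. Var (f x))}"

definition ren_inv :: "('f, 'v) subst \<Rightarrow> ('f, 'v) subst" where
  "ren_inv \<rho> = (\<lambda>x. Var (THE y. \<rho> y = Var x))"

definition ren_vars :: "('f, 'v) subst \<Rightarrow> 'v set \<Rightarrow> 'v set" where
  "ren_vars \<rho> U = (\<Union>x\<in>U. vars_trm (\<rho> x))"


section \<open>Unification\<close>

text \<open>
  Here \<open>\<Sigma>\<close> is the set of all unifiers of the problem at hand and \<open>X\<close> the set of its variables.
\<close>

definition is_mgu :: "('f::ranked, 'v) subst set \<Rightarrow> 'v set \<Rightarrow> ('f, 'v) subst \<Rightarrow> bool" where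
  "is_mgu \<Sigma> X \<mu> \<longleftrightarrow>
     \<mu> \<in> ISubst \<and> \<mu> \<in> \<Sigma> \<and> (\<forall>\<sigma>\<in>\<Sigma>. \<exists>\<delta>\<in>Subst. \<sigma> = \<delta> \<circ>\<^sub>s \<mu>) \<and> subst_vars \<mu> \<subseteq> X"

definition eqs_unifiers :: "(('f::ranked, 'v) trm \<times> ('f, 'v) trm) set \<Rightarrow> ('f, 'v) subst set" where
  "eqs_unifiers E = {\<sigma> \<in> Subst. \<forall>(s, t)\<in>E. app_trm \<sigma> s = app_trm \<sigma> t}"

definition vars_eqs :: "(('f, 'v) trm \<times> ('f, 'v) trm) set \<Rightarrow> 'v set" where
  "vars_eqs E = (\<Union>(s, t)\<in>E. vars_trm s \<union> vars_trm t)"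

definition eqs_mgu :: "(('f::ranked, 'v) trm \<times> ('f, 'v) trm) set \<Rightarrow> ('f, 'v) subst" where
  "eqs_mgu E = (SOME \<mu>. is_mgu (eqs_unifiers E) (vars_eqs E) \<mu>)"

definition atom_unifiers ::
    "('p, 'f::ranked, 'v) atom \<Rightarrow> ('p, 'f, 'v) atom \<Rightarrow> ('f, 'v) subst set" where
  "atom_unifiers A B = {\<sigma> \<in> Subst. app_atom \<sigma> A = app_atom \<sigma> B}"

definition is_atom_mgu ::
    "('p, 'f::ranked, 'v) atom \<Rightarrow> ('p, 'f, 'v) atom \<Rightarrow> ('f, 'v) subst \<Rightarrow> bool" where
  "is_atom_mgu A B \<mu> \<longleftrightarrow> is_mgu (atom_unifiers A B) (vars_atom A \<union> vars_atom B) \<mu>"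

definition atom_mgu ::
    "('p, 'f::ranked, 'v) atom \<Rightarrow> ('p, 'f, 'v) atom \<Rightarrow> ('f, 'v) subst" where
  "atom_mgu A B = (SOME \<mu>. is_atom_mgu A B \<mu>)"

definition Eq :: "('f, 'v) subst \<Rightarrow> (('f, 'v) trm \<times> ('f, 'v) trm) set" where
  "Eq \<sigma> = {(Var x, \<sigma> x) | x. x \<in> subst_dom \<sigma>}"


section \<open>Existential substitutions\<close>

definition inst_on :: "'v set \<Rightarrow> ('f::ranked, 'v) subst \<Rightarrow> ('f, 'v) subst \<Rightarrow> bool" where
  "inst_on U \<theta>\<^sub>1 \<theta>\<^sub>2 \<longleftrightarrow> (\<exists>\<delta>\<in>Subst. \<forall>u\<in>U. \<theta>\<^sub>1 u = app_trm \<delta> (\<theta>\<^sub>2 u))"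

definition sim_on :: "'v set \<Rightarrow> ('f::ranked, 'v) subst \<Rightarrow> ('f, 'v) subst \<Rightarrow> bool" where
  "sim_on U \<theta>\<^sub>1 \<theta>\<^sub>2 \<longleftrightarrow> (\<exists>\<rho>\<in>Ren. \<forall>u\<in>U. \<theta>\<^sub>1 u = app_trm \<rho> (\<theta>\<^sub>2 u))"

text \<open>
  The class of \<open>\<theta>\<close> over \<open>U\<close>. It collects idempotent substitutions only, but \<open>\<theta>\<close> itself need not be
  idempotent: the class is then that of any idempotent substitution equivalent to \<open>\<theta>\<close>.
\<close>

definition ecls :: "'v set \<Rightarrow> ('f::ranked, 'v) subst \<Rightarrow> ('f, 'v) subst set" where
  "ecls U \<theta> = {\<theta>' \<in> ISubst. sim_on U \<theta> \<theta>'}"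

definition ESubst :: "'v set \<Rightarrow> ('f::ranked, 'v) subst set set" where
  "ESubst U = ecls U ` ISubst"

text \<open>
  The partial operation mgu on the classes of \<open>\<theta>\<^sub>1\<close> over \<open>U\<close> and \<open>\<theta>\<^sub>2\<close> over \<open>V\<close>, rendered as the set of
  its values over all admissible representatives: empty when undefined, otherwise a singleton,
  since the operation does not depend on representatives.
\<close>

definition emgu ::
    "'v set \<Rightarrow> ('f::ranked, 'v) subst \<Rightarrow> 'v set \<Rightarrow> ('f, 'v) subst \<Rightarrow> ('f, 'v) subst set set" where
  "emgu U \<theta>\<^sub>1 V \<theta>\<^sub>2 =
     {ecls (U \<union> V) (eqs_mgu (Eq \<theta>\<^sub>1' \<union> Eq \<theta>\<^sub>2')) | \<theta>\<^sub>1' \<theta>\<^sub>2'.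
        \<theta>\<^sub>1' \<in> ISubst \<and> sim_on U \<theta>\<^sub>1 \<theta>\<^sub>1' \<and> \<theta>\<^sub>2' \<in> ISubst \<and> sim_on V \<theta>\<^sub>2 \<theta>\<^sub>2' \<and>
        (U \<union> subst_vars \<theta>\<^sub>1') \<inter> (V \<union> subst_vars \<theta>\<^sub>2') \<subseteq> U \<inter> V \<and>
        eqs_unifiers (Eq \<theta>\<^sub>1' \<union> Eq \<theta>\<^sub>2') \<noteq> {}}"


section \<open>The concrete domain\<close>

datatype ('f, 'v) psub_rep =
  Bot_rep | Top_rep | Elem_rep "('f, 'v) subst set set" "'v set"

typedef (overloaded) ('f::ranked, 'v) psub =
  "{Bot_rep, Top_rep} \<union>
   {Elem_rep \<Theta> U | (\<Theta> :: ('f, 'v) subst set set) U. finite U \<and> \<Theta> \<subseteq> ESubst U}"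
  by blast

text \<open>Meaningful only for finite \<open>U\<close> and \<open>\<Theta> \<subseteq> ESubst U\<close>.\<close>

definition Elem :: "('f::ranked, 'v) subst set set \<Rightarrow> 'v set \<Rightarrow> ('f, 'v) psub" where
  "Elem \<Theta> U = Abs_psub (Elem_rep \<Theta> U)"

instantiation psub :: (ranked, type) complete_lattice
begin

definition bot_psub :: "('a, 'b) psub" where
  "bot_psub = Abs_psub Bot_rep"

definition top_psub :: "('a, 'b) psub" where
  "top_psub = Abs_psub Top_rep"

definition less_eq_psub :: "('a, 'b) psub \<Rightarrow> ('a, 'b) psub \<Rightarrow> bool" where
  "less_eq_psub x y \<longleftrightarrow>
     (case (Rep_psub x, Rep_psub y) of
        (Bot_rep, _) \<Rightarrow> True
      | (_, Top_rep) \<Rightarrow> True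
      | (Elem_rep \<Theta>\<^sub>1 U\<^sub>1, Elem_rep \<Theta>\<^sub>2 U\<^sub>2) \<Rightarrow> U\<^sub>1 = U\<^sub>2 \<and> \<Theta>\<^sub>1 \<subseteq> \<Theta>\<^sub>2
      | _ \<Rightarrow> False)"

definition less_psub :: "('a, 'b) psub \<Rightarrow> ('a, 'b) psub \<Rightarrow> bool" where
  "less_psub x y \<longleftrightarrow> x \<le> y \<and> \<not> y \<le> x"

definition Sup_psub :: "('a, 'b) psub set \<Rightarrow> ('a, 'b) psub" where
  "Sup_psub X =
     (if X \<subseteq> {bot} then bot
      else if \<exists>U. \<forall>x\<in>X - {bot}. \<exists>\<Theta>. Rep_psub x = Elem_rep \<Theta> U
      then let U = (THE U. \<forall>x\<in>X - {bot}. \<exists>\<Theta>. Rep_psub x = Elem_rep \<Theta> U)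
           in Elem (\<Union>{\<Theta>. \<exists>x\<in>X. Rep_psub x = Elem_rep \<Theta> U}) U
      else top)"

definition Inf_psub :: "('a, 'b) psub set \<Rightarrow> ('a, 'b) psub" where
  "Inf_psub X = Sup {l. \<forall>x\<in>X. l \<le> x}"

definition sup_psub :: "('a, 'b) psub \<Rightarrow> ('a, 'b) psub \<Rightarrow> ('a, 'b) psub" where
  "sup_psub x y = Sup {x, y}"

definition inf_psub :: "('a, 'b) psub \<Rightarrow> ('a, 'b) psub \<Rightarrow> ('a, 'b) psub" where
  "inf_psub x y = Inf {x, y}"

instance
proof
  note Rep = Rep_psub[unfolded Un_iff insert_iff empty_iff mem_Collect_eq]
  have Rep_bot: "Rep_psub (bot :: ('a, 'b) psub) = Bot_rep"
    and Rep_top: "Rep_psub (top :: ('a, 'b) psub) = Top_rep"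
    by (simp_all add: bot_psub_def top_psub_def Abs_psub_inverse)
  have Rep_Elem: "Rep_psub (Elem \<Theta> U :: ('a, 'b) psub) = Elem_rep \<Theta> U"
    if "finite U" "\<Theta> \<subseteq> ESubst U" for \<Theta> U
    using that by (simp add: Elem_def Abs_psub_inverse)
  have refl: "x \<le> x" for x :: "('a, 'b) psub"
    by (simp add: less_eq_psub_def split: psub_rep.splits)
  have trans: "x \<le> z" if "x \<le> y" "y \<le> z" for x y z :: "('a, 'b) psub"
    using that by (auto simp: less_eq_psub_def split: psub_rep.splits)
  have antisym: "x = y" if "x \<le> y" "y \<le> x" for x y :: "('a, 'b) psub"
    using that by (auto simp: less_eq_psub_def Rep_psub_inject[symmetric] split: psub_rep.splits)
  have bot_le: "bot \<le> x" for x :: "('a, 'b) psub"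
    by (simp add: less_eq_psub_def Rep_bot)
  have le_top: "x \<le> top" for x :: "('a, 'b) psub"
    by (simp add: less_eq_psub_def Rep_top split: psub_rep.splits)
  have not_bot: "Rep_psub x \<noteq> Bot_rep" if "x \<noteq> bot" for x :: "('a, 'b) psub"
    using that by (metis Rep_bot Rep_psub_inject)
  have lub: "(\<forall>x\<in>X. x \<le> Sup X) \<and> (\<forall>z. (\<forall>x\<in>X. x \<le> z) \<longrightarrow> Sup X \<le> z)"
    for X :: "('a, 'b) psub set"
  proof (cases "X \<subseteq> {bot}")
    case True
    then show ?thesis by (auto simp: Sup_psub_def refl bot_le)
  next
    case nbot: False
    then obtain x0 where x0: "x0 \<in> X" "x0 \<noteq> bot" by blast
    show ?thesis
    proof (cases "\<exists>U. \<forall>x\<in>X - {bot}. \<exists>\<Theta>. Rep_psub x = Elem_rep \<Theta> U")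
      case True
      then obtain U where U: "\<forall>x\<in>X - {bot}. \<exists>\<Theta>. Rep_psub x = Elem_rep \<Theta> U" by blast
      have the: "(THE U. \<forall>x\<in>X - {bot}. \<exists>\<Theta>. Rep_psub x = Elem_rep \<Theta> U) = U"
      proof (rule the_equality)
        fix U' assume U': "\<forall>x\<in>X - {bot}. \<exists>\<Theta>. Rep_psub x = Elem_rep \<Theta> U'"
        have "x0 \<in> X - {bot}" using x0 by simp
        with U U' show "U' = U" by (metis psub_rep.inject)
      qed (fact U)
      let ?T = "\<Union>{\<Theta>. \<exists>x\<in>X. Rep_psub x = Elem_rep \<Theta> U}"
      have S: "Sup X = Elem ?T U"
        unfolding Sup_psub_def the Let_def using nbot True by simp
      obtain \<Theta>0 where "Rep_psub x0 = Elem_rep \<Theta>0 U" using U x0 by blast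
      with Rep[of x0] have "finite U" by simp
      moreover have "?T \<subseteq> ESubst U"
      proof -
        have "\<Theta> \<subseteq> ESubst U" if "Rep_psub x = Elem_rep \<Theta> U" for x :: "('a, 'b) psub" and \<Theta>
          using Rep[of x] that by simp
        then show ?thesis by blast
      qed
      ultimately have RS: "Rep_psub (Sup X) = Elem_rep ?T U"
        unfolding S by (rule Rep_Elem)
      have "x \<le> Sup X" if x: "x \<in> X" for x
      proof (cases "x = bot")
        case False
        then obtain \<Theta> where "Rep_psub x = Elem_rep \<Theta> U" using U x by blast
        then show ?thesis using x by (auto simp: less_eq_psub_def RS)
      qed (simp add: bot_le)
      moreover have "Sup X \<le> z" if ub: "\<forall>x\<in>X. x \<le> z" for z
      proof (cases "Rep_psub z")
        case Bot_rep
        obtain \<Theta> where "Rep_psub x0 = Elem_rep \<Theta> U" using U x0 by blast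
        with ub[rule_format, OF x0(1)] Bot_rep show ?thesis by (simp add: less_eq_psub_def)
      next
        case Top_rep
        then show ?thesis by (simp add: less_eq_psub_def RS)
      next
        case (Elem_rep \<Theta>z Uz)
        obtain \<Theta> where "Rep_psub x0 = Elem_rep \<Theta> U" using U x0 by blast
        with ub[rule_format, OF x0(1)] Elem_rep have "Uz = U" by (simp add: less_eq_psub_def)
        moreover have "\<Theta>' \<subseteq> \<Theta>z" if "x \<in> X" "Rep_psub x = Elem_rep \<Theta>' U" for x \<Theta>'
          using ub[rule_format, OF that(1)] that(2) Elem_rep by (simp add: less_eq_psub_def)
        ultimately show ?thesis using Elem_rep by (auto simp: less_eq_psub_def RS)
      qed
      ultimately show ?thesis by blast
    next
      case False
      then have S: "Sup X = top" by (simp only: Sup_psub_def nbot if_False)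
      have "z = top" if ub: "\<forall>x\<in>X. x \<le> z" for z
      proof (cases "Rep_psub z")
        case Bot_rep
        with ub[rule_format, OF x0(1)] not_bot[OF x0(2)] show ?thesis
          by (simp add: less_eq_psub_def split: psub_rep.splits)
      next
        case Top_rep
        then show ?thesis by (metis Rep_psub_inject Rep_top)
      next
        case (Elem_rep \<Theta> U)
        have "\<exists>\<Theta>'. Rep_psub x = Elem_rep \<Theta>' U" if "x \<in> X - {bot}" for x
          using that ub[rule_format, of x] not_bot[of x] Elem_rep
          by (auto simp: less_eq_psub_def split: psub_rep.splits)
        with False show ?thesis by blast
      qed
      then show ?thesis unfolding S using le_top refl by metis
    qed
  qed
  have Sup1: "x \<le> Sup X" if "x \<in> X" for x :: "('a, 'b) psub" and X
    using lub[of X] that by simp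
  have Sup2: "Sup X \<le> z" if "\<And>x. x \<in> X \<Longrightarrow> x \<le> z" for z :: "('a, 'b) psub" and X
    using lub[of X] that by simp
  have Inf1: "Inf X \<le> x" if "x \<in> X" for x :: "('a, 'b) psub" and X
    unfolding Inf_psub_def by (rule Sup2) (use that in simp)
  have Inf2: "z \<le> Inf X" if "\<And>x. x \<in> X \<Longrightarrow> z \<le> x" for z :: "('a, 'b) psub" and X
    unfolding Inf_psub_def by (rule Sup1) (use that in simp)
  fix x y z :: "('a, 'b) psub" and X :: "('a, 'b) psub set"
  show "x < y \<longleftrightarrow> x \<le> y \<and> \<not> y \<le> x" by (simp add: less_psub_def)
  show "x \<le> x" by (fact refl)
  show "x \<le> y \<Longrightarrow> y \<le> z \<Longrightarrow> x \<le> z" by (fact trans)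
  show "x \<le> y \<Longrightarrow> y \<le> x \<Longrightarrow> x = y" by (fact antisym)
  show "x \<in> X \<Longrightarrow> x \<le> Sup X" by (fact Sup1)
  show "(\<And>x. x \<in> X \<Longrightarrow> x \<le> z) \<Longrightarrow> Sup X \<le> z" by (fact Sup2)
  show "x \<in> X \<Longrightarrow> Inf X \<le> x" by (fact Inf1)
  show "(\<And>x. x \<in> X \<Longrightarrow> z \<le> x) \<Longrightarrow> z \<le> Inf X" by (fact Inf2)
  show "inf x y \<le> x" "inf x y \<le> y"
    unfolding inf_psub_def by (simp_all add: Inf1)
  show "x \<le> inf y z" if "x \<le> y" "x \<le> z"
    unfolding inf_psub_def by (rule Inf2) (use that in auto)
  show "x \<le> sup x y" "y \<le> sup x y"
    unfolding sup_psub_def by (simp_all add: Sup1)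
  show "sup y z \<le> x" if "y \<le> x" "z \<le> x"
    unfolding sup_psub_def by (rule Sup2) (use that in auto)
  show "Inf ({} :: ('a, 'b) psub set) = top"
    by (rule antisym[OF le_top]) (rule Inf2, simp)
  show "Sup ({} :: ('a, 'b) psub set) = bot"
    by (simp add: Sup_psub_def)
qed

end


section \<open>Operators on the concrete domain\<close>

definition rename_ps :: "('f::ranked, 'v) subst \<Rightarrow> ('f, 'v) psub \<Rightarrow> ('f, 'v) psub" where
  "rename_ps \<rho> \<chi> =
     (case Rep_psub \<chi> of
        Bot_rep \<Rightarrow> bot
      | Top_rep \<Rightarrow> top
      | Elem_rep \<Theta> U \<Rightarrow>
          Elem {ecls (ren_vars \<rho> U) (\<rho> \<circ>\<^sub>s \<sigma> \<circ>\<^sub>s ren_inv \<rho>) | \<sigma>. \<sigma> \<in> ISubst \<and> ecls U \<sigma> \<in> \<Theta>}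
               (ren_vars \<rho> U))"

definition proj_ps :: "('f::ranked, 'v) psub \<Rightarrow> 'v set \<Rightarrow> ('f, 'v) psub" where
  "proj_ps \<chi> V =
     (case Rep_psub \<chi> of
        Bot_rep \<Rightarrow> bot
      | Top_rep \<Rightarrow> top
      | Elem_rep \<Theta> U \<Rightarrow>
          Elem {ecls (U \<inter> V) \<sigma> | \<sigma>. \<sigma> \<in> ISubst \<and> ecls U \<sigma> \<in> \<Theta>} (U \<inter> V))"

definition unif_ps :: "('f::ranked, 'v) psub \<Rightarrow> ('f, 'v) subst \<Rightarrow> ('f, 'v) psub" where
  "unif_ps \<chi> \<delta> =
     (case Rep_psub \<chi> of
        Bot_rep \<Rightarrow> bot
      | Top_rep \<Rightarrow> top
      | Elem_rep \<Theta> U \<Rightarrow>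
          Elem (\<Union>\<sigma>\<in>{\<sigma> \<in> ISubst. ecls U \<sigma> \<in> \<Theta>}. emgu U \<sigma> (subst_vars \<delta>) \<delta>)
               (U \<union> subst_vars \<delta>))"

definition match_ps :: "('f::ranked, 'v) psub \<Rightarrow> ('f, 'v) psub \<Rightarrow> ('f, 'v) psub" where
  "match_ps \<chi>\<^sub>1 \<chi>\<^sub>2 =
     (case (Rep_psub \<chi>\<^sub>1, Rep_psub \<chi>\<^sub>2) of
        (Bot_rep, _) \<Rightarrow> bot
      | (_, Bot_rep) \<Rightarrow> bot
      | (Top_rep, _) \<Rightarrow> top
      | (_, Top_rep) \<Rightarrow> top
      | (Elem_rep \<Theta>\<^sub>1 U\<^sub>1, Elem_rep \<Theta>\<^sub>2 U\<^sub>2) \<Rightarrow>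
          Elem (\<Union>(\<theta>\<^sub>1, \<theta>\<^sub>2)\<in>{(\<theta>\<^sub>1, \<theta>\<^sub>2). \<theta>\<^sub>1 \<in> ISubst \<and> ecls U\<^sub>1 \<theta>\<^sub>1 \<in> \<Theta>\<^sub>1 \<and>
                                   \<theta>\<^sub>2 \<in> ISubst \<and> ecls U\<^sub>2 \<theta>\<^sub>2 \<in> \<Theta>\<^sub>2 \<and>
                                   inst_on (U\<^sub>1 \<inter> U\<^sub>2) \<theta>\<^sub>1 \<theta>\<^sub>2}. emgu U\<^sub>1 \<theta>\<^sub>1 U\<^sub>2 \<theta>\<^sub>2)
               (U\<^sub>1 \<union> U\<^sub>2))"

definition vars_ps :: "('f::ranked, 'v) psub \<Rightarrow> 'v set" where
  "vars_ps \<chi> = (case Rep_psub \<chi> of Elem_rep \<Theta> U \<Rightarrow> U | _ \<Rightarrow> {})"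

text \<open>The results below do not depend on the choice of the renaming.\<close>

definition forward_ps ::
    "('f::ranked, 'v) psub \<Rightarrow> ('p, 'f, 'v) atom \<Rightarrow> ('p, 'f, 'v) atom \<Rightarrow> ('f, 'v) psub" where
  "forward_ps \<chi> A\<^sub>1 A\<^sub>2 =
     (let \<rho> = (SOME \<rho>. \<rho> \<in> Ren \<and> ren_vars \<rho> (vars_ps \<chi> \<union> vars_atom A\<^sub>1) \<inter> vars_atom A\<^sub>2 = {})
      in if atom_unifiers (app_atom \<rho> A\<^sub>1) A\<^sub>2 = {} then bot
         else proj_ps (unif_ps (rename_ps \<rho> \<chi>) (atom_mgu (app_atom \<rho> A\<^sub>1) A\<^sub>2)) (vars_atom A\<^sub>2))"

definition backward_ps ::
    "('f::ranked, 'v) psub \<Rightarrow> ('f, 'v) psub \<Rightarrow> ('p, 'f, 'v) atom \<Rightarrow> ('p, 'f, 'v) atom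
      \<Rightarrow> ('f, 'v) psub" where
  "backward_ps \<chi>\<^sub>1 \<chi>\<^sub>2 A\<^sub>1 A\<^sub>2 =
     (let \<rho> = (SOME \<rho>. \<rho> \<in> Ren \<and>
                 ren_vars \<rho> (vars_ps \<chi>\<^sub>1 \<union> vars_atom A\<^sub>1) \<inter> (vars_ps \<chi>\<^sub>2 \<union> vars_atom A\<^sub>2) = {})
      in if atom_unifiers (app_atom \<rho> A\<^sub>1) A\<^sub>2 = {} then bot
         else proj_ps (match_ps (rename_ps \<rho> \<chi>\<^sub>1)
                                (unif_ps \<chi>\<^sub>2 (atom_mgu (app_atom \<rho> A\<^sub>1) A\<^sub>2)))
                      (vars_ps \<chi>\<^sub>2 \<union> vars_atom A\<^sub>2))"


section \<open>Denotational semantics\<close>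

type_synonym ('p, 'f, 'v) denotation = "('p, 'f, 'v) atom \<Rightarrow> ('f, 'v) psub \<Rightarrow> ('f, 'v) psub"

text \<open>
  Continuity is preservation of the joins of all nonempty chains. The argument \<open>A\<close> ranges over raw
  atoms, but for a well-formed program this is harmless: an ill-formed atom unifies with no clause
  head, so its meaning under \<open>prog_sem\<close> below is \<open>bot\<close>, and no other atom depends on it.
\<close>

definition is_denotation :: "('p, 'f::ranked, 'v) denotation \<Rightarrow> bool" where
  "is_denotation d \<longleftrightarrow> (\<forall>A. mcont Sup (\<le>) Sup (\<le>) (d A))"

primrec body_sem ::
    "('p, 'f::ranked, 'v) atom list \<Rightarrow> ('p, 'f, 'v) denotation \<Rightarrow> ('f, 'v) psub \<Rightarrow> ('f, 'v) psub" where
  "body_sem [] d \<chi> = \<chi>"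
| "body_sem (A # B) d \<chi> = body_sem B d (d A \<chi>)"

definition clause_sem ::
    "('p, 'f::ranked, 'v) clause \<Rightarrow> ('p, 'f, 'v) denotation \<Rightarrow> ('p, 'f, 'v) denotation" where
  "clause_sem cl d A \<chi> =
     backward_ps (body_sem (body cl) d (forward_ps \<chi> A (head cl))) \<chi> (head cl) A"

text \<open>
  The least fixed point is taken among denotations: the operator is not monotone on arbitrary
  families of maps, so \<open>lfp\<close> on the full function space would not be adequate.
\<close>

definition prog_sem :: "('p, 'f::ranked, 'v) clause set \<Rightarrow> ('p, 'f, 'v) denotation" where
  "prog_sem P =
     (LEAST d. is_denotation d \<and> (\<lambda>A \<chi>. SUP cl\<in>P. clause_sem cl d A \<chi>) = d)"


section \<open>SLD-derivations and computed answers\<close>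

definition sld_step ::
    "('p, 'f::ranked, 'v) atom list \<Rightarrow> ('p, 'f, 'v) clause \<Rightarrow> ('f, 'v) subst
      \<Rightarrow> ('p, 'f, 'v) atom list \<Rightarrow> bool" where
  "sld_step G cl \<sigma> G' \<longleftrightarrow>
     vars_goal G \<inter> vars_clause cl = {} \<and>
     (\<exists>G\<^sub>1 g G\<^sub>2. G = G\<^sub>1 @ g # G\<^sub>2 \<and> is_atom_mgu g (head cl) \<sigma> \<and>
                G' = app_goal \<sigma> (G\<^sub>1 @ body cl @ G\<^sub>2))"

text \<open>\<open>sld P G G' cls \<sigma>s\<close>: a derivation from \<open>G\<close> to \<open>G'\<close> with clauses \<open>cls\<close> and unifiers \<open>\<sigma>s\<close>, in order.\<close>

inductive sld ::
    "('p, 'f::ranked, 'v) clause set \<Rightarrow> ('p, 'f, 'v) atom list \<Rightarrow> ('p, 'f, 'v) atom list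
      \<Rightarrow> ('p, 'f, 'v) clause list \<Rightarrow> ('f, 'v) subst list \<Rightarrow> bool"
  for P :: "('p, 'f, 'v) clause set" and G :: "('p, 'f, 'v) atom list" where
  sld_empty: "sld P G G [] []"
| sld_snoc: "sld P G G'' (cls @ [app_clause \<rho> cl]) (\<sigma>s @ [\<sigma>])"
    if "sld P G G' cls \<sigma>s"
      and "cl \<in> P" and "\<rho> \<in> Ren"
      and "vars_clause (app_clause \<rho> cl) \<inter> (vars_goal G \<union> (\<Union>c\<in>set cls. vars_clause c)) = {}"
      and "sld_step G' (app_clause \<rho> cl) \<sigma> G''"

definition computed_answer ::
    "('p, 'f::ranked, 'v) clause set \<Rightarrow> ('p, 'f, 'v) atom list \<Rightarrow> ('f, 'v) subst \<Rightarrow> bool" where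
  "computed_answer P G \<theta> \<longleftrightarrow>
     (\<exists>cls \<sigma>s. sld P G [] cls \<sigma>s \<and>
        \<theta> = subst_restrict (foldl (\<lambda>\<delta> \<sigma>. \<sigma> \<circ>\<^sub>s \<delta>) Var \<sigma>s) (vars_goal G))"

end

(*
  A class over U is determined by its solution set, the substitutions that are instances over U of a
  representative. On solution sets projection is cylindrification, renaming is preimage and mgu is
  intersection; so forward and backward unification have descriptions in which no renaming and no
  fresh representative is left.

  Dually, a computed answer is a most general unifier of the equations "selected atom = head" taken
  before any unifier is applied. These equations form a proof tree that does not remember the
  selection rule, so the tree can be traversed left to right as the denotational semantics does: by
  induction on its size, the semantics of a goal yields the class whose solutions are the solutions
  of the input that extend to a unifier of the equations. Since prog_sem is a LEAST over denotations, one
  must also know that all operators are continuous, which gives the least fixed point.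
*)
theory Submission
  imports Defs
begin

section \<open>Substitutions\<close>

text \<open>The operators discard classes that do not unify, and \<open>match_ps\<close> also
  discards pairs that fail its instance test. Intersection therefore describes them only where a
  common solution exists and the test is passed. Nonemptiness is carried as a hypothesis, and the
  composed unifiers of the derivation, which solve all equations at once, supply the witness. The
  test is passed because every exit solution of a clause body restricts to one that forward
  unification passed in. Since \<open>prog_sem\<close> joins the contributions of all clauses, no
  exact value is computed: one singleton is kept below the semantics, and monotonicity carries this
  bound along. The tree contains variants, while the semantics evaluates the clauses of
  \<open>P\<close> themselves. A subtree has to be renamed before the induction hypothesis applies,
  and a renamed subtree is no longer a subtree; hence the induction on size. For continuity the
  point is that the basic operators act on each class separately. What needs care is
  \<open>bot\<close>, \<open>top\<close> and the renamings, which are chosen from the variable set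
  of the argument.\<close>

lemma app_trm_comp: "app_trm (a \<circ>\<^sub>s b) t = app_trm a (app_trm b t)"
  by (induction t) (simp_all add: subst_comp_def)

lemma app_atom_comp: "app_atom (a \<circ>\<^sub>s b) A = app_atom a (app_atom b A)"
  by (cases A) (simp add: app_trm_comp)

lemma app_trm_Var [simp]: "app_trm Var t = t"
  by (induction t) (simp_all add: map_idI)

lemma app_atom_Var [simp]: "app_atom Var A = A"
  by (cases A) (simp add: map_idI)

lemma subst_comp_assoc: "(a \<circ>\<^sub>s b) \<circ>\<^sub>s c = a \<circ>\<^sub>s b \<circ>\<^sub>s c"
  by (simp add: subst_comp_def app_trm_comp[unfolded subst_comp_def])

lemma app_trm_eq_iff: "app_trm a t = app_trm b t \<longleftrightarrow> (\<forall>x\<in>vars_trm t. a x = b x)"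
  by (induction t) auto

lemma app_atom_eq_iff: "app_atom a A = app_atom b A \<longleftrightarrow> (\<forall>x\<in>vars_atom A. a x = b x)"
  by (cases A) (auto simp: app_trm_eq_iff)

lemma app_trm_idI: "(\<And>x. x \<in> vars_trm t \<Longrightarrow> a x = Var x) \<Longrightarrow> app_trm a t = t"
  using app_trm_eq_iff[of a t Var] by simp

lemma app_atom_idI: "(\<And>x. x \<in> vars_atom A \<Longrightarrow> a x = Var x) \<Longrightarrow> app_atom a A = A"
  using app_atom_eq_iff[of a A Var] by simp

lemma vars_app_trm: "vars_trm (app_trm a t) = (\<Union>x\<in>vars_trm t. vars_trm (a x))"
  by (induction t) auto

lemma vars_app_atom: "vars_atom (app_atom a A) = (\<Union>x\<in>vars_atom A. vars_trm (a x))"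
  by (cases A) (auto simp: vars_app_trm)

lemma finite_vars_trm [simp]: "finite (vars_trm t)"
  by (induction t) auto

lemma finite_vars_atom [simp]: "finite (vars_atom A)"
  by (cases A) auto

lemma finite_vars_goal [simp]: "finite (vars_goal G)"
  by (simp add: vars_goal_def)

lemma vars_goal_simps [simp]:
  "vars_goal [] = {}"
  "vars_goal (A # G) = vars_atom A \<union> vars_goal G"
  "vars_goal (G @ G') = vars_goal G \<union> vars_goal G'"
  by (auto simp: vars_goal_def)

lemma wf_app_trm: "(\<And>x. wf_trm (a x)) \<Longrightarrow> wf_trm t \<Longrightarrow> wf_trm (app_trm a t)"
  by (induction t) auto

lemma wf_app_trmD: "wf_trm (app_trm a t) \<Longrightarrow> wf_trm t"
  by (induction t) auto

lemma SubstI: "finite (subst_dom a) \<Longrightarrow> (\<And>x. wf_trm (a x)) \<Longrightarrow> a \<in> Subst"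
  by (simp add: Subst_def)

lemma SubstD: "a \<in> Subst \<Longrightarrow> finite (subst_dom a)" "a \<in> Subst \<Longrightarrow> wf_trm (a x)"
  by (simp_all add: Subst_def)

lemma Var_Subst [simp]: "Var \<in> Subst"
  by (simp add: Subst_def subst_dom_def)

lemma comp_Var [simp]: "a \<circ>\<^sub>s Var = a" "Var \<circ>\<^sub>s a = a"
  by (simp_all add: subst_comp_def)

lemma comp_apply: "(a \<circ>\<^sub>s b) x = app_trm a (b x)"
  by (simp add: subst_comp_def)

lemma Subst_comp [intro]: assumes "a \<in> Subst" "b \<in> Subst" shows "a \<circ>\<^sub>s b \<in> Subst"
proof (rule SubstI)
  have "subst_dom (a \<circ>\<^sub>s b) \<subseteq> subst_dom a \<union> subst_dom b"
    by (auto simp: subst_dom_def subst_comp_def)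
  then show "finite (subst_dom (a \<circ>\<^sub>s b))"
    using assms by (meson SubstD(1) finite_UnI finite_subset)
qed (simp add: subst_comp_def wf_app_trm assms SubstD(2))

text \<open>Two solutions that agree where their relevant variables overlap are merged into one.
  This replaces explicit reasoning about fresh variants in most of the proofs below.\<close>

definition glue :: "'v set \<Rightarrow> ('f, 'v) subst \<Rightarrow> ('f, 'v) subst \<Rightarrow> ('f, 'v) subst" where
  "glue X a b = (\<lambda>x. if x \<in> X then a x else b x)"

lemma glue_simps: "x \<in> X \<Longrightarrow> glue X a b x = a x" "x \<notin> X \<Longrightarrow> glue X a b x = b x"
  by (simp_all add: glue_def)

lemma Subst_glue [intro]: assumes "a \<in> Subst" "b \<in> Subst" shows "glue X a b \<in> Subst"
proof (rule SubstI)
  have "subst_dom (glue X a b) \<subseteq> subst_dom a \<union> subst_dom b"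
    by (auto simp: subst_dom_def glue_def)
  then show "finite (subst_dom (glue X a b))"
    using assms by (meson SubstD(1) finite_UnI finite_subset)
qed (simp add: glue_def assms SubstD(2))

lemma subst_vars_cases: "x \<notin> subst_vars a \<Longrightarrow> a x = Var x"
  by (simp add: subst_vars_def subst_dom_def)

lemma vars_subst_le: "x \<in> X \<Longrightarrow> vars_trm (a x) \<subseteq> X \<union> subst_vars a"
  by (cases "a x = Var x") (auto simp: subst_vars_def subst_rng_def subst_dom_def)

lemma finite_subst_vars [simp]: "a \<in> Subst \<Longrightarrow> finite (subst_vars a)"
  by (auto simp: subst_vars_def subst_rng_def dest: SubstD)

lemma subst_vars_subsetI:
  assumes "\<And>x. a x \<noteq> Var x \<Longrightarrow> x \<in> X \<and> vars_trm (a x) \<subseteq> X"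
  shows "subst_vars a \<subseteq> X"
  using assms by (auto simp: subst_vars_def subst_rng_def subst_dom_def)

lemma idempotent_iff: "subst_dom a \<inter> subst_rng a = {} \<longleftrightarrow> a \<circ>\<^sub>s a = a"
proof -
  have "a \<circ>\<^sub>s a = a \<longleftrightarrow> (\<forall>x. app_trm a (a x) = app_trm Var (a x))"
    by (auto simp: subst_comp_def fun_eq_iff)
  also have "\<dots> \<longleftrightarrow> (\<forall>x. \<forall>y\<in>vars_trm (a x). a y = Var y)"
    by (simp only: app_trm_eq_iff)
  also have "\<dots> \<longleftrightarrow> subst_dom a \<inter> subst_rng a = {}"
  proof -
    \<comment> \<open>A variable outside the domain is its own image, so ranging over all images
      instead of those of domain variables adds only fixed variables.\<close>
    have "y = x" if "y \<in> vars_trm (a x)" "a x = Var x" for x y using that by simp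
    then show ?thesis unfolding subst_dom_def subst_rng_def by blast
  qed
  finally show ?thesis by simp
qed

lemma ISubst_iff: "a \<in> ISubst \<longleftrightarrow> a \<in> Subst \<and> a \<circ>\<^sub>s a = a"
  by (simp add: ISubst_def idempotent_iff)

lemma ISubst_Subst: "a \<in> ISubst \<Longrightarrow> a \<in> Subst"
  by (simp add: ISubst_iff)


section \<open>Existence of most general unifiers\<close>

text \<open>
  The third conjunct is stronger than being most general up to some instantiation; it makes
  idempotence come for free.
\<close>

definition strong_mgu ::
    "(('f::ranked, 'v) trm \<times> ('f, 'v) trm) set \<Rightarrow> ('f, 'v) subst \<Rightarrow> bool" where
  "strong_mgu E \<mu> \<longleftrightarrow> \<mu> \<in> eqs_unifiers E \<and> subst_vars \<mu> \<subseteq> vars_eqs E \<and>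
     (\<forall>\<tau>\<in>eqs_unifiers E. \<tau> = \<tau> \<circ>\<^sub>s \<mu>)"

lemma strong_mgu_is_mgu: "strong_mgu E \<mu> \<Longrightarrow> is_mgu (eqs_unifiers E) (vars_eqs E) \<mu>"
  unfolding strong_mgu_def is_mgu_def ISubst_iff eqs_unifiers_def by force

lemma eqs_unifiers_insert:
  "\<tau> \<in> eqs_unifiers (insert (s, t) E) \<longleftrightarrow> app_trm \<tau> s = app_trm \<tau> t \<and> \<tau> \<in> eqs_unifiers E"
  by (auto simp: eqs_unifiers_def)

lemma vars_eqs_simps [simp]:
  "vars_eqs {} = {}"
  "vars_eqs (insert (s, t) E) = vars_trm s \<union> vars_trm t \<union> vars_eqs E"
  "vars_eqs (E \<union> E') = vars_eqs E \<union> vars_eqs E'"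
  by (auto simp: vars_eqs_def)

lemma finite_vars_eqs: "finite E \<Longrightarrow> finite (vars_eqs E)"
  by (auto simp: vars_eqs_def)

text \<open>Every term has positive size, so deleting or decomposing an equation lowers the total
  size; this serves as the second component of the termination measure for unification.\<close>

fun trm_size :: "('f, 'v) trm \<Rightarrow> nat" where
  "trm_size (Var x) = 1"
| "trm_size (Fun f ts) = Suc (sum_list (map trm_size ts))"

lemma trm_size_var_le: "x \<in> vars_trm t \<Longrightarrow> trm_size (a x) \<le> trm_size (app_trm a t)"
proof (induction t)
  case (Fun f ts)
  then obtain t where t: "t \<in> set ts" "x \<in> vars_trm t" by auto
  then have "trm_size (a x) \<le> trm_size (app_trm a t)" using Fun by blast
  also have "\<dots> \<le> sum_list (map trm_size (map (app_trm a) ts))"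
    using t by (intro member_le_sum_list) auto
  finally show ?case by (simp add: comp_def)
qed simp

text \<open>If \<open>x\<close> occurred strictly below the root of \<open>t\<close>, the term
  \<open>a x\<close> would be strictly smaller than \<open>app_trm a t\<close>.\<close>

lemma occurs_check:
  assumes "a x = app_trm a t" "x \<in> vars_trm t"
  shows "t = Var x"
proof (cases t)
  case (Fun f ts)
  then obtain u where u: "u \<in> set ts" "x \<in> vars_trm u" using assms by auto
  have "trm_size (a x) \<le> trm_size (app_trm a u)" using u trm_size_var_le by fast
  also have "\<dots> \<le> sum_list (map trm_size (map (app_trm a) ts))"
    using u by (intro member_le_sum_list) auto
  also have "\<dots> < trm_size (app_trm a t)" using Fun by (simp add: comp_def)
  finally show ?thesis using assms by simp
qed (use assms in auto)

definition single :: "'v \<Rightarrow> ('f, 'v) trm \<Rightarrow> ('f, 'v) subst" where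
  "single x t = Var(x := t)"

lemma comp_single: "\<tau> x = app_trm \<tau> t \<Longrightarrow> \<tau> \<circ>\<^sub>s single x t = \<tau>"
  by (auto simp: subst_comp_def single_def)

text \<open>Variable elimination. A unifier \<tau> of \<open>Var x\<close> and \<open>t\<close>
  absorbs the binding, \<open>\<tau> \<circ>\<^sub>s single x t = \<tau>\<close>, hence it also
  unifies the reduced equations, and \<open>\<tau> = \<tau> \<circ>\<^sub>s \<mu>\<close> passes to
  the composition.\<close>

lemma strong_mgu_elim:
  fixes E :: "(('f::ranked, 'v) trm \<times> ('f, 'v) trm) set"
  defines "E' \<equiv> \<lambda>x t. (\<lambda>(u, v). (app_trm (single x t) u, app_trm (single x t) v)) ` E"
  assumes \<mu>: "strong_mgu (E' x t) \<mu>" and x: "x \<notin> vars_trm t" and wf: "wf_trm t"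
  shows "strong_mgu (insert (Var x, t) E) (\<mu> \<circ>\<^sub>s single x t)"
proof -
  let ?s = "single x t"
  have s: "?s \<in> Subst"
    using wf by (intro SubstI) (auto simp: subst_dom_def single_def intro: finite_subset[of _ "{x}"])
  have \<mu>S: "\<mu> \<in> Subst" using \<mu> by (simp add: strong_mgu_def eqs_unifiers_def)
  have st: "app_trm ?s t = t" using x by (intro app_trm_idI) (auto simp: single_def)
  have un: "\<mu> \<circ>\<^sub>s ?s \<in> eqs_unifiers (insert (Var x, t) E)"
    unfolding eqs_unifiers_insert
  proof
    show "app_trm (\<mu> \<circ>\<^sub>s ?s) (Var x) = app_trm (\<mu> \<circ>\<^sub>s ?s) t"
      using st by (simp add: app_trm_comp) (simp add: comp_apply single_def)
    show "\<mu> \<circ>\<^sub>s ?s \<in> eqs_unifiers E"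
      using \<mu> s unfolding strong_mgu_def eqs_unifiers_def E'_def by (auto simp: app_trm_comp)
  qed
  have vE': "vars_eqs (E' x t) \<subseteq> vars_eqs E \<union> vars_trm t"
    unfolding E'_def vars_eqs_def by (fastforce simp: vars_app_trm single_def split: if_splits)
  have v\<mu>: "subst_vars \<mu> \<subseteq> vars_eqs E \<union> vars_trm t" using vE' \<mu> by (auto simp: strong_mgu_def)
  have "subst_vars (\<mu> \<circ>\<^sub>s ?s) \<subseteq> vars_eqs (insert (Var x, t) E)"
  proof (rule subst_vars_subsetI)
    fix y assume ne: "(\<mu> \<circ>\<^sub>s ?s) y \<noteq> Var y"
    show "y \<in> vars_eqs (insert (Var x, t) E) \<and> vars_trm ((\<mu> \<circ>\<^sub>s ?s) y) \<subseteq> vars_eqs (insert (Var x, t) E)"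
    proof (cases "y = x")
      case True
      then show ?thesis
        using v\<mu> vars_subst_le[of _ "vars_trm t" \<mu>] by (fastforce simp: comp_apply single_def vars_app_trm)
    next
      case False
      then have "\<mu> y \<noteq> Var y" using ne by (simp add: comp_apply single_def)
      then have "y \<in> subst_vars \<mu>" using subst_vars_cases by metis
      then show ?thesis
        using False v\<mu> vars_subst_le[of y "vars_eqs E \<union> vars_trm t" \<mu>]
        by (auto simp: comp_apply single_def)
    qed
  qed
  moreover have "\<tau> = \<tau> \<circ>\<^sub>s \<mu> \<circ>\<^sub>s ?s" if \<tau>: "\<tau> \<in> eqs_unifiers (insert (Var x, t) E)" for \<tau>
  proof -
    have ts: "\<tau> \<circ>\<^sub>s ?s = \<tau>" using \<tau> by (intro comp_single) (simp add: eqs_unifiers_insert)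
    then have "app_trm \<tau> (app_trm ?s u) = app_trm \<tau> u" for u by (metis app_trm_comp)
    then have "\<tau> \<in> eqs_unifiers (E' x t)"
      using \<tau> unfolding E'_def eqs_unifiers_def by auto
    then have "\<tau> = \<tau> \<circ>\<^sub>s \<mu>" using \<mu> by (auto simp: strong_mgu_def)
    then show ?thesis using ts by (metis subst_comp_assoc)
  qed
  ultimately show ?thesis using un by (auto simp: strong_mgu_def)
qed

text \<open>The classical unification algorithm as a well-founded induction: elimination lowers the
  number of variables, while deletion and decomposition keep within the variables and lower the
  size. Clash and occurs-check failure cannot arise since a unifier is given.\<close>

lemma strong_mgu_exists_list:
  fixes es :: "(('f::ranked, 'v) trm \<times> ('f, 'v) trm) list"
  shows "eqs_unifiers (set es) \<noteq> {} \<Longrightarrow> \<exists>\<mu>. strong_mgu (set es) \<mu>"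
proof (induction es rule: wf_induct[OF wf_measures[of "[\<lambda>es. card (vars_eqs (set es)),
      \<lambda>es. sum_list (map (\<lambda>(s, t). trm_size s + trm_size t) es)]"]])
  case (1 es)
  let ?sz = "\<lambda>es. sum_list (map (\<lambda>(s, t). trm_size s + trm_size t) es)"
  have IH: "\<exists>\<mu>. strong_mgu (set es') \<mu>"
    if "eqs_unifiers (set es') \<noteq> {}"
      "card (vars_eqs (set es')) < card (vars_eqs (set es)) \<or>
       vars_eqs (set es') \<subseteq> vars_eqs (set es) \<and> ?sz es' < ?sz es" for es' :: "(('f, 'v) trm \<times> ('f, 'v) trm) list"
  proof -
    have "card (vars_eqs (set es')) < card (vars_eqs (set es)) \<or>
       card (vars_eqs (set es')) = card (vars_eqs (set es)) \<and> ?sz es' < ?sz es"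
      using that(2) card_mono[OF finite_vars_eqs, of "set es" "vars_eqs (set es')"] by fastforce
    then show ?thesis using 1(1)[rule_format, of es'] that(1) by auto
  qed
  show ?case
  proof (cases es)
    case Nil
    then have "strong_mgu (set es) Var"
      by (simp add: strong_mgu_def eqs_unifiers_def subst_vars_def subst_dom_def subst_rng_def)
    then show ?thesis by blast
  next
    case (Cons e es1)
    obtain s t where e: "e = (s, t)" by force
    obtain \<tau> where \<tau>: "\<tau> \<in> eqs_unifiers (set es)" using 1(2) by blast
    then have \<tau>st: "app_trm \<tau> s = app_trm \<tau> t" and \<tau>1: "\<tau> \<in> eqs_unifiers (set es1)"
      and wf\<tau>: "\<And>u. wf_trm u \<Longrightarrow> wf_trm (app_trm \<tau> u)" "\<And>x. wf_trm (\<tau> x)"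
      unfolding Cons e list.set eqs_unifiers_insert
      by (auto simp: eqs_unifiers_def dest: SubstD(2) intro!: wf_app_trm)
    have elim: "\<exists>\<mu>. strong_mgu (insert (Var x, u) (set es1)) \<mu>"
      if xu: "\<tau> x = app_trm \<tau> u" "x \<in> vars_eqs (set es)" "vars_trm u \<subseteq> vars_eqs (set es)" "u \<noteq> Var x" for x u
    proof -
      have nx: "x \<notin> vars_trm u" using occurs_check[of \<tau>, OF xu(1)] xu(4) by blast
      \<comment> \<open>\<open>u\<close> is a raw term; it is well-formed because its instance
        \<open>\<tau> x\<close> is.\<close>
      have wfu: "wf_trm u" using xu(1) wf\<tau>(2) wf_app_trmD by metis
      let ?f = "\<lambda>(a, b). (app_trm (single x u) a, app_trm (single x u) b)"
      let ?es = "map ?f es1"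
      have "app_trm \<tau> (app_trm (single x u) a) = app_trm \<tau> a" for a
        using comp_single[OF xu(1)] by (metis app_trm_comp)
      then have u: "\<tau> \<in> eqs_unifiers (set ?es)" using \<tau>1 by (auto simp: eqs_unifiers_def)
      have "vars_eqs (set ?es) \<subseteq> vars_eqs (set es) - {x}"
        using nx xu(3) unfolding Cons vars_eqs_def
        by (fastforce simp: vars_app_trm single_def split: if_splits)
      then have "card (vars_eqs (set ?es)) < card (vars_eqs (set es))"
        using xu(2) by (intro psubset_card_mono finite_vars_eqs finite_set) blast
      then obtain \<mu> where "strong_mgu (set ?es) \<mu>" using IH[of ?es] u by blast
      then show ?thesis using strong_mgu_elim[of x u "set es1" \<mu>] nx wfu by auto
    qed
    show ?thesis
    proof (cases s)
      case s: (Var x)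
      show ?thesis
      proof (cases "t = Var x")
        case True
        have "\<exists>\<mu>. strong_mgu (set es1) \<mu>"
          using \<tau>1 by (intro IH) (auto simp: Cons e s True)
        then obtain \<mu> where "strong_mgu (set es1) \<mu>" by blast
        then have "strong_mgu (set es) \<mu>"
          by (auto simp: strong_mgu_def Cons e s True eqs_unifiers_insert)
        then show ?thesis by blast
      next
        case False
        then show ?thesis using elim[of x t] \<tau>st by (auto simp: Cons e s)
      qed
    next
      case s: (Fun f ss)
      show ?thesis
      proof (cases t)
        case t: (Var x)
        have "\<exists>\<mu>. strong_mgu (insert (Var x, s) (set es1)) \<mu>"
          using elim[of x s] \<tau>st by (auto simp: Cons e s t)
        \<comment> \<open>Elimination was stated with the variable on the left; reversing an
          equation changes neither unifiers nor variables.\<close>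
        moreover have "strong_mgu (insert (Var x, s) (set es1)) \<mu> \<longleftrightarrow> strong_mgu (set es) \<mu>" for \<mu>
          unfolding strong_mgu_def Cons e list.set t Ball_def eqs_unifiers_insert by auto
        ultimately show ?thesis by blast
      next
        case t: (Fun g ts)
        have fg: "f = g" and map_eq: "map (app_trm \<tau>) ss = map (app_trm \<tau>) ts"
          using \<tau>st by (auto simp: s t)
        then have len: "length ss = length ts" by (metis length_map)
        let ?es = "zip ss ts @ es1"
        have un: "app_trm a (Fun f ss) = app_trm a (Fun g ts) \<longleftrightarrow> (\<forall>(u, v)\<in>set (zip ss ts). app_trm a u = app_trm a v)" for a :: "('f, 'v) subst"
          using len fg by (induction ss ts rule: list_induct2) auto
        have uneq: "eqs_unifiers (set ?es) = eqs_unifiers (set es)"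
          unfolding Cons e list.set s t set_eq_iff eqs_unifiers_insert un
          by (auto simp: eqs_unifiers_def)
        have "(\<Union>(u, v)\<in>set (zip ss ts). vars_trm u \<union> vars_trm v) = vars_trm s \<union> vars_trm t"
          unfolding s t using len by (induction ss ts rule: list_induct2) auto
        then have veq: "vars_eqs (set ?es) = vars_eqs (set es)"
          unfolding Cons e by (simp add: vars_eqs_def)
        have "sum_list (map (\<lambda>(s, t). trm_size s + trm_size t) (zip ss ts)) < trm_size s + trm_size t"
          unfolding s t using len by (induction ss ts rule: list_induct2) auto
        then have "\<exists>\<mu>. strong_mgu (set ?es) \<mu>"
          using \<tau> veq uneq by (intro IH) (auto simp: Cons e)
        then show ?thesis by (simp only: strong_mgu_def uneq veq)
      qed
    qed
  qed
qed

lemma eqs_mgu_is_mgu: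
  assumes "finite E" "eqs_unifiers E \<noteq> {}"
  shows "is_mgu (eqs_unifiers E) (vars_eqs E) (eqs_mgu E)"
proof -
  obtain es where "E = set es" using assms(1) finite_list by blast
  then show ?thesis
    unfolding eqs_mgu_def using assms(2) strong_mgu_exists_list strong_mgu_is_mgu
    by (metis someI_ex)
qed

text \<open>Reduction to the equations between corresponding arguments. Raw atoms need not respect
  arities, so it is the given unifier that yields argument lists of equal length.\<close>

lemma atom_mgu_is_mgu:
  assumes "atom_unifiers A B \<noteq> {}"
  shows "is_atom_mgu A B (atom_mgu A B)"
proof -
  obtain p ss q ts where A: "A = Atom p ss" and B: "B = Atom q ts"
    by (metis atom.exhaust)
  obtain \<tau> where \<tau>: "\<tau> \<in> atom_unifiers A B" using assms by blast
  then have pq: "p = q" and len: "length ss = length ts"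
    by (auto simp: atom_unifiers_def A B dest: map_eq_imp_length_eq)
  have un: "app_atom a A = app_atom a B \<longleftrightarrow> (\<forall>(u, v)\<in>set (zip ss ts). app_trm a u = app_trm a v)" for a
    unfolding A B using len pq by (induction ss ts rule: list_induct2) auto
  have "vars_atom A \<union> vars_atom B = vars_eqs (set (zip ss ts))"
    unfolding A B vars_eqs_def using len by (induction ss ts rule: list_induct2) auto
  moreover have "atom_unifiers A B = eqs_unifiers (set (zip ss ts))"
    unfolding atom_unifiers_def eqs_unifiers_def un by simp
  ultimately have "\<exists>\<mu>. is_atom_mgu A B \<mu>"
    using assms eqs_mgu_is_mgu[of "set (zip ss ts)"] unfolding is_atom_mgu_def by auto
  then show ?thesis unfolding atom_mgu_def by (rule someI_ex)
qed


section \<open>Renamings\<close>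

lemma bij_extend:
  assumes fin: "finite Y" and inj: "inj_on g Y"
  shows "\<exists>f. bij f \<and> (\<forall>x\<in>Y. f x = g x) \<and> finite {x. f x \<noteq> x}"
proof -
  let ?A = "g ` Y - Y" and ?B = "Y - g ` Y"
  have "card (g ` Y) = card Y" using inj by (rule card_image)
  then have "card ?A = card ?B"
    using fin by (simp add: card_Diff_subset_Int Int_commute)
  then obtain h where h: "bij_betw h ?A ?B"
    using fin finite_same_card_bij[of ?A ?B] by auto
  let ?f = "\<lambda>x. if x \<in> Y then g x else if x \<in> ?A then h x else x"
  have "bij_betw ?f Y (g ` Y)"
    using inj bij_betw_cong[of Y ?f g "g ` Y"] by (simp add: bij_betw_def)
  moreover have "bij_betw ?f ?A ?B"
    using h bij_betw_cong[of ?A ?f h ?B] by simp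
  ultimately have "bij_betw ?f (Y \<union> ?A) (g ` Y \<union> ?B)"
    by (rule bij_betw_combine) auto
  moreover have "Y \<union> ?A = Y \<union> g ` Y" "g ` Y \<union> ?B = Y \<union> g ` Y" by auto
  ultimately have "bij_betw ?f (Y \<union> g ` Y) (Y \<union> g ` Y)" by simp
  moreover have "bij_betw ?f (- (Y \<union> g ` Y)) (- (Y \<union> g ` Y))"
    using bij_betw_cong[of "- (Y \<union> g ` Y)" ?f id] by simp
  ultimately have "bij_betw ?f ((Y \<union> g ` Y) \<union> - (Y \<union> g ` Y)) ((Y \<union> g ` Y) \<union> - (Y \<union> g ` Y))"
    by (rule bij_betw_combine) blast
  then have "bij ?f" by (simp only: Compl_partition)
  moreover have "finite {x. ?f x \<noteq> x}"
    using fin by (auto intro: finite_subset[of _ "Y \<union> g ` Y"])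
  ultimately show ?thesis by (intro exI[of _ ?f]) auto
qed

lemma RenI: "bij f \<Longrightarrow> finite {x. f x \<noteq> x} \<Longrightarrow> (\<lambda>x. Var (f x)) \<in> Ren"
  by (auto simp: Ren_def Subst_def subst_dom_def)

lemma RenE:
  assumes "\<rho> \<in> Ren"
  obtains f where "bij f" "finite {x. f x \<noteq> x}" "\<rho> = (\<lambda>x. Var (f x))"
  using assms by (auto simp: Ren_def Subst_def subst_dom_def)

lemma Ren_Subst: "\<rho> \<in> Ren \<Longrightarrow> \<rho> \<in> Subst"
  by (simp add: Ren_def)

lemma ren_inv_Var: "bij f \<Longrightarrow> ren_inv (\<lambda>x. Var (f x)) = (\<lambda>x. Var (inv f x))"
  unfolding ren_inv_def by (intro ext arg_cong[of _ _ Var] the_equality) (auto simp: bij_is_surj surj_f_inv_f bij_is_inj)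

lemma ren_inv:
  assumes "\<rho> \<in> Ren"
  shows "ren_inv \<rho> \<in> Ren" "\<rho> \<circ>\<^sub>s ren_inv \<rho> = Var" "ren_inv \<rho> \<circ>\<^sub>s \<rho> = Var"
proof -
  obtain f where f: "bij f" "finite {x. f x \<noteq> x}" "\<rho> = (\<lambda>x. Var (f x))"
    using assms by (rule RenE)
  have "{x. inv f x \<noteq> x} \<subseteq> {x. f x \<noteq> x}" using f(1) by auto (metis bij_inv_eq_iff)
  then have "finite {x. inv f x \<noteq> x}" using f(2) finite_subset by blast
  then show "ren_inv \<rho> \<in> Ren"
    using f(1) by (simp add: f(3) ren_inv_Var RenI bij_imp_bij_inv)
  show "\<rho> \<circ>\<^sub>s ren_inv \<rho> = Var" "ren_inv \<rho> \<circ>\<^sub>s \<rho> = Var"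
    using f(1) by (auto simp: f(3) ren_inv_Var subst_comp_def bij_is_surj surj_f_inv_f bij_is_inj)
qed

lemma ren_vars_iff: "\<rho> \<in> Ren \<Longrightarrow> x \<in> ren_vars \<rho> U \<longleftrightarrow> (\<exists>y\<in>U. \<rho> y = Var x)"
  by (auto simp: ren_vars_def elim!: RenE)

lemma finite_ren_vars [simp]: "finite U \<Longrightarrow> finite (ren_vars \<rho> U)"
  by (simp add: ren_vars_def)

lemma ren_vars_Un: "ren_vars \<rho> (U \<union> V) = ren_vars \<rho> U \<union> ren_vars \<rho> V"
  by (simp add: ren_vars_def)

lemma ren_vars_mono: "U \<subseteq> V \<Longrightarrow> ren_vars \<rho> U \<subseteq> ren_vars \<rho> V"
  by (auto simp: ren_vars_def)

lemma ren_vars_disjoint: 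
  assumes "\<rho> \<in> Ren" "U \<inter> V = {}"
  shows "ren_vars \<rho> U \<inter> ren_vars \<rho> V = {}"
  using assms by (auto simp: ren_vars_def bij_def inj_eq elim!: RenE)

lemma vars_app_atom_ren: "vars_atom (app_atom \<rho> A) = ren_vars \<rho> (vars_atom A)"
  by (simp add: vars_app_atom ren_vars_def)

lemma ren_inv_ren_vars: "\<rho> \<in> Ren \<Longrightarrow> ren_vars (ren_inv \<rho>) (ren_vars \<rho> U) = U"
  by (auto simp: ren_vars_def ren_inv_Var bij_is_inj elim!: RenE)

lemma comp_ren_inv_apply: "\<rho> \<in> Ren \<Longrightarrow> \<rho> y = Var x \<Longrightarrow> (\<tau> \<circ>\<^sub>s ren_inv \<rho>) x = \<tau> y"
  by (auto simp: comp_apply ren_inv_Var bij_is_inj elim!: RenE)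

text \<open>Infinity of the variables provides a copy of \<open>X\<close> outside \<open>Y\<close>;
  an injection onto it extends to a finitely supported permutation.\<close>

lemma ex_Ren_apart:
  fixes X Y :: "'v::infinite set"
  assumes "finite X" "finite Y"
  shows "\<exists>\<rho> :: ('f::ranked, 'v) subst. \<rho> \<in> Ren \<and> ren_vars \<rho> X \<inter> Y = {}"
proof -
  have "infinite (UNIV - Y)" using assms(2) infinite_UNIV by (rule Diff_infinite_finite)
  then obtain Z where Z: "finite Z" "card Z = card X" "Z \<subseteq> UNIV - Y"
    using infinite_arbitrarily_large by metis
  then obtain g where g: "bij_betw g X Z"
    using assms(1) finite_same_card_bij[of X Z] by auto
  then obtain f where f: "bij f" "\<forall>x\<in>X. f x = g x" "finite {x. f x \<noteq> x}"
    using bij_extend[OF assms(1)] unfolding bij_betw_def by metis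
  have "ren_vars (\<lambda>x. Var (f x)) X = g ` X" using f(2) by (auto simp: ren_vars_def)
  also have "\<dots> \<subseteq> - Y" using g Z by (auto simp: bij_betw_def)
  finally show ?thesis using f by (blast intro: RenI)
qed


section \<open>Solution sets\<close>

definition Sol :: "'v set \<Rightarrow> ('f::ranked, 'v) subst \<Rightarrow> ('f, 'v) subst set" where
  "Sol U \<theta> = {\<tau> \<in> Subst. inst_on U \<tau> \<theta>}"

lemma inst_on_refl [simp]: "inst_on U a a"
  unfolding inst_on_def by (rule bexI[of _ Var]) auto

lemma inst_on_trans: "inst_on U a b \<Longrightarrow> inst_on U b c \<Longrightarrow> inst_on U a c"
  unfolding inst_on_def by (metis Subst_comp app_trm_comp)

lemma Sol_self: "a \<in> Subst \<Longrightarrow> a \<in> Sol U a"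
  by (simp add: Sol_def)

lemma Sol_Subst: "\<tau> \<in> Sol U a \<Longrightarrow> \<tau> \<in> Subst"
  by (simp add: Sol_def)

lemma Sol_cong: "\<tau> \<in> Sol U a \<Longrightarrow> \<tau>' \<in> Subst \<Longrightarrow> (\<And>u. u \<in> U \<Longrightarrow> \<tau>' u = \<tau> u) \<Longrightarrow> \<tau>' \<in> Sol U a"
  by (simp add: Sol_def inst_on_def)

text \<open>\<open>Sol U a\<close> is the principal lower set of \<open>a\<close> in the preorder
  \<open>inst_on U\<close>; testing the inclusion on \<open>a\<close> itself gives the
  comparison.\<close>

lemma Sol_subset_iff: "a \<in> Subst \<Longrightarrow> Sol U a \<subseteq> Sol U b \<longleftrightarrow> inst_on U a b"
  unfolding Sol_def using inst_on_trans by fastforce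

lemma Sol_comp: "a \<in> Subst \<Longrightarrow> \<delta> \<in> Subst \<Longrightarrow> \<delta> \<circ>\<^sub>s a \<in> Sol U a"
  by (auto simp: Sol_def inst_on_def comp_apply)

lemma SolE:
  assumes "\<tau> \<in> Sol U a"
  obtains \<delta> where "\<delta> \<in> Subst" "\<forall>u\<in>U. \<tau> u = (\<delta> \<circ>\<^sub>s a) u"
  using assms by (auto simp: Sol_def inst_on_def comp_apply)

text \<open>
  Two substitutions that are instances of each other over a finite set differ by an injective
  variable map there, and such a map extends to a renaming.
\<close>

lemma sim_on_iff_Sol:
  assumes fin: "finite U" and ab: "a \<in> Subst" "b \<in> Subst"
  shows "sim_on U a b \<longleftrightarrow> Sol U a = Sol U b"
proof
  assume "sim_on U a b"
  then obtain \<rho> where \<rho>: "\<rho> \<in> Ren" "\<forall>u\<in>U. a u = app_trm \<rho> (b u)" by (auto simp: sim_on_def)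
  have "\<forall>u\<in>U. b u = app_trm (ren_inv \<rho>) (a u)"
    using \<rho> by (metis app_trm_comp ren_inv(3) app_trm_Var)
  then have "inst_on U a b" "inst_on U b a"
    using \<rho> ren_inv(1)[OF \<rho>(1)] by (auto simp: inst_on_def dest: Ren_Subst)
  then show "Sol U a = Sol U b" using ab by (simp add: Sol_subset_iff[symmetric])
next
  assume "Sol U a = Sol U b"
  then have "inst_on U a b" "inst_on U b a" using ab by (simp_all add: Sol_subset_iff[symmetric])
  then obtain \<alpha> \<beta> where \<alpha>: "\<forall>u\<in>U. a u = app_trm \<alpha> (b u)" and \<beta>: "\<forall>u\<in>U. b u = app_trm \<beta> (a u)"
    unfolding inst_on_def by blast
  define Y where "Y = (\<Union>u\<in>U. vars_trm (b u))"
  \<comment> \<open>On the variables of the images of \<open>b\<close> the composition of \<alpha>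
    and \<beta> is the identity. A term that \<beta> sends to a variable is a variable, so \<alpha>
    is a variable map there, and it is injective.\<close>
  have inv: "app_trm \<beta> (\<alpha> y) = Var y" if y: "y \<in> Y" for y
  proof -
    obtain u where u: "u \<in> U" "y \<in> vars_trm (b u)" using y by (auto simp: Y_def)
    have "app_trm (\<beta> \<circ>\<^sub>s \<alpha>) (b u) = app_trm Var (b u)" using bspec[OF \<alpha> u(1)] bspec[OF \<beta> u(1)] by (simp add: app_trm_comp)
    then show ?thesis using u(2) unfolding app_trm_eq_iff by (simp add: comp_apply)
  qed
  define g where "g = (\<lambda>y. SOME x. \<alpha> y = Var x)"
  have g: "\<alpha> y = Var (g y)" if "y \<in> Y" for y
  proof -
    have "\<exists>x. \<alpha> y = Var x" using inv[OF that] by (cases "\<alpha> y") auto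
    then show ?thesis unfolding g_def by (rule someI_ex)
  qed
  have "inj_on g Y" by (rule inj_onI) (metis g inv trm.inject(1))
  moreover have "finite Y" using fin by (simp add: Y_def)
  ultimately obtain f where f: "bij f" "\<forall>x\<in>Y. f x = g x" "finite {x. f x \<noteq> x}"
    using bij_extend by metis
  have "\<forall>u\<in>U. a u = app_trm (\<lambda>x. Var (f x)) (b u)"
  proof
    fix u assume u: "u \<in> U"
    then have "vars_trm (b u) \<subseteq> Y" by (auto simp: Y_def)
    then show "a u = app_trm (\<lambda>x. Var (f x)) (b u)"
      unfolding bspec[OF \<alpha> u] app_trm_eq_iff using f(2) g by auto
  qed
  then show "sim_on U a b" unfolding sim_on_def using RenI[OF f(1,3)] by blast
qed

lemma subst_restrict_outside: "x \<notin> U \<Longrightarrow> subst_restrict \<theta> U x = Var x"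
  by (simp add: subst_restrict_def)

text \<open>Restrict \<theta> to \<open>U\<close> and rename its image variables away from both
  \<open>U\<close> and \<open>X\<close>. The renaming preserves the solution set, and since the new
  range avoids \<open>U\<close>, which contains the domain, the result is idempotent.\<close>

lemma fresh_representative:
  fixes \<theta> :: "('f::ranked, 'v::infinite) subst"
  assumes \<theta>: "\<theta> \<in> Subst" and fin: "finite U" "finite X"
  obtains \<theta>' where "\<theta>' \<in> ISubst" "Sol U \<theta>' = Sol U \<theta>" "subst_vars \<theta>' \<inter> X \<subseteq> U"
proof -
  let ?Z = "\<Union>u\<in>U. vars_trm (\<theta> u)"
  have "finite ?Z" using fin by simp
  then obtain \<rho> :: "('f, 'v) subst" where \<rho>: "\<rho> \<in> Ren" "ren_vars \<rho> ?Z \<inter> (U \<union> X) = {}"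
    using ex_Ren_apart[of ?Z "U \<union> X"] fin by blast
  let ?t = "subst_restrict (\<rho> \<circ>\<^sub>s \<theta>) U"
  have vt: "vars_trm (?t u) \<subseteq> ren_vars \<rho> ?Z" if "u \<in> U" for u
    using that by (auto simp: subst_restrict_def comp_apply vars_app_trm ren_vars_def)
  have "\<rho> \<circ>\<^sub>s \<theta> \<in> Subst" using \<theta> \<rho> Ren_Subst by blast
  then have tS: "?t \<in> Subst"
    using Subst_glue[of "\<rho> \<circ>\<^sub>s \<theta>" Var U] by (simp add: glue_def subst_restrict_def)
  have "?t \<circ>\<^sub>s ?t = ?t"
  proof
    fix x
    show "(?t \<circ>\<^sub>s ?t) x = ?t x"
    proof (cases "x \<in> U")
      case True
      then have "y \<notin> U" if "y \<in> vars_trm (?t x)" for y using vt[OF True] \<rho>(2) that by blast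
      then have "app_trm ?t (?t x) = ?t x"
        by (intro app_trm_idI) (rule subst_restrict_outside, blast)
      then show ?thesis by (subst comp_apply)
    qed (simp add: comp_apply subst_restrict_def)
  qed
  then have "?t \<in> ISubst" using tS by (simp add: ISubst_iff)
  moreover have "sim_on U ?t \<theta>"
    unfolding sim_on_def using \<rho>(1) by (auto simp: subst_restrict_def comp_apply)
  then have "Sol U ?t = Sol U \<theta>" using sim_on_iff_Sol fin tS \<theta> by blast
  moreover have "subst_vars ?t \<subseteq> U \<union> ren_vars \<rho> ?Z"
  proof (rule subst_vars_subsetI)
    fix x assume "?t x \<noteq> Var x"
    then have "x \<in> U" by (auto simp: subst_restrict_def split: if_splits)
    then show "x \<in> U \<union> ren_vars \<rho> ?Z \<and> vars_trm (?t x) \<subseteq> U \<union> ren_vars \<rho> ?Z" using vt by blast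
  qed
  then have "subst_vars ?t \<inter> X \<subseteq> U" using \<rho>(2) by blast
  ultimately show ?thesis using that by blast
qed

text \<open>A class contains idempotent members only, so \<open>a\<close> need not belong to its own
  class; a fresh representative shows that the class is nonempty, without which equal classes would
  say nothing about solution sets.\<close>

lemma ecls_eq_iff:
  fixes a b :: "('f::ranked, 'v::infinite) subst"
  assumes fin: "finite U" and ab: "a \<in> Subst" "b \<in> Subst"
  shows "ecls U a = ecls U b \<longleftrightarrow> Sol U a = Sol U b"
proof -
  have e: "ecls U c = {\<theta> \<in> ISubst. Sol U c = Sol U \<theta>}" if "c \<in> Subst" for c :: "('f, 'v) subst"
    unfolding ecls_def using that fin by (auto simp: sim_on_iff_Sol ISubst_Subst)
  obtain c where "c \<in> ISubst" "Sol U c = Sol U a" using fresh_representative[OF ab(1) fin fin] by blast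
  then show ?thesis by (auto simp: e ab)
qed

lemma ecls_ESubst:
  fixes a :: "('f::ranked, 'v::infinite) subst"
  assumes "finite U" "a \<in> Subst"
  shows "ecls U a \<in> ESubst U"
proof -
  obtain c where "c \<in> ISubst" "Sol U c = Sol U a" 
    using fresh_representative[OF assms(2,1,1)] by blast
  then have "ecls U a = ecls U c" using assms by (simp add: ecls_eq_iff ISubst_Subst)
  then show ?thesis using \<open>c \<in> ISubst\<close> by (auto simp: ESubst_def)
qed

text \<open>Every unifier factors through \<mu>, and every instance of \<mu> is a unifier;
  restriction to \<open>U\<close> then turns unifiers into a cylinder. Only closure under instances
  is used of \<Sigma>, so the lemma serves equations and atoms alike.\<close>

lemma Sol_mgu:
  assumes "is_mgu \<Sigma> X \<mu>" and closed: "\<And>\<sigma> \<delta>. \<sigma> \<in> \<Sigma> \<Longrightarrow> \<delta> \<in> Subst \<Longrightarrow> \<delta> \<circ>\<^sub>s \<sigma> \<in> \<Sigma>"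
  shows "Sol U \<mu> = {\<tau> \<in> Subst. \<exists>\<tau>'\<in>\<Sigma>. \<forall>u\<in>U. \<tau>' u = \<tau> u}"
proof -
  have \<mu>: "\<mu> \<in> \<Sigma>" and mg: "\<And>\<sigma>. \<sigma> \<in> \<Sigma> \<Longrightarrow> \<exists>\<delta>\<in>Subst. \<sigma> = \<delta> \<circ>\<^sub>s \<mu>" 
    using assms(1) by (auto simp: is_mgu_def)
  show ?thesis
  proof (intro set_eqI iffI)
    fix \<tau> assume \<tau>: "\<tau> \<in> Sol U \<mu>"
    then obtain \<delta> where "\<delta> \<in> Subst" "\<forall>u\<in>U. \<tau> u = (\<delta> \<circ>\<^sub>s \<mu>) u" by (rule SolE)
    then show "\<tau> \<in> {\<tau> \<in> Subst. \<exists>\<tau>'\<in>\<Sigma>. \<forall>u\<in>U. \<tau>' u = \<tau> u}"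
      using Sol_Subst[OF \<tau>] closed[OF \<mu>] by auto
  next
    fix \<tau> assume "\<tau> \<in> {\<tau> \<in> Subst. \<exists>\<tau>'\<in>\<Sigma>. \<forall>u\<in>U. \<tau>' u = \<tau> u}"
    then obtain \<tau>' where "\<tau> \<in> Subst" "\<tau>' \<in> \<Sigma>" "\<forall>u\<in>U. \<tau>' u = \<tau> u" by blast
    moreover obtain \<delta> where "\<delta> \<in> Subst" "\<tau>' = \<delta> \<circ>\<^sub>s \<mu>" using mg calculation(2) by blast
    ultimately show "\<tau> \<in> Sol U \<mu>"
      by (auto simp: Sol_def inst_on_def comp_apply intro!: bexI[of _ \<delta>])
  qed
qed

section \<open>Unifiers of equations, and mgu of classes as intersection\<close>

lemma eqs_unifiers_comp: "\<sigma> \<in> eqs_unifiers E \<Longrightarrow> \<delta> \<in> Subst \<Longrightarrow> \<delta> \<circ>\<^sub>s \<sigma> \<in> eqs_unifiers E"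
  by (fastforce simp: eqs_unifiers_def app_trm_comp)

lemma atom_unifiers_comp: "\<sigma> \<in> atom_unifiers A B \<Longrightarrow> \<delta> \<in> Subst \<Longrightarrow> \<delta> \<circ>\<^sub>s \<sigma> \<in> atom_unifiers A B"
  by (auto simp: atom_unifiers_def app_atom_comp)

lemma eqs_unifiers_Un: "eqs_unifiers (E \<union> E') = eqs_unifiers E \<inter> eqs_unifiers E'"
  by (auto simp: eqs_unifiers_def)

lemma eqs_unifiers_Eq_iff:
  "\<tau> \<in> eqs_unifiers (Eq \<theta>) \<longleftrightarrow> \<tau> \<in> Subst \<and> (\<forall>x\<in>subst_dom \<theta>. \<tau> x = app_trm \<tau> (\<theta> x))"
  by (force simp: eqs_unifiers_def Eq_def)

lemma eqs_unifiers_Eq: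
  assumes "\<tau> \<in> Subst"
  shows "\<tau> \<in> eqs_unifiers (Eq \<theta>) \<longleftrightarrow> \<tau> \<circ>\<^sub>s \<theta> = \<tau>"
proof -
  have "\<tau> \<in> eqs_unifiers (Eq \<theta>) \<longleftrightarrow> (\<forall>x\<in>subst_dom \<theta>. \<tau> x = app_trm \<tau> (\<theta> x))"
    using assms by (simp add: eqs_unifiers_Eq_iff)
  also have "\<dots> \<longleftrightarrow> (\<forall>x. \<tau> x = app_trm \<tau> (\<theta> x))"
    by (auto simp: subst_dom_def) (metis app_trm.simps(1))
  finally show ?thesis by (auto simp: fun_eq_iff comp_apply)
qed

lemma finite_Eq: "\<theta> \<in> Subst \<Longrightarrow> finite (Eq \<theta>)"
  by (auto simp: Eq_def dest: SubstD(1))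

text \<open>An idempotent \<theta> is a most general unifier of its own equations: \<theta> solves
  them, and a unifier \<sigma> satisfies
  \<open>\<sigma> = \<sigma> \<circ>\<^sub>s \<theta>\<close>.\<close>

lemma Sol_Eq:
  assumes "\<theta> \<in> ISubst"
  shows "Sol U \<theta> = {\<tau> \<in> Subst. \<exists>\<tau>'\<in>eqs_unifiers (Eq \<theta>). \<forall>u\<in>U. \<tau>' u = \<tau> u}"
proof (rule Sol_mgu[of _ "subst_vars \<theta>"])
  have "\<theta> \<in> Subst" "\<theta> \<circ>\<^sub>s \<theta> = \<theta>" using assms by (auto simp: ISubst_iff)
  moreover have "\<exists>\<delta>\<in>Subst. \<sigma> = \<delta> \<circ>\<^sub>s \<theta>" if "\<sigma> \<in> eqs_unifiers (Eq \<theta>)" for \<sigma>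
  proof -
    have "\<sigma> \<in> Subst" using that by (simp add: eqs_unifiers_def)
    then show ?thesis using that by (auto simp: eqs_unifiers_Eq intro!: bexI[of _ \<sigma>])
  qed
  ultimately show "is_mgu (eqs_unifiers (Eq \<theta>)) (subst_vars \<theta>) \<theta>"
    using assms by (auto simp: is_mgu_def eqs_unifiers_Eq)
qed (rule eqs_unifiers_comp)

lemma eqs_unifiers_Eq_cong:
  assumes "\<tau> \<in> eqs_unifiers (Eq \<theta>)" "\<tau>' \<in> Subst" "\<And>x. x \<in> subst_vars \<theta> \<Longrightarrow> \<tau>' x = \<tau> x"
  shows "\<tau>' \<in> eqs_unifiers (Eq \<theta>)"
proof -
  have "app_trm \<tau>' (\<theta> x) = app_trm \<tau> (\<theta> x)" "\<tau>' x = \<tau> x" if "x \<in> subst_dom \<theta>" for x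
    using assms(3) that by (auto simp: app_trm_eq_iff subst_vars_def subst_rng_def)
  then show ?thesis using assms(1,2) by (simp add: eqs_unifiers_Eq_iff)
qed

text \<open>A common solution \<tau> comes with two separate extensions, one to a unifier of each
  equation set. Apartness says that their variables overlap only in \<open>U \<inter> V\<close>,
  where both extensions equal \<tau>, so they can be glued.\<close>

lemma emgu_representatives:
  assumes \<theta>: "\<theta>\<^sub>1 \<in> ISubst" "\<theta>\<^sub>2 \<in> ISubst"
    and apart: "(U \<union> subst_vars \<theta>\<^sub>1) \<inter> (V \<union> subst_vars \<theta>\<^sub>2) \<subseteq> U \<inter> V"
  shows "(\<exists>\<tau>'\<in>eqs_unifiers (Eq \<theta>\<^sub>1 \<union> Eq \<theta>\<^sub>2). \<forall>u\<in>U \<union> V. \<tau>' u = \<tau> u) \<and> \<tau> \<in> Subst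
    \<longleftrightarrow> \<tau> \<in> Sol U \<theta>\<^sub>1 \<inter> Sol V \<theta>\<^sub>2"
proof
  assume "(\<exists>\<tau>'\<in>eqs_unifiers (Eq \<theta>\<^sub>1 \<union> Eq \<theta>\<^sub>2). \<forall>u\<in>U \<union> V. \<tau>' u = \<tau> u) \<and> \<tau> \<in> Subst"
  then show "\<tau> \<in> Sol U \<theta>\<^sub>1 \<inter> Sol V \<theta>\<^sub>2"
    unfolding eqs_unifiers_Un Sol_Eq[OF \<theta>(1)] Sol_Eq[OF \<theta>(2)] by blast
next
  assume "\<tau> \<in> Sol U \<theta>\<^sub>1 \<inter> Sol V \<theta>\<^sub>2"
  then obtain \<tau>\<^sub>1 \<tau>\<^sub>2 where \<tau>: "\<tau> \<in> Subst"
    and \<tau>\<^sub>1: "\<tau>\<^sub>1 \<in> eqs_unifiers (Eq \<theta>\<^sub>1)" "\<forall>u\<in>U. \<tau>\<^sub>1 u = \<tau> u"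
    and \<tau>\<^sub>2: "\<tau>\<^sub>2 \<in> eqs_unifiers (Eq \<theta>\<^sub>2)" "\<forall>u\<in>V. \<tau>\<^sub>2 u = \<tau> u"
    unfolding Sol_Eq[OF \<theta>(1)] Sol_Eq[OF \<theta>(2)] by blast
  let ?g = "glue (U \<union> subst_vars \<theta>\<^sub>1) \<tau>\<^sub>1 \<tau>\<^sub>2"
  have "\<tau>\<^sub>1 \<in> Subst" "\<tau>\<^sub>2 \<in> Subst" using \<tau>\<^sub>1 \<tau>\<^sub>2 by (auto simp: eqs_unifiers_def)
  then have g: "?g \<in> Subst" by blast
  have g2: "?g x = \<tau>\<^sub>2 x" if "x \<in> V \<union> subst_vars \<theta>\<^sub>2" for x
  proof (cases "x \<in> U \<union> subst_vars \<theta>\<^sub>1")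
    case True
    then have "x \<in> U" "x \<in> V" using that apart by blast+
    then show ?thesis using \<tau>\<^sub>1(2) \<tau>\<^sub>2(2) by (simp add: glue_def)
  qed (simp add: glue_def)
  have "?g \<in> eqs_unifiers (Eq \<theta>\<^sub>1)"
    using \<tau>\<^sub>1(1) g by (rule eqs_unifiers_Eq_cong) (simp add: glue_def)
  moreover have "?g \<in> eqs_unifiers (Eq \<theta>\<^sub>2)"
    using \<tau>\<^sub>2(1) g by (rule eqs_unifiers_Eq_cong) (simp add: g2)
  moreover have "\<forall>u\<in>U \<union> V. ?g u = \<tau> u"
  proof
    fix u assume "u \<in> U \<union> V"
    then show "?g u = \<tau> u"
      using g2[of u] \<tau>\<^sub>1(2) \<tau>\<^sub>2(2) by (cases "u \<in> V") (auto simp: glue_simps)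
  qed
  ultimately show "(\<exists>\<tau>'\<in>eqs_unifiers (Eq \<theta>\<^sub>1 \<union> Eq \<theta>\<^sub>2). \<forall>u\<in>U \<union> V. \<tau>' u = \<tau> u) \<and> \<tau> \<in> Subst"
    using \<tau> unfolding eqs_unifiers_Un by blast
qed

lemma mem_emgu_iff:
  assumes "finite U" "finite V" "a \<in> Subst" "b \<in> Subst"
  shows "c \<in> emgu U a V b \<longleftrightarrow> (\<exists>a' b'. c = ecls (U \<union> V) (eqs_mgu (Eq a' \<union> Eq b')) \<and>
    a' \<in> ISubst \<and> Sol U a = Sol U a' \<and> b' \<in> ISubst \<and> Sol V b = Sol V b' \<and>
    (U \<union> subst_vars a') \<inter> (V \<union> subst_vars b') \<subseteq> U \<inter> V \<and> eqs_unifiers (Eq a' \<union> Eq b') \<noteq> {})"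
  unfolding emgu_def mem_Collect_eq
  by (simp only: sim_on_iff_Sol[OF assms(1,3) ISubst_Subst] sim_on_iff_Sol[OF assms(2,4) ISubst_Subst] cong: conj_cong)

text \<open>Admissible representatives are chosen one after the other: the first avoids
  \<open>V\<close>, the second avoids \<open>U\<close> and all variables of the first.\<close>

lemma emgu_nonempty:
  fixes a b :: "('f::ranked, 'v::infinite) subst"
  assumes fin: "finite U" "finite V" and ab: "a \<in> Subst" "b \<in> Subst"
    and ne: "Sol U a \<inter> Sol V b \<noteq> {}"
  shows "emgu U a V b \<noteq> {}"
proof -
  obtain a' where a': "a' \<in> ISubst" "Sol U a' = Sol U a" "subst_vars a' \<inter> V \<subseteq> U"
    using fresh_representative[OF ab(1) fin] by blast
  have "finite (U \<union> subst_vars a')" using fin a'(1) by (simp add: ISubst_Subst)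
  then obtain b' where b': "b' \<in> ISubst" "Sol V b' = Sol V b" "subst_vars b' \<inter> (U \<union> subst_vars a') \<subseteq> V"
    using fresh_representative[OF ab(2) fin(2)] by metis
  have apart: "(U \<union> subst_vars a') \<inter> (V \<union> subst_vars b') \<subseteq> U \<inter> V"
    using a'(3) b'(3) by blast
  obtain \<tau> where "\<tau> \<in> Sol U a' \<inter> Sol V b'" using ne a'(2) b'(2) by blast
  then have "eqs_unifiers (Eq a' \<union> Eq b') \<noteq> {}"
    using emgu_representatives[OF a'(1) b'(1) apart] by blast
  then show ?thesis
    using mem_emgu_iff[OF fin ab] a'(1,2) b'(1,2) apart by (metis empty_iff)
qed

text \<open>All dependence on representatives is removed: the result is decided by the two solution
  sets alone. Later proofs work with this form instead of the definition.\<close>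

lemma emgu_eq:
  fixes a b :: "('f::ranked, 'v::infinite) subst"
  assumes fin: "finite U" "finite V" and ab: "a \<in> Subst" "b \<in> Subst"
  shows "emgu U a V b = {ecls (U \<union> V) \<mu> | \<mu>. \<mu> \<in> ISubst \<and> Sol (U \<union> V) \<mu> = Sol U a \<inter> Sol V b}"
proof (intro set_eqI iffI)
  have mgu: "eqs_mgu (Eq a' \<union> Eq b') \<in> ISubst \<and> Sol (U \<union> V) (eqs_mgu (Eq a' \<union> Eq b')) = Sol U a \<inter> Sol V b"
    if a': "a' \<in> ISubst" "Sol U a = Sol U a'" and b': "b' \<in> ISubst" "Sol V b = Sol V b'"
      and apart: "(U \<union> subst_vars a') \<inter> (V \<union> subst_vars b') \<subseteq> U \<inter> V"
      and ne: "eqs_unifiers (Eq a' \<union> Eq b') \<noteq> {}" for a' b'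
  proof -
    have "finite (Eq a' \<union> Eq b')" using a' b' by (simp add: finite_Eq ISubst_Subst)
    then have m: "is_mgu (eqs_unifiers (Eq a' \<union> Eq b')) (vars_eqs (Eq a' \<union> Eq b')) (eqs_mgu (Eq a' \<union> Eq b'))"
      using ne by (rule eqs_mgu_is_mgu)
    show ?thesis
    proof
      show "eqs_mgu (Eq a' \<union> Eq b') \<in> ISubst" using m by (simp add: is_mgu_def)
      show "Sol (U \<union> V) (eqs_mgu (Eq a' \<union> Eq b')) = Sol U a \<inter> Sol V b"
        by (subst Sol_mgu[OF m], erule (1) eqs_unifiers_comp)
          (simp add: set_eq_iff a'(2) b'(2) emgu_representatives[OF a'(1) b'(1) apart, symmetric, simplified] conj_commute)
    qed
  qed
  have sub: "c \<in> emgu U a V b \<Longrightarrow> c \<in> {ecls (U \<union> V) \<mu> | \<mu>. \<mu> \<in> ISubst \<and> Sol (U \<union> V) \<mu> = Sol U a \<inter> Sol V b}" for c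
    unfolding mem_emgu_iff[OF fin ab] using mgu by blast
  fix c
  { assume "c \<in> emgu U a V b"
    then show "c \<in> {ecls (U \<union> V) \<mu> | \<mu>. \<mu> \<in> ISubst \<and> Sol (U \<union> V) \<mu> = Sol U a \<inter> Sol V b}"
      by (rule sub) }
  { assume "c \<in> {ecls (U \<union> V) \<mu> | \<mu>. \<mu> \<in> ISubst \<and> Sol (U \<union> V) \<mu> = Sol U a \<inter> Sol V b}"
    then obtain \<mu> where \<mu>: "\<mu> \<in> ISubst" "c = ecls (U \<union> V) \<mu>" "Sol (U \<union> V) \<mu> = Sol U a \<inter> Sol V b"
      by blast
    \<comment> \<open>As a member of its own solution set, \<mu> witnesses unifiability. So
      \<open>emgu\<close> has some element, and that element has the same solutions as
      \<mu>.\<close>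
    have "\<mu> \<in> Sol U a \<inter> Sol V b" using \<mu>(1,3) Sol_self[OF ISubst_Subst] by metis
    then obtain c' where c': "c' \<in> emgu U a V b" using emgu_nonempty[OF fin ab] by blast
    then obtain \<mu>' where "\<mu>' \<in> ISubst" "c' = ecls (U \<union> V) \<mu>'" "Sol (U \<union> V) \<mu>' = Sol U a \<inter> Sol V b"
      using sub by blast
    then have "c = c'" using \<mu> fin by (simp add: ecls_eq_iff ISubst_Subst)
    then show "c \<in> emgu U a V b" using c' by simp }
qed

lemma emgu_singleton:
  fixes a b :: "('f::ranked, 'v::infinite) subst"
  assumes fin: "finite U" "finite V" and ab: "a \<in> Subst" "b \<in> Subst"
    and ne: "Sol U a \<inter> Sol V b \<noteq> {}"
  obtains \<mu> where "\<mu> \<in> ISubst" "Sol (U \<union> V) \<mu> = Sol U a \<inter> Sol V b" "emgu U a V b = {ecls (U \<union> V) \<mu>}"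
proof -
  obtain c where "c \<in> emgu U a V b" using emgu_nonempty[OF assms] by blast
  then obtain \<mu> where \<mu>: "\<mu> \<in> ISubst" "Sol (U \<union> V) \<mu> = Sol U a \<inter> Sol V b"
    unfolding emgu_eq[OF fin ab] by blast
  moreover have "ecls (U \<union> V) \<mu>' = ecls (U \<union> V) \<mu>"
    if "\<mu>' \<in> ISubst" "Sol (U \<union> V) \<mu>' = Sol U a \<inter> Sol V b" for \<mu>'
    using that \<mu> fin by (simp add: ecls_eq_iff ISubst_Subst)
  then have "emgu U a V b = {ecls (U \<union> V) \<mu>}" unfolding emgu_eq[OF fin ab] using \<mu> by blast
  ultimately show ?thesis using that by blast
qed


section \<open>Elements of the concrete domain\<close>

lemma Rep_bot: "Rep_psub bot = Bot_rep" and Rep_top: "Rep_psub top = Top_rep"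
  by (simp_all add: bot_psub_def top_psub_def Abs_psub_inverse)

lemma Rep_Elem: "finite U \<Longrightarrow> \<Theta> \<subseteq> ESubst U \<Longrightarrow> Rep_psub (Elem \<Theta> U) = Elem_rep \<Theta> U"
  by (simp add: Elem_def Abs_psub_inverse)

lemma psub_cases [case_names bot top Elem]:
  obtains "\<chi> = bot" | "\<chi> = top" | \<Theta> U where "finite U" "\<Theta> \<subseteq> ESubst U" "\<chi> = Elem \<Theta> U"
proof (cases "Rep_psub \<chi>")
  case Bot_rep
  then show ?thesis using that(1) by (metis Rep_psub_inject Rep_bot)
next
  case Top_rep
  then show ?thesis using that(2) by (metis Rep_psub_inject Rep_top)
next
  case (Elem_rep \<Theta> U)
  then have "finite U \<and> \<Theta> \<subseteq> ESubst U" using Rep_psub[of \<chi>] by simp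
  then show ?thesis using that(3) Elem_rep by (metis Rep_psub_inject Rep_Elem)
qed

lemma Elem_le_Elem:
  assumes "finite U" "\<Theta> \<subseteq> ESubst U" "finite U'" "\<Theta>' \<subseteq> ESubst U'"
  shows "Elem \<Theta> U \<le> Elem \<Theta>' U' \<longleftrightarrow> U = U' \<and> \<Theta> \<subseteq> \<Theta>'"
  using assms by (simp add: less_eq_psub_def Rep_Elem)

lemma Elem_neq:
  assumes "finite U" "\<Theta> \<subseteq> ESubst U"
  shows "Elem \<Theta> U \<noteq> bot" "Elem \<Theta> U \<noteq> top"
  using assms by (metis Rep_Elem Rep_bot Rep_top psub_rep.distinct)+

text \<open>Nonemptiness of \<open>C\<close> is what pins the variable set of \<chi> to
  \<open>U\<close>: \<open>Elem {} U\<close> is different from \<open>bot\<close>, so an empty union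
  would still have to be compared.\<close>

lemma Elem_UN_le:
  assumes U: "finite U" and h: "\<And>c. c \<in> C \<Longrightarrow> h c \<subseteq> ESubst U" and C: "C \<noteq> {}"
    and le: "\<And>c. c \<in> C \<Longrightarrow> Elem (h c) U \<le> \<chi>"
  shows "Elem (\<Union>(h ` C)) U \<le> \<chi>"
proof (cases \<chi> rule: psub_cases)
  case bot
  then show ?thesis using C le Elem_neq(1)[OF U h] by (metis bot.extremum_unique ex_in_conv)
next
  case top
  then show ?thesis by simp
next
  case (Elem \<Theta> V)
  obtain c where "c \<in> C" using C by blast
  then have "U = V" using le[of c] Elem_le_Elem[OF U h[of c] Elem(1,2)] by (simp add: Elem(3))
  moreover have "h c \<subseteq> \<Theta>" if "c \<in> C" for c
    using le[OF that] Elem_le_Elem[OF U h[OF that] Elem(1,2)] by (simp add: Elem(3))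
  ultimately show ?thesis using Elem_le_Elem[OF U _ Elem(1,2), of "\<Union>(h ` C)"] h by (simp add: Elem(3) UN_least)
qed


section \<open>Continuity\<close>

text \<open>
  \<open>h\<close> may depend on \<open>U\<close>, as the renamings chosen in forward and backward unification do.
\<close>

definition classwise :: "(('f::ranked, 'v) psub \<Rightarrow> ('f, 'v) psub) \<Rightarrow> bool" where
  "classwise f \<longleftrightarrow> f bot = bot \<and> f top = top \<and>
     (\<forall>U. finite U \<longrightarrow> (\<exists>U' h. finite U' \<and> (\<forall>c\<in>ESubst U. h c \<subseteq> ESubst U') \<and>
        (\<forall>\<Theta>\<subseteq>ESubst U. f (Elem \<Theta> U) = Elem (\<Union>(h ` \<Theta>)) U')))"

lemma classwiseE:
  assumes "classwise f" "finite U"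
  obtains U' h where "finite U'" "\<And>c. c \<in> ESubst U \<Longrightarrow> h c \<subseteq> ESubst U'"
    "\<And>\<Theta>. \<Theta> \<subseteq> ESubst U \<Longrightarrow> f (Elem \<Theta> U) = Elem (\<Union>(h ` \<Theta>)) U'"
  using assms unfolding classwise_def by metis

lemma classwiseI:
  assumes "f bot = bot" "f top = top"
    and "\<And>\<Theta> U. finite U \<Longrightarrow> \<Theta> \<subseteq> ESubst U \<Longrightarrow> f (Elem \<Theta> U) = Elem (\<Union>c\<in>\<Theta>. h U c) (D U)"
    and "\<And>U. finite U \<Longrightarrow> finite (D U)"
    and "\<And>U c. finite U \<Longrightarrow> h U c \<subseteq> ESubst (D U)"
  shows "classwise f"
  unfolding classwise_def
proof (intro conjI assms(1,2) allI impI)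
  fix U :: "'b set" assume U: "finite U"
  show "\<exists>U' h. finite U' \<and> (\<forall>c\<in>ESubst U. h c \<subseteq> ESubst U') \<and>
      (\<forall>\<Theta>\<subseteq>ESubst U. f (Elem \<Theta> U) = Elem (\<Union>(h ` \<Theta>)) U')"
    using assms(3-5)[OF U] by (intro exI[of _ "D U"] exI[of _ "h U"]) simp
qed

text \<open>Forward and backward unification choose a renaming from the variable set of their
  argument. They are not one fixed composition of basic operators, but agree with such a composition
  for each \<open>U\<close>.\<close>

lemma classwise_local:
  assumes "f bot = bot" "f top = top"
    and "\<And>U. finite U \<Longrightarrow> \<exists>g. classwise g \<and> (\<forall>\<Theta>\<subseteq>ESubst U. f (Elem \<Theta> U) = g (Elem \<Theta> U))"
  shows "classwise f"
  unfolding classwise_def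
proof (intro conjI assms(1,2) allI impI)
  fix U :: "'b set" assume U: "finite U"
  then obtain g where g: "classwise g" "\<forall>\<Theta>\<subseteq>ESubst U. f (Elem \<Theta> U) = g (Elem \<Theta> U)"
    using assms(3) by blast
  obtain U' h where "finite U'" "\<And>c. c \<in> ESubst U \<Longrightarrow> h c \<subseteq> ESubst U'"
    "\<And>\<Theta>. \<Theta> \<subseteq> ESubst U \<Longrightarrow> g (Elem \<Theta> U) = Elem (\<Union>(h ` \<Theta>)) U'"
    using classwiseE[OF g(1) U] by metis
  then show "\<exists>U' h. finite U' \<and> (\<forall>c\<in>ESubst U. h c \<subseteq> ESubst U') \<and>
      (\<forall>\<Theta>\<subseteq>ESubst U. f (Elem \<Theta> U) = Elem (\<Union>(h ` \<Theta>)) U')"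
    using g(2) by (intro exI[of _ U'] exI[of _ h]) simp
qed

lemma classwise_comp:
  assumes f: "classwise f" and g: "classwise g"
  shows "classwise (\<lambda>\<chi>. g (f \<chi>))"
  unfolding classwise_def
proof (intro conjI allI impI)
  show "g (f bot) = bot" "g (f top) = top" using f g by (simp_all add: classwise_def)
  fix U :: "'b set" assume U: "finite U"
  obtain U' h where h: "finite U'" "\<And>c. c \<in> ESubst U \<Longrightarrow> h c \<subseteq> ESubst U'"
    "\<And>\<Theta>. \<Theta> \<subseteq> ESubst U \<Longrightarrow> f (Elem \<Theta> U) = Elem (\<Union>(h ` \<Theta>)) U'"
    using classwiseE[OF f U] by metis
  obtain U'' k where k: "finite U''" "\<And>c. c \<in> ESubst U' \<Longrightarrow> k c \<subseteq> ESubst U''"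
    "\<And>\<Theta>. \<Theta> \<subseteq> ESubst U' \<Longrightarrow> g (Elem \<Theta> U') = Elem (\<Union>(k ` \<Theta>)) U''"
    using classwiseE[OF g h(1)] by metis
  have "\<Union> (k ` h c) \<subseteq> ESubst U''" if "c \<in> ESubst U" for c
    using h(2)[OF that] k(2) by blast
  moreover have "g (f (Elem \<Theta> U)) = Elem (\<Union>((\<lambda>c. \<Union> (k ` h c)) ` \<Theta>)) U''" if \<Theta>: "\<Theta> \<subseteq> ESubst U" for \<Theta>
  proof -
    have "\<Union>(h ` \<Theta>) \<subseteq> ESubst U'" using h(2) \<Theta> by blast
    moreover have "\<Union>(k ` \<Union>(h ` \<Theta>)) = \<Union>((\<lambda>c. \<Union> (k ` h c)) ` \<Theta>)" by blast
    ultimately show ?thesis using h(3)[OF \<Theta>] k(3) by simp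
  qed
  ultimately show "\<exists>U' h. finite U' \<and> (\<forall>c\<in>ESubst U. h c \<subseteq> ESubst U') \<and>
      (\<forall>\<Theta>\<subseteq>ESubst U. g (f (Elem \<Theta> U)) = Elem (\<Union>(h ` \<Theta>)) U')"
    using k(1) by (intro exI[of _ U''] exI[of _ "\<lambda>c. \<Union> (k ` h c)"]) simp
qed

section \<open>Continuity from the behaviour on singletons\<close>

abbreviation ps_mcont :: "(('f::ranked, 'v) psub \<Rightarrow> ('f, 'v) psub) \<Rightarrow> bool" where
  "ps_mcont \<equiv> mcont Sup (\<le>) Sup (\<le>)"

text \<open>If a chain contains its join, monotonicity suffices. Otherwise its members other than
  \<open>bot\<close> share one variable set, and every class of the join already occurs in some
  member, so a bound by singletons is enough.\<close>

lemma ps_mcontI: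
  fixes f :: "('f::ranked, 'v) psub \<Rightarrow> ('f, 'v) psub"
  assumes mono: "\<And>x y. x \<le> y \<Longrightarrow> f x \<le> f y"
    and le_SUP: "\<And>U \<Theta>. finite U \<Longrightarrow> \<Theta> \<subseteq> ESubst U \<Longrightarrow> \<Theta> \<noteq> {} \<Longrightarrow>
      f (Elem \<Theta> U) \<le> (SUP c\<in>\<Theta>. f (Elem {c} U))"
  shows "ps_mcont f"
proof (rule mcontI)
  show "monotone (\<le>) (\<le>) f" using mono by (simp add: monotoneI)
  show "cont Sup (\<le>) Sup (\<le>) f"
  proof (rule contI)
    fix Y :: "('f, 'v) psub set"
    assume chain: "Complete_Partial_Order.chain (\<le>) Y" and ne: "Y \<noteq> {}"
    have "f (Sup Y) \<le> Sup (f ` Y)"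
    proof (cases "Sup Y \<in> Y")
      case True
      then show ?thesis by (simp add: SUP_upper)
    next
      case no_max: False
      \<comment> \<open>A chain with \<open>top\<close>, or one consisting of \<open>bot\<close>
        alone, contains its join.\<close>
      then have "top \<notin> Y" using top_le[of "Sup Y"] Sup_upper[of top Y] by metis
      moreover have "\<exists>y\<in>Y. y \<noteq> bot"
      proof (rule ccontr)
        assume "\<not> ?thesis"
        then have "Y = {bot}" using ne by auto
        then show False using no_max by simp
      qed
      ultimately obtain y0 where y0: "y0 \<in> Y" "y0 \<noteq> bot" "y0 \<noteq> top" by metis
      then obtain \<Theta>0 U where U: "finite U" and \<Theta>0: "\<Theta>0 \<subseteq> ESubst U" "y0 = Elem \<Theta>0 U"
        by (metis psub_cases)
      have Y: "\<exists>\<Theta>\<subseteq>ESubst U. y = Elem \<Theta> U" if y: "y \<in> Y" "y \<noteq> bot" for y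
      proof (cases y rule: psub_cases)
        case (Elem \<Theta> V)
        have "y \<le> y0 \<or> y0 \<le> y" using chain y(1) y0(1) unfolding Complete_Partial_Order.chain_def by blast
        then have "V = U" using Elem_le_Elem[OF U \<Theta>0(1) Elem(1,2)] Elem_le_Elem[OF Elem(1,2) U \<Theta>0(1)]
          by (auto simp: Elem(3) \<Theta>0(2))
        then show ?thesis using Elem by blast
      qed (use y \<open>top \<notin> Y\<close> in auto)
      define T where "T = \<Union>{\<Theta>. \<Theta> \<subseteq> ESubst U \<and> Elem \<Theta> U \<in> Y}"
      have T: "T \<subseteq> ESubst U" by (auto simp: T_def)
      have "y \<le> Elem T U" if y: "y \<in> Y" for y
      proof (cases "y = bot")
        case False
        then obtain \<Theta> where \<Theta>: "\<Theta> \<subseteq> ESubst U" "y = Elem \<Theta> U" using Y[OF y] by blast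
        then have "\<Theta> \<subseteq> T" using y by (auto simp: T_def)
        then show ?thesis using \<Theta> Elem_le_Elem[OF U \<Theta>(1) U T] by simp
      qed simp
      then have "f (Sup Y) \<le> f (Elem T U)" by (intro mono Sup_least)
      also have "\<dots> \<le> Sup (f ` Y)"
      \<comment> \<open>An empty \<open>T\<close> offers no singletons, and the join over them would
        be \<open>bot\<close>; the member \<open>y0\<close> is used instead.\<close>
      proof (cases "T = {}")
        case True
        then have "Elem T U \<le> y0" using Elem_le_Elem[OF U T U \<Theta>0(1)] \<Theta>0(2) by simp
        then have "f (Elem T U) \<le> f y0" by (rule mono)
        also have "\<dots> \<le> Sup (f ` Y)" using y0(1) by (simp add: SUP_upper)
        finally show ?thesis .
      next
        case False
        then have "f (Elem T U) \<le> (SUP c\<in>T. f (Elem {c} U))" using le_SUP U T by blast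
        also have "\<dots> \<le> Sup (f ` Y)"
        proof (rule SUP_least)
          fix c assume "c \<in> T"
          then obtain \<Theta> where \<Theta>: "c \<in> \<Theta>" "\<Theta> \<subseteq> ESubst U" "Elem \<Theta> U \<in> Y" by (auto simp: T_def)
          then have "Elem {c} U \<le> Elem \<Theta> U" using Elem_le_Elem[OF U _ U \<Theta>(2), of "{c}"] by auto
          then have "f (Elem {c} U) \<le> f (Elem \<Theta> U)" by (rule mono)
          also have "\<dots> \<le> Sup (f ` Y)" using \<Theta>(3) by (simp add: SUP_upper)
          finally show "f (Elem {c} U) \<le> Sup (f ` Y)" .
        qed
        finally show ?thesis .
      qed
      finally show ?thesis .
    qed
    moreover have "Sup (f ` Y) \<le> f (Sup Y)" by (intro SUP_least mono Sup_upper)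
    ultimately show "f (Sup Y) = Sup (f ` Y)" by (rule order.antisym)
  qed
qed

lemma ps_mcont_mono: "ps_mcont f \<Longrightarrow> x \<le> y \<Longrightarrow> f x \<le> f y"
  by (rule mcont_monoD)

lemma classwise_mcont:
  fixes f :: "('f::ranked, 'v) psub \<Rightarrow> ('f, 'v) psub"
  assumes f: "classwise f"
  shows "ps_mcont f"
proof (rule ps_mcontI)
  fix x y :: "('f, 'v) psub" assume le: "x \<le> y"
  have fbt: "f bot = bot" "f top = top" using f by (simp_all add: classwise_def)
  show "f x \<le> f y"
  proof (cases x rule: psub_cases)
    case x: (Elem \<Theta> U)
    show ?thesis
    proof (cases y rule: psub_cases)
      case y: (Elem \<Theta>' U')
      have UU: "U' = U" "\<Theta> \<subseteq> \<Theta>'" using le Elem_le_Elem[OF x(1,2) y(1,2)] by (simp_all add: x y)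
      obtain V h where V: "finite V" and h: "\<And>c. c \<in> ESubst U \<Longrightarrow> h c \<subseteq> ESubst V"
        and fE: "\<And>\<Theta>. \<Theta> \<subseteq> ESubst U \<Longrightarrow> f (Elem \<Theta> U) = Elem (\<Union>(h ` \<Theta>)) V"
        using classwiseE[OF f x(1)] by metis
      have "\<Theta>' \<subseteq> ESubst U" using y(2) UU by simp
      then have "\<Union>(h ` \<Theta>) \<subseteq> ESubst V" "\<Union>(h ` \<Theta>') \<subseteq> ESubst V" using h x(2) by blast+
      then have "Elem (\<Union>(h ` \<Theta>)) V \<le> Elem (\<Union>(h ` \<Theta>')) V"
        using UU(2) by (subst Elem_le_Elem[OF V _ V]) auto
      then show ?thesis using UU x(2,3) y(3) \<open>\<Theta>' \<subseteq> ESubst U\<close> fE by simp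
    qed (use le x Elem_neq fbt bot.extremum_unique in \<open>auto dest: bot.extremum_uniqueI\<close>)
  qed (use le fbt top.extremum_unique in \<open>auto dest: top.extremum_uniqueI\<close>)
next
  fix U :: "'v set" and \<Theta> :: "('f, 'v) subst set set"
  assume U: "finite U" and \<Theta>: "\<Theta> \<subseteq> ESubst U" "\<Theta> \<noteq> {}"
  obtain V h where V: "finite V" and h: "\<And>c. c \<in> ESubst U \<Longrightarrow> h c \<subseteq> ESubst V"
    and fE: "\<And>\<Theta>. \<Theta> \<subseteq> ESubst U \<Longrightarrow> f (Elem \<Theta> U) = Elem (\<Union>(h ` \<Theta>)) V"
    using classwiseE[OF f U] by metis
  have "Elem (\<Union>(h ` \<Theta>)) V \<le> (SUP c\<in>\<Theta>. f (Elem {c} U))"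
  proof (rule Elem_UN_le[OF V _ \<Theta>(2)])
    fix c assume c: "c \<in> \<Theta>"
    then show "h c \<subseteq> ESubst V" using h \<Theta>(1) by blast
    have "Elem (h c) V = f (Elem {c} U)" using c \<Theta>(1) fE[of "{c}"] by auto
    then show "Elem (h c) V \<le> (SUP c\<in>\<Theta>. f (Elem {c} U))" by (intro SUP_upper2[OF c]) simp
  qed
  then show "f (Elem \<Theta> U) \<le> (SUP c\<in>\<Theta>. f (Elem {c} U))" using fE \<Theta>(1) by simp
qed

text \<open>The shape that \<open>match_ps\<close> takes once one argument is \<open>top\<close>. It
  sends each \<open>Elem\<close> to \<open>top\<close>, so it is not \<open>classwise\<close> and
  needs its own argument.\<close>

lemma ps_mcont_nonbot_top:
  "ps_mcont (\<lambda>\<chi> :: ('f::ranked, 'v) psub. if \<chi> = bot then bot else top)"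
proof (rule ps_mcontI)
  fix x y :: "('f, 'v) psub" assume "x \<le> y"
  then show "(if x = bot then bot else top) \<le> (if y = bot then bot else top :: ('f, 'v) psub)"
    using bot.extremum_unique by auto
next
  fix U :: "'v set" and \<Theta> :: "('f, 'v) subst set set"
  assume U: "finite U" and \<Theta>: "\<Theta> \<subseteq> ESubst U" "\<Theta> \<noteq> {}"
  then obtain c where c: "c \<in> \<Theta>" by blast
  then have "Elem {c} U \<noteq> bot" using U \<Theta>(1) by (intro Elem_neq) auto
  then have "top \<le> (SUP c\<in>\<Theta>. if Elem {c} U = bot then bot else top :: ('f, 'v) psub)"
    using c by (intro SUP_upper2[of c]) auto
  then show "(if Elem \<Theta> U = bot then bot else top)
      \<le> (SUP c\<in>\<Theta>. if Elem {c} U = bot then bot else top :: ('f, 'v) psub)"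
    by auto
qed

lemma ps_mcont_SUP:
  fixes f :: "'i \<Rightarrow> ('f::ranked, 'v) psub \<Rightarrow> ('f, 'v) psub"
  assumes "\<And>i. i \<in> I \<Longrightarrow> ps_mcont (f i)"
  shows "ps_mcont (\<lambda>\<chi>. SUP i\<in>I. f i \<chi>)"
proof (rule mcontI)
  show "monotone (\<le>) (\<le>) (\<lambda>\<chi>. SUP i\<in>I. f i \<chi>)"
    using assms ps_mcont_mono by (intro monotoneI SUP_mono) blast
  show "cont Sup (\<le>) Sup (\<le>) (\<lambda>\<chi>. SUP i\<in>I. f i \<chi>)"
  proof (rule contI)
    fix Y :: "('f, 'v) psub set" assume Y: "Complete_Partial_Order.chain (\<le>) Y" "Y \<noteq> {}"
    have "(SUP i\<in>I. f i (Sup Y)) = (SUP i\<in>I. SUP y\<in>Y. f i y)"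
      using assms by (intro SUP_cong refl mcont_contD[OF _ Y]) 
    then show "(SUP i\<in>I. f i (Sup Y)) = Sup ((\<lambda>\<chi>. SUP i\<in>I. f i \<chi>) ` Y)"
      by (simp add: SUP_commute[of _ Y])
  qed
qed

section \<open>The basic operators act class by class\<close>

lemma rename_ps_Elem:
  assumes "finite U" "\<Theta> \<subseteq> ESubst U"
  shows "rename_ps \<rho> (Elem \<Theta> U) = Elem (\<Union>c\<in>\<Theta>. {ecls (ren_vars \<rho> U) (\<rho> \<circ>\<^sub>s \<sigma> \<circ>\<^sub>s ren_inv \<rho>) | \<sigma>.
    \<sigma> \<in> ISubst \<and> ecls U \<sigma> = c}) (ren_vars \<rho> U)"
  unfolding rename_ps_def using assms by (auto simp: Rep_Elem intro!: arg_cong[of _ _ "\<lambda>T. Elem T (ren_vars \<rho> U)"])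

lemma proj_ps_Elem:
  assumes "finite U" "\<Theta> \<subseteq> ESubst U"
  shows "proj_ps (Elem \<Theta> U) V = Elem (\<Union>c\<in>\<Theta>. {ecls (U \<inter> V) \<sigma> | \<sigma>. \<sigma> \<in> ISubst \<and> ecls U \<sigma> = c}) (U \<inter> V)"
  unfolding proj_ps_def using assms by (auto simp: Rep_Elem intro!: arg_cong[of _ _ "\<lambda>T. Elem T (U \<inter> V)"])

lemma unif_ps_Elem:
  assumes "finite U" "\<Theta> \<subseteq> ESubst U"
  shows "unif_ps (Elem \<Theta> U) \<delta> = Elem (\<Union>c\<in>\<Theta>. \<Union>\<sigma>\<in>{\<sigma> \<in> ISubst. ecls U \<sigma> = c}. emgu U \<sigma> (subst_vars \<delta>) \<delta>)
    (U \<union> subst_vars \<delta>)"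
  unfolding unif_ps_def using assms by (auto simp: Rep_Elem intro!: arg_cong[of _ _ "\<lambda>T. Elem T (U \<union> subst_vars \<delta>)"])

text \<open>The contribution of a single pair of classes. It turns \<open>match_ps\<close> into a
  double union, which is \<open>classwise\<close> in either argument when the other is a fixed
  \<open>Elem\<close>.\<close>

definition match_classes ::
    "'v set \<Rightarrow> 'v set \<Rightarrow> ('f::ranked, 'v) subst set \<Rightarrow> ('f, 'v) subst set \<Rightarrow> ('f, 'v) subst set set" where
  "match_classes U\<^sub>1 U\<^sub>2 c\<^sub>1 c\<^sub>2 = (\<Union>(\<theta>\<^sub>1, \<theta>\<^sub>2)\<in>{(\<theta>\<^sub>1, \<theta>\<^sub>2). \<theta>\<^sub>1 \<in> ISubst \<and> ecls U\<^sub>1 \<theta>\<^sub>1 = c\<^sub>1 \<and>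
     \<theta>\<^sub>2 \<in> ISubst \<and> ecls U\<^sub>2 \<theta>\<^sub>2 = c\<^sub>2 \<and> inst_on (U\<^sub>1 \<inter> U\<^sub>2) \<theta>\<^sub>1 \<theta>\<^sub>2}. emgu U\<^sub>1 \<theta>\<^sub>1 U\<^sub>2 \<theta>\<^sub>2)"

lemma match_ps_Elem:
  assumes "finite U\<^sub>1" "\<Theta>\<^sub>1 \<subseteq> ESubst U\<^sub>1" "finite U\<^sub>2" "\<Theta>\<^sub>2 \<subseteq> ESubst U\<^sub>2"
  shows "match_ps (Elem \<Theta>\<^sub>1 U\<^sub>1) (Elem \<Theta>\<^sub>2 U\<^sub>2) =
    Elem (\<Union>c\<^sub>1\<in>\<Theta>\<^sub>1. \<Union>c\<^sub>2\<in>\<Theta>\<^sub>2. match_classes U\<^sub>1 U\<^sub>2 c\<^sub>1 c\<^sub>2) (U\<^sub>1 \<union> U\<^sub>2)"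
  unfolding match_ps_def match_classes_def using assms
  by (auto simp: Rep_Elem intro!: arg_cong[of _ _ "\<lambda>T. Elem T (U\<^sub>1 \<union> U\<^sub>2)"])

lemma match_ps_bot [simp]: "match_ps bot \<chi> = bot" "match_ps \<chi> bot = bot"
  by (cases "Rep_psub \<chi>"; simp add: match_ps_def Rep_bot)+

lemma match_ps_top [simp]:
  "match_ps top \<chi> = (if \<chi> = bot then bot else top)" "match_ps \<chi> top = (if \<chi> = bot then bot else top)"
  by (cases "Rep_psub \<chi>"; simp add: match_ps_def Rep_top Rep_bot flip: Rep_psub_inject)+

lemma emgu_subset_ESubst:
  fixes a b :: "('f::ranked, 'v::infinite) subst"
  assumes "finite U" "finite V" "a \<in> Subst" "b \<in> Subst"
  shows "emgu U a V b \<subseteq> ESubst (U \<union> V)"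
  unfolding emgu_eq[OF assms] ESubst_def by blast

lemma match_classes_subset_ESubst:
  fixes c\<^sub>1 c\<^sub>2 :: "('f::ranked, 'v::infinite) subst set"
  assumes "finite U\<^sub>1" "finite U\<^sub>2"
  shows "match_classes U\<^sub>1 U\<^sub>2 c\<^sub>1 c\<^sub>2 \<subseteq> ESubst (U\<^sub>1 \<union> U\<^sub>2)"
  unfolding match_classes_def using emgu_subset_ESubst[OF assms ISubst_Subst ISubst_Subst] by blast

lemma classwise_rename:
  fixes \<rho> :: "('f::ranked, 'v::infinite) subst"
  assumes \<rho>: "\<rho> \<in> Ren"
  shows "classwise (rename_ps \<rho>)"
proof (rule classwiseI)
  show "rename_ps \<rho> bot = bot" "rename_ps \<rho> top = top" by (simp_all add: rename_ps_def Rep_bot Rep_top)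
  show "rename_ps \<rho> (Elem \<Theta> U) = Elem (\<Union>c\<in>\<Theta>. {ecls (ren_vars \<rho> U) (\<rho> \<circ>\<^sub>s \<sigma> \<circ>\<^sub>s ren_inv \<rho>) | \<sigma>.
    \<sigma> \<in> ISubst \<and> ecls U \<sigma> = c}) (ren_vars \<rho> U)" if "finite U" "\<Theta> \<subseteq> ESubst U" for \<Theta> U
    using that by (rule rename_ps_Elem)
  fix U :: "'v set" assume U: "finite U"
  then show "finite (ren_vars \<rho> U)" by simp
  have "ecls (ren_vars \<rho> U) (\<rho> \<circ>\<^sub>s \<sigma> \<circ>\<^sub>s ren_inv \<rho>) \<in> ESubst (ren_vars \<rho> U)" if "\<sigma> \<in> ISubst" for \<sigma>
    using U \<rho> that by (intro ecls_ESubst finite_ren_vars Subst_comp Ren_Subst ren_inv(1) ISubst_Subst)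
  then show "{ecls (ren_vars \<rho> U) (\<rho> \<circ>\<^sub>s \<sigma> \<circ>\<^sub>s ren_inv \<rho>) | \<sigma>. \<sigma> \<in> ISubst \<and> ecls U \<sigma> = c}
      \<subseteq> ESubst (ren_vars \<rho> U)" for c
    by auto
qed

lemma classwise_proj:
  "classwise (\<lambda>\<chi> :: ('f::ranked, 'v::infinite) psub. proj_ps \<chi> V)"
proof (rule classwiseI)
  show "proj_ps bot V = bot" "proj_ps top V = top" by (simp_all add: proj_ps_def Rep_bot Rep_top)
  show "proj_ps (Elem \<Theta> U) V = Elem (\<Union>c\<in>\<Theta>. {ecls (U \<inter> V) \<sigma> | \<sigma>. \<sigma> \<in> ISubst \<and> ecls U \<sigma> = c}) (U \<inter> V)"
    if "finite U" "\<Theta> \<subseteq> ESubst U" for \<Theta> :: "('f, 'v) subst set set" and U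
    using that by (rule proj_ps_Elem)
qed (auto simp: ESubst_def)

lemma classwise_unif:
  fixes \<delta> :: "('f::ranked, 'v::infinite) subst"
  assumes \<delta>: "\<delta> \<in> Subst"
  shows "classwise (\<lambda>\<chi>. unif_ps \<chi> \<delta>)"
proof (rule classwiseI)
  show "unif_ps bot \<delta> = bot" "unif_ps top \<delta> = top" by (simp_all add: unif_ps_def Rep_bot Rep_top)
  show "unif_ps (Elem \<Theta> U) \<delta> = Elem (\<Union>c\<in>\<Theta>. \<Union>\<sigma>\<in>{\<sigma> \<in> ISubst. ecls U \<sigma> = c}. emgu U \<sigma> (subst_vars \<delta>) \<delta>)
    (U \<union> subst_vars \<delta>)" if "finite U" "\<Theta> \<subseteq> ESubst U" for \<Theta> U
    using that by (rule unif_ps_Elem)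
  fix U :: "'v set" assume U: "finite U"
  then show "finite (U \<union> subst_vars \<delta>)" using \<delta> by simp
  show "(\<Union>\<sigma>\<in>{\<sigma> \<in> ISubst. ecls U \<sigma> = c}. emgu U \<sigma> (subst_vars \<delta>) \<delta>) \<subseteq> ESubst (U \<union> subst_vars \<delta>)" for c
    using U \<delta> by (intro UN_least emgu_subset_ESubst) (simp_all add: ISubst_Subst)
qed

lemma classwise_match1:
  fixes \<Theta>\<^sub>2 :: "('f::ranked, 'v::infinite) subst set set"
  assumes "finite U\<^sub>2" "\<Theta>\<^sub>2 \<subseteq> ESubst U\<^sub>2"
  shows "classwise (\<lambda>\<chi>. match_ps \<chi> (Elem \<Theta>\<^sub>2 U\<^sub>2))"
proof (rule classwiseI)
  show "match_ps bot (Elem \<Theta>\<^sub>2 U\<^sub>2) = bot" "match_ps top (Elem \<Theta>\<^sub>2 U\<^sub>2) = top"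
    using assms by (simp_all add: Elem_neq)
  show "match_ps (Elem \<Theta> U) (Elem \<Theta>\<^sub>2 U\<^sub>2) =
      Elem (\<Union>c\<in>\<Theta>. \<Union>c\<^sub>2\<in>\<Theta>\<^sub>2. match_classes U U\<^sub>2 c c\<^sub>2) (U \<union> U\<^sub>2)" if "finite U" "\<Theta> \<subseteq> ESubst U" for \<Theta> U
    using that assms by (rule match_ps_Elem)
  fix U :: "'v set" assume U: "finite U"
  then show "finite (U \<union> U\<^sub>2)" using assms by simp
  show "(\<Union>c\<^sub>2\<in>\<Theta>\<^sub>2. match_classes U U\<^sub>2 c c\<^sub>2) \<subseteq> ESubst (U \<union> U\<^sub>2)" for c
    using U assms by (intro UN_least match_classes_subset_ESubst)
qed

lemma classwise_match2:
  fixes \<Theta>\<^sub>1 :: "('f::ranked, 'v::infinite) subst set set"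
  assumes "finite U\<^sub>1" "\<Theta>\<^sub>1 \<subseteq> ESubst U\<^sub>1"
  shows "classwise (match_ps (Elem \<Theta>\<^sub>1 U\<^sub>1))"
proof (rule classwiseI)
  show "match_ps (Elem \<Theta>\<^sub>1 U\<^sub>1) bot = bot" "match_ps (Elem \<Theta>\<^sub>1 U\<^sub>1) top = top"
    using assms by (simp_all add: Elem_neq)
  show "match_ps (Elem \<Theta>\<^sub>1 U\<^sub>1) (Elem \<Theta> U) =
      Elem (\<Union>c\<in>\<Theta>. \<Union>c\<^sub>1\<in>\<Theta>\<^sub>1. match_classes U\<^sub>1 U c\<^sub>1 c) (U\<^sub>1 \<union> U)" if "finite U" "\<Theta> \<subseteq> ESubst U" for \<Theta> U
    unfolding match_ps_Elem[OF assms that] by (intro arg_cong[of _ _ "\<lambda>T. Elem T (U\<^sub>1 \<union> U)"]) blast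
  fix U :: "'v set" assume U: "finite U"
  then show "finite (U\<^sub>1 \<union> U)" using assms by simp
  show "(\<Union>c\<^sub>1\<in>\<Theta>\<^sub>1. match_classes U\<^sub>1 U c\<^sub>1 c) \<subseteq> ESubst (U\<^sub>1 \<union> U)" for c
    using U assms by (intro UN_least match_classes_subset_ESubst)
qed

section \<open>Continuity of forward and backward unification\<close>

definition apart_ren :: "'v set \<Rightarrow> 'v set \<Rightarrow> ('f::ranked, 'v) subst" where
  "apart_ren X Y = (SOME \<rho>. \<rho> \<in> Ren \<and> ren_vars \<rho> X \<inter> Y = {})"

lemma apart_ren:
  fixes X Y :: "'v::infinite set"
  assumes "finite X" "finite Y"
  shows "(apart_ren X Y :: ('f::ranked, 'v) subst) \<in> Ren"
    "ren_vars (apart_ren X Y :: ('f, 'v) subst) X \<inter> Y = {}"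
proof -
  have "(apart_ren X Y :: ('f, 'v) subst) \<in> Ren \<and> ren_vars (apart_ren X Y :: ('f, 'v) subst) X \<inter> Y = {}"
    using someI_ex[OF ex_Ren_apart[OF assms]] unfolding apart_ren_def .
  then show "(apart_ren X Y :: ('f, 'v) subst) \<in> Ren"
    "ren_vars (apart_ren X Y :: ('f, 'v) subst) X \<inter> Y = {}" by simp_all
qed

lemma finite_vars_ps [simp]: "finite (vars_ps \<chi>)"
  by (cases \<chi> rule: psub_cases) (simp_all add: vars_ps_def Rep_bot Rep_top Rep_Elem)

lemma vars_ps_Elem: "finite U \<Longrightarrow> \<Theta> \<subseteq> ESubst U \<Longrightarrow> vars_ps (Elem \<Theta> U) = U"
  by (simp add: vars_ps_def Rep_Elem)

text \<open>Unifiability after renaming apart, expressed by independent substitutions. Thus the test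
  for \<open>bot\<close> depends on the two atoms only, not on the argument from which the renaming
  is chosen.\<close>

definition unifiable_apart :: "('p, 'f::ranked, 'v) atom \<Rightarrow> ('p, 'f, 'v) atom \<Rightarrow> bool" where
  "unifiable_apart A B \<longleftrightarrow> (\<exists>\<tau>\<^sub>1\<in>Subst. \<exists>\<tau>\<^sub>2\<in>Subst. app_atom \<tau>\<^sub>1 A = app_atom \<tau>\<^sub>2 B)"

text \<open>\<tau>\<open>\<^sub>1\<close> is transported along \<rho> to the renamed copy of
  \<open>X\<close>, and \<tau>\<open>\<^sub>2\<close> is kept elsewhere. Composing with \<rho>
  recovers the first on \<open>X\<close>.\<close>

definition glue_ren ::
    "('f::ranked, 'v) subst \<Rightarrow> 'v set \<Rightarrow> ('f, 'v) subst \<Rightarrow> ('f, 'v) subst \<Rightarrow> ('f, 'v) subst" where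
  "glue_ren \<rho> X \<tau>\<^sub>1 \<tau>\<^sub>2 = glue (ren_vars \<rho> X) (\<tau>\<^sub>1 \<circ>\<^sub>s ren_inv \<rho>) \<tau>\<^sub>2"

lemma glue_ren_Subst [intro]: "\<rho> \<in> Ren \<Longrightarrow> \<tau>\<^sub>1 \<in> Subst \<Longrightarrow> \<tau>\<^sub>2 \<in> Subst \<Longrightarrow> glue_ren \<rho> X \<tau>\<^sub>1 \<tau>\<^sub>2 \<in> Subst"
  unfolding glue_ren_def using Ren_Subst ren_inv(1) by blast

lemma glue_ren_in: "\<rho> \<in> Ren \<Longrightarrow> x \<in> X \<Longrightarrow> (glue_ren \<rho> X \<tau>\<^sub>1 \<tau>\<^sub>2 \<circ>\<^sub>s \<rho>) x = \<tau>\<^sub>1 x"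
proof -
  assume \<rho>: "\<rho> \<in> Ren" and x: "x \<in> X"
  obtain y where y: "\<rho> x = Var y" using \<rho> by (auto elim: RenE)
  then have "y \<in> ren_vars \<rho> X" using \<rho> x by (auto simp: ren_vars_iff)
  then show ?thesis using comp_ren_inv_apply[OF \<rho> y] by (simp add: comp_apply y glue_ren_def glue_simps)
qed

lemma glue_ren_out: "x \<notin> ren_vars \<rho> X \<Longrightarrow> glue_ren \<rho> X \<tau>\<^sub>1 \<tau>\<^sub>2 x = \<tau>\<^sub>2 x"
  by (simp add: glue_ren_def glue_simps)

lemma glue_ren_atom_in:
  "\<rho> \<in> Ren \<Longrightarrow> vars_atom A \<subseteq> X \<Longrightarrow> app_atom (glue_ren \<rho> X \<tau>\<^sub>1 \<tau>\<^sub>2) (app_atom \<rho> A) = app_atom \<tau>\<^sub>1 A"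
  unfolding app_atom_comp[symmetric] by (subst app_atom_eq_iff) (auto simp: glue_ren_in)

lemma glue_ren_atom_out:
  "vars_atom A \<inter> ren_vars \<rho> X = {} \<Longrightarrow> app_atom (glue_ren \<rho> X \<tau>\<^sub>1 \<tau>\<^sub>2) A = app_atom \<tau>\<^sub>2 A"
  by (subst app_atom_eq_iff) (meson disjoint_iff glue_ren_out)

lemma unifiable_apart_iff:
  assumes \<rho>: "\<rho> \<in> Ren" and apart: "ren_vars \<rho> (vars_atom A) \<inter> vars_atom B = {}"
  shows "atom_unifiers (app_atom \<rho> A) B \<noteq> {} \<longleftrightarrow> unifiable_apart A B"
proof
  assume "atom_unifiers (app_atom \<rho> A) B \<noteq> {}"
  then obtain \<tau> where "\<tau> \<in> Subst" "app_atom (\<tau> \<circ>\<^sub>s \<rho>) A = app_atom \<tau> B"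
    by (auto simp: atom_unifiers_def app_atom_comp)
  then show "unifiable_apart A B" unfolding unifiable_apart_def using \<rho> Ren_Subst Subst_comp by metis
next
  assume "unifiable_apart A B"
  then obtain \<tau>\<^sub>1 \<tau>\<^sub>2 where \<tau>: "\<tau>\<^sub>1 \<in> Subst" "\<tau>\<^sub>2 \<in> Subst" "app_atom \<tau>\<^sub>1 A = app_atom \<tau>\<^sub>2 B"
    by (auto simp: unifiable_apart_def)
  have "glue_ren \<rho> (vars_atom A) \<tau>\<^sub>1 \<tau>\<^sub>2 \<in> atom_unifiers (app_atom \<rho> A) B"
    unfolding atom_unifiers_def using \<rho> \<tau> apart
    by (auto simp: glue_ren_atom_in glue_ren_atom_out Int_commute)
  then show "atom_unifiers (app_atom \<rho> A) B \<noteq> {}" by blast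
qed

lemma atom_mgu_Subst: "atom_unifiers A B \<noteq> {} \<Longrightarrow> atom_mgu A B \<in> Subst"
  using atom_mgu_is_mgu[of A B] by (simp add: is_atom_mgu_def is_mgu_def ISubst_Subst)

lemma bot_neq_top_psub: "(top :: ('f::ranked, 'v) psub) \<noteq> bot"
  by (metis Rep_bot Rep_top psub_rep.distinct(1))

text \<open>When one argument of \<open>match_ps\<close> is \<open>top\<close>, the result depends
  only on whether the other is \<open>bot\<close>, and the operators applied before it do not affect
  this.\<close>

lemma classwise_nonbot: "classwise f \<Longrightarrow> f \<chi> = bot \<longleftrightarrow> \<chi> = bot"
proof (cases \<chi> rule: psub_cases)
  case (Elem \<Theta> U)
  assume f: "classwise f"
  obtain U' h where "finite U'" "\<And>c. c \<in> ESubst U \<Longrightarrow> h c \<subseteq> ESubst U'"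
    "f (Elem \<Theta> U) = Elem (\<Union>(h ` \<Theta>)) U'"
    using classwiseE[OF f Elem(1)] Elem(2) by metis
  then show ?thesis using Elem(2) Elem_neq(1)[OF Elem(1,2)] Elem_neq(1)[of U' "\<Union>(h ` \<Theta>)"] 
    unfolding Elem(3) by auto
qed (auto simp: classwise_def bot_neq_top_psub)

lemma forward_ps_unfold:
  fixes \<chi> :: "('f::ranked, 'v::infinite) psub"
  shows "forward_ps \<chi> A B = (if unifiable_apart A B then
     let \<rho> = apart_ren (vars_ps \<chi> \<union> vars_atom A) (vars_atom B)
     in proj_ps (unif_ps (rename_ps \<rho> \<chi>) (atom_mgu (app_atom \<rho> A) B)) (vars_atom B) else bot)"
proof -
  let ?\<rho> = "apart_ren (vars_ps \<chi> \<union> vars_atom A) (vars_atom B) :: ('f, 'v) subst"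
  have "?\<rho> \<in> Ren" "ren_vars ?\<rho> (vars_ps \<chi> \<union> vars_atom A) \<inter> vars_atom B = {}"
    by (rule apart_ren; simp)+
  then have "atom_unifiers (app_atom ?\<rho> A) B \<noteq> {} \<longleftrightarrow> unifiable_apart A B"
    by (intro unifiable_apart_iff) (auto simp: ren_vars_Un)
  then show ?thesis unfolding forward_ps_def apart_ren_def Let_def by (cases "unifiable_apart A B") simp_all
qed

lemma backward_ps_unfold:
  fixes \<chi>\<^sub>1 \<chi>\<^sub>2 :: "('f::ranked, 'v::infinite) psub"
  shows "backward_ps \<chi>\<^sub>1 \<chi>\<^sub>2 A B = (if unifiable_apart A B then
     let \<rho> = apart_ren (vars_ps \<chi>\<^sub>1 \<union> vars_atom A) (vars_ps \<chi>\<^sub>2 \<union> vars_atom B)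
     in proj_ps (match_ps (rename_ps \<rho> \<chi>\<^sub>1) (unif_ps \<chi>\<^sub>2 (atom_mgu (app_atom \<rho> A) B)))
          (vars_ps \<chi>\<^sub>2 \<union> vars_atom B) else bot)"
proof -
  let ?\<rho> = "apart_ren (vars_ps \<chi>\<^sub>1 \<union> vars_atom A) (vars_ps \<chi>\<^sub>2 \<union> vars_atom B) :: ('f, 'v) subst"
  have "?\<rho> \<in> Ren" "ren_vars ?\<rho> (vars_ps \<chi>\<^sub>1 \<union> vars_atom A) \<inter> (vars_ps \<chi>\<^sub>2 \<union> vars_atom B) = {}"
    by (rule apart_ren; simp)+
  then have "atom_unifiers (app_atom ?\<rho> A) B \<noteq> {} \<longleftrightarrow> unifiable_apart A B"
    by (intro unifiable_apart_iff) (auto simp: ren_vars_Un)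
  then show ?thesis unfolding backward_ps_def apart_ren_def Let_def by (cases "unifiable_apart A B") simp_all
qed

lemma mgu_apart_Subst:
  fixes A B :: "('p, 'f::ranked, 'v::infinite) atom"
  assumes "unifiable_apart A B" "finite X" "finite Y" "vars_atom A \<subseteq> X" "vars_atom B \<subseteq> Y"
  shows "atom_mgu (app_atom (apart_ren X Y) A) B \<in> Subst"
proof (rule atom_mgu_Subst)
  let ?\<rho> = "apart_ren X Y :: ('f, 'v) subst"
  have "ren_vars ?\<rho> X \<inter> Y = {}" using assms(2,3) by (rule apart_ren)
  have "ren_vars ?\<rho> (vars_atom A) \<inter> vars_atom B = {}"
    using \<open>ren_vars ?\<rho> X \<inter> Y = {}\<close> ren_vars_mono[OF assms(4), of ?\<rho>] assms(5) by blast
  then show "atom_unifiers (app_atom ?\<rho> A) B \<noteq> {}"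
    using unifiable_apart_iff[OF apart_ren(1)] assms by blast
qed

text \<open>For a fixed variable set \<open>U\<close> the renaming and the mgu are constants, so the
  operator is there a composition of \<open>classwise\<close> ones.\<close>

lemma ps_mcont_forward:
  "ps_mcont (\<lambda>\<chi> :: ('f::ranked, 'v::infinite) psub. forward_ps \<chi> A B)"
proof (cases "unifiable_apart A B")
  case False
  then show ?thesis by (simp add: forward_ps_unfold)
next
  case True
  note [simp] = classwise_rename[OF apart_ren(1), unfolded classwise_def]
    classwise_proj[unfolded classwise_def] classwise_unif[OF mgu_apart_Subst[OF True], unfolded classwise_def]
  show ?thesis
  proof (intro classwise_mcont classwise_local)
    fix U :: "'v set" assume U: "finite U"
    let ?\<rho> = "apart_ren (U \<union> vars_atom A) (vars_atom B) :: ('f, 'v) subst"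
    let ?g = "\<lambda>\<chi>. proj_ps (unif_ps (rename_ps ?\<rho> \<chi>) (atom_mgu (app_atom ?\<rho> A) B)) (vars_atom B)"
    have "?\<rho> \<in> Ren" "atom_mgu (app_atom ?\<rho> A) B \<in> Subst"
      using U True by (auto intro!: apart_ren mgu_apart_Subst)
    then have "classwise ?g"
      by (intro classwise_comp[OF classwise_comp[OF classwise_rename classwise_unif] classwise_proj])
    then show "\<exists>g. classwise g \<and> (\<forall>\<Theta>\<subseteq>ESubst U. forward_ps (Elem \<Theta> U :: ('f, 'v) psub) A B = g (Elem \<Theta> U))"
      using U True by (intro exI[of _ ?g]) (simp add: forward_ps_unfold vars_ps_Elem Let_def)
  qed (simp_all add: forward_ps_unfold True Let_def)
qed

text \<open>If the fixed argument is an \<open>Elem\<close>, the unification step turns it into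
  another fixed \<open>Elem\<close>, and matching against that is \<open>classwise\<close>. The
  values \<open>bot\<close> and \<open>top\<close> of the fixed argument are treated apart because
  of the precedence rules of \<open>match_ps\<close>.\<close>

lemma ps_mcont_backward1:
  fixes \<chi>\<^sub>2 :: "('f::ranked, 'v::infinite) psub"
  shows "ps_mcont (\<lambda>\<chi>\<^sub>1. backward_ps \<chi>\<^sub>1 \<chi>\<^sub>2 A B)"
proof (cases "unifiable_apart A B")
  case False
  then show ?thesis by (simp add: backward_ps_unfold)
next
  case True
  note [simp] = classwise_rename[OF apart_ren(1), unfolded classwise_def]
    classwise_proj[unfolded classwise_def] classwise_unif[OF mgu_apart_Subst[OF True], unfolded classwise_def]
  show ?thesis
  proof (cases \<chi>\<^sub>2 rule: psub_cases)
    case bot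
    then show ?thesis by (simp add: backward_ps_unfold True Let_def)
  next
    case top
    have "backward_ps \<chi>\<^sub>1 \<chi>\<^sub>2 A B = (if \<chi>\<^sub>1 = bot then bot else top)" for \<chi>\<^sub>1
      by (simp add: backward_ps_unfold True Let_def top classwise_nonbot[OF classwise_rename[OF apart_ren(1)]])
    then show ?thesis by (simp add: ps_mcont_nonbot_top)
  next
    case (Elem \<Theta>\<^sub>2 U\<^sub>2)
    note ne = Elem_neq[OF Elem(1,2)]
    show ?thesis
    proof (intro classwise_mcont classwise_local)
      show "backward_ps bot \<chi>\<^sub>2 A B = bot" by (simp add: backward_ps_unfold True Let_def)
      show "backward_ps top \<chi>\<^sub>2 A B = top"
        by (simp add: backward_ps_unfold True Let_def Elem(3) ne classwise_nonbot[OF classwise_unif[OF mgu_apart_Subst[OF True]]])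
      fix U :: "'v set" assume U: "finite U"
      let ?\<rho> = "apart_ren (U \<union> vars_atom A) (U\<^sub>2 \<union> vars_atom B) :: ('f, 'v) subst"
      let ?u = "unif_ps \<chi>\<^sub>2 (atom_mgu (app_atom ?\<rho> A) B)"
      let ?g = "\<lambda>\<chi>. proj_ps (match_ps (rename_ps ?\<rho> \<chi>) ?u) (U\<^sub>2 \<union> vars_atom B)"
      have \<rho>: "?\<rho> \<in> Ren" and m: "atom_mgu (app_atom ?\<rho> A) B \<in> Subst"
        using U Elem(1) True by (auto intro!: apart_ren mgu_apart_Subst)
      obtain U' \<Theta>' where u: "finite U'" "\<Theta>' \<subseteq> ESubst U'" "?u = Elem \<Theta>' U'"
      proof -
        obtain U' h where "finite U'" "\<And>c. c \<in> ESubst U\<^sub>2 \<Longrightarrow> h c \<subseteq> ESubst U'" "?u = Elem (\<Union>(h ` \<Theta>\<^sub>2)) U'"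
          using classwiseE[OF classwise_unif[OF m] Elem(1)] Elem(2,3) by metis
        moreover from this have "\<Union>(h ` \<Theta>\<^sub>2) \<subseteq> ESubst U'" using Elem(2) by blast
        ultimately show ?thesis using that by blast
      qed
      have "classwise ?g"
        unfolding u(3)
        by (intro classwise_comp[OF classwise_comp[OF classwise_rename[OF \<rho>] classwise_match1[OF u(1,2)]] classwise_proj])
      then show "\<exists>g. classwise g \<and> (\<forall>\<Theta>\<subseteq>ESubst U. backward_ps (Elem \<Theta> U) \<chi>\<^sub>2 A B = g (Elem \<Theta> U))"
        using U True Elem by (intro exI[of _ ?g]) (simp add: backward_ps_unfold vars_ps_Elem Let_def)
    qed
  qed
qed

lemma ps_mcont_backward2:
  fixes \<chi>\<^sub>1 :: "('f::ranked, 'v::infinite) psub"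
  shows "ps_mcont (\<lambda>\<chi>\<^sub>2. backward_ps \<chi>\<^sub>1 \<chi>\<^sub>2 A B)"
proof (cases "unifiable_apart A B")
  case False
  then show ?thesis by (simp add: backward_ps_unfold)
next
  case True
  note [simp] = classwise_rename[OF apart_ren(1), unfolded classwise_def]
    classwise_proj[unfolded classwise_def] classwise_unif[OF mgu_apart_Subst[OF True], unfolded classwise_def]
  show ?thesis
  proof (cases \<chi>\<^sub>1 rule: psub_cases)
    case bot
    then show ?thesis by (simp add: backward_ps_unfold True Let_def)
  next
    case top
    have "backward_ps \<chi>\<^sub>1 \<chi>\<^sub>2 A B = (if \<chi>\<^sub>2 = bot then bot else top)" for \<chi>\<^sub>2
      by (simp add: backward_ps_unfold True Let_def top classwise_nonbot[OF classwise_unif[OF mgu_apart_Subst[OF True]]])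
    then show ?thesis by (simp add: ps_mcont_nonbot_top)
  next
    case (Elem \<Theta>\<^sub>1 U\<^sub>1)
    note ne = Elem_neq[OF Elem(1,2)]
    show ?thesis
    proof (intro classwise_mcont classwise_local)
      show "backward_ps \<chi>\<^sub>1 bot A B = bot" by (simp add: backward_ps_unfold True Let_def)
      show "backward_ps \<chi>\<^sub>1 top A B = top"
        by (simp add: backward_ps_unfold True Let_def Elem(3) ne classwise_nonbot[OF classwise_rename[OF apart_ren(1)]])
      fix U :: "'v set" assume U: "finite U"
      \<comment> \<open>The renaming depends on both variable sets, so even the renamed fixed
        argument varies with \<open>U\<close>; localisation to one \<open>U\<close> makes it
        constant.\<close>
      let ?\<rho> = "apart_ren (U\<^sub>1 \<union> vars_atom A) (U \<union> vars_atom B) :: ('f, 'v) subst"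
      let ?r = "rename_ps ?\<rho> \<chi>\<^sub>1"
      let ?g = "\<lambda>\<chi>. proj_ps (match_ps ?r (unif_ps \<chi> (atom_mgu (app_atom ?\<rho> A) B))) (U \<union> vars_atom B)"
      have \<rho>: "?\<rho> \<in> Ren" and m: "atom_mgu (app_atom ?\<rho> A) B \<in> Subst"
        using U Elem(1) True by (auto intro!: apart_ren mgu_apart_Subst)
      obtain U' \<Theta>' where u: "finite U'" "\<Theta>' \<subseteq> ESubst U'" "?r = Elem \<Theta>' U'"
      proof -
        obtain U' h where "finite U'" "\<And>c. c \<in> ESubst U\<^sub>1 \<Longrightarrow> h c \<subseteq> ESubst U'" "?r = Elem (\<Union>(h ` \<Theta>\<^sub>1)) U'"
          using classwiseE[OF classwise_rename[OF \<rho>] Elem(1)] Elem(2,3) by metis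
        moreover from this have "\<Union>(h ` \<Theta>\<^sub>1) \<subseteq> ESubst U'" using Elem(2) by blast
        ultimately show ?thesis using that by blast
      qed
      have "classwise ?g"
        unfolding u(3)
        by (intro classwise_comp[OF classwise_comp[OF classwise_unif[OF m] classwise_match2[OF u(1,2)]] classwise_proj])
      then show "\<exists>g. classwise g \<and> (\<forall>\<Theta>\<subseteq>ESubst U. backward_ps \<chi>\<^sub>1 (Elem \<Theta> U) A B = g (Elem \<Theta> U))"
        using U True Elem by (intro exI[of _ ?g]) (simp add: backward_ps_unfold vars_ps_Elem Let_def)
    qed
  qed
qed


section \<open>The least fixed point\<close>

lemma ps_mcont_body_sem: "is_denotation d \<Longrightarrow> ps_mcont (body_sem G d)"
proof (induction G)
  case (Cons A G)
  then have "ps_mcont (d A)" by (simp add: is_denotation_def)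
  moreover have "body_sem (A # G) d = (\<lambda>\<chi>. body_sem G d (d A \<chi>))" by (rule ext) simp
  ultimately show ?case using ccpo.mcont2mcont[OF complete_lattice_ccpo Cons.IH[OF Cons.prems]] by simp
next
  case Nil
  have "body_sem [] d = (\<lambda>\<chi>. \<chi>)" by (rule ext) simp
  then show ?case by simp
qed

text \<open>The input \<chi> is used twice, by forward unification and again as the caller's state
  in backward unification. Separate continuity in both arguments gives continuity along the
  diagonal.\<close>

lemma ps_mcont_clause_sem:
  fixes d :: "('p, 'f::ranked, 'v::infinite) denotation"
  assumes "is_denotation d"
  shows "ps_mcont (clause_sem cl d A)"
proof -
  have "ps_mcont (\<lambda>\<chi>. body_sem (body cl) d (forward_ps \<chi> A (head cl)))"
    using ccpo.mcont2mcont[OF complete_lattice_ccpo ps_mcont_body_sem[OF assms] ps_mcont_forward] .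
  from ccpo.mcont2mcont'[where f = "\<lambda>\<chi>\<^sub>2 \<chi>\<^sub>1. backward_ps \<chi>\<^sub>1 \<chi>\<^sub>2 (head cl) A",
      OF complete_lattice_ccpo ps_mcont_backward1 ps_mcont_backward2 this]
  have "ps_mcont (\<lambda>\<chi>. clause_sem cl d A \<chi>)" unfolding clause_sem_def .
  then show ?thesis .
qed

definition step_sem :: "('p, 'f::ranked, 'v) clause set \<Rightarrow> ('p, 'f, 'v) denotation \<Rightarrow> ('p, 'f, 'v) denotation" where
  "step_sem P d = (\<lambda>A \<chi>. SUP cl\<in>P. clause_sem cl d A \<chi>)"

lemma is_denotation_step_sem:
  fixes d :: "('p, 'f::ranked, 'v::infinite) denotation"
  assumes "is_denotation d"
  shows "is_denotation (step_sem P d)"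
  unfolding is_denotation_def step_sem_def using ps_mcont_clause_sem[OF assms]
  by (auto intro: ps_mcont_SUP)

text \<open>Family and argument grow together; the comparison goes through
  \<open>d' A \<chi>\<close>, so \<open>d'\<close> has to be monotone in its argument.\<close>

lemma body_sem_mono:
  assumes "is_denotation d'" "d \<le> d'" "\<chi> \<le> \<chi>'"
  shows "body_sem G d \<chi> \<le> body_sem G d' \<chi>'"
  using assms(3)
proof (induction G arbitrary: \<chi> \<chi>')
  case (Cons A G)
  have "d A \<chi> \<le> d' A \<chi>" using assms(2) by (simp add: le_fun_def)
  also have "\<dots> \<le> d' A \<chi>'" using assms(1) Cons.prems by (auto simp: is_denotation_def dest: ps_mcont_mono)
  finally show ?case by (simp add: Cons.IH)
qed simp

lemma step_sem_mono:
  fixes d d' :: "('p, 'f::ranked, 'v::infinite) denotation"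
  assumes "is_denotation d'" "d \<le> d'"
  shows "step_sem P d \<le> step_sem P d'"
  unfolding step_sem_def clause_sem_def
  by (intro le_funI SUP_mono) (meson assms body_sem_mono ps_mcont_mono[OF ps_mcont_backward1] order_refl)

lemma is_denotation_SUP: "(\<And>d. d \<in> D \<Longrightarrow> is_denotation d) \<Longrightarrow> is_denotation (Sup D)"
  unfolding is_denotation_def
proof
  fix A
  assume "\<And>d. d \<in> D \<Longrightarrow> \<forall>A. ps_mcont (d A)"
  then have "ps_mcont (\<lambda>\<chi>. SUP d\<in>D. d A \<chi>)" by (intro ps_mcont_SUP) blast
  moreover have "Sup D A = (\<lambda>\<chi>. SUP d\<in>D. d A \<chi>)" by (rule ext) (simp add: image_comp)
  ultimately show "ps_mcont (Sup D A)" by simp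
qed

text \<open>Knaster-Tarski, for denotations are closed under pointwise joins.\<close>

lemma prog_sem_fixpoint:
  fixes P :: "('p, 'f::ranked, 'v::infinite) clause set"
  shows "is_denotation (prog_sem P)" "step_sem P (prog_sem P) = prog_sem P"
proof -
  define Post where "Post = {e. is_denotation e \<and> step_sem P e \<le> e}"
  \<comment> \<open>The greatest lower bound of \<open>Post\<close> is taken among denotations, as a
    join of lower bounds. Pointwise infima would not do, since they need not be continuous.\<close>
  define L where "L = Sup {d. is_denotation d \<and> (\<forall>e\<in>Post. d \<le> e)}"
  have L: "is_denotation L" unfolding L_def by (rule is_denotation_SUP) simp
  have low: "L \<le> e" if "e \<in> Post" for e unfolding L_def using that by (intro Sup_least) auto
  have step: "is_denotation (step_sem P e)" if "is_denotation e" for e :: "('p, 'f, 'v) denotation"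
    using that by (rule is_denotation_step_sem)
  have "step_sem P L \<le> e" if "e \<in> Post" for e
    using step_sem_mono[of e L P] low that unfolding Post_def by (blast intro: order_trans)
  \<comment> \<open>\<open>step_sem P L\<close> is a denotation below every member of
    \<open>Post\<close>, hence one of the maps whose join is \<open>L\<close>.\<close>
  then have "step_sem P L \<le> L" using step[OF L] by (subst (2) L_def) (auto intro: Sup_upper)
  moreover from this have "step_sem P L \<in> Post"
    using step[OF L] step_sem_mono[OF L] by (simp add: Post_def)
  then have "L \<le> step_sem P L" by (rule low)
  ultimately have fp: "step_sem P L = L" by (rule order.antisym)
  have "prog_sem P = L"
    unfolding prog_sem_def step_sem_def[symmetric]
    using L fp low by (intro Least_equality) (auto simp: Post_def)
  then show "is_denotation (prog_sem P)" "step_sem P (prog_sem P) = prog_sem P"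
    using L fp by simp_all
qed

lemma clause_sem_le_prog_sem:
  fixes P :: "('p, 'f::ranked, 'v::infinite) clause set"
  assumes "cl \<in> P"
  shows "clause_sem cl (prog_sem P) A \<chi> \<le> prog_sem P A \<chi>"
  by (subst (2) prog_sem_fixpoint(2)[symmetric]) (use assms in \<open>auto simp: step_sem_def intro: SUP_upper\<close>)


section \<open>Singletons and their solution sets\<close>

text \<open>The invariant carried through the semantics: a singleton, recorded by its variable set
  and its solutions instead of a representative.\<close>

definition represents :: "('f::ranked, 'v) psub \<Rightarrow> 'v set \<Rightarrow> ('f, 'v) subst set \<Rightarrow> bool" where
  "represents \<chi> U S \<longleftrightarrow> finite U \<and> (\<exists>\<theta>\<in>Subst. \<chi> = Elem {ecls U \<theta>} U \<and> Sol U \<theta> = S)"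

lemma representsI: "finite U \<Longrightarrow> \<theta> \<in> Subst \<Longrightarrow> represents (Elem {ecls U \<theta>} U) U (Sol U \<theta>)"
  unfolding represents_def by blast

text \<open>\<open>S\<close> is a cylinder over \<open>U\<close>. Solutions may thus be altered
  freely outside \<open>U\<close>, which is what gluing requires.\<close>

lemma represents_cong:
  "represents \<chi> U S \<Longrightarrow> \<tau> \<in> S \<Longrightarrow> \<tau>' \<in> Subst \<Longrightarrow> (\<And>u. u \<in> U \<Longrightarrow> \<tau>' u = \<tau> u) \<Longrightarrow> \<tau>' \<in> S"
  unfolding represents_def using Sol_cong by blast

lemma represents_Subst: "represents \<chi> U S \<Longrightarrow> \<tau> \<in> S \<Longrightarrow> \<tau> \<in> Subst"
  unfolding represents_def using Sol_Subst by blast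

lemma represents_vars_ps:
  fixes \<chi> :: "('f::ranked, 'v::infinite) psub"
  shows "represents \<chi> U S \<Longrightarrow> vars_ps \<chi> = U"
  by (auto simp: represents_def vars_ps_Elem ecls_ESubst)

text \<open>Renaming and projection collect one class for every idempotent representative. If the
  new solution set depends only on the old one, these classes coincide, and a fresh representative
  shows that there is one.\<close>

lemma classes_singleton:
  fixes \<theta> :: "('f::ranked, 'v::infinite) subst" and g :: "('f, 'v) subst \<Rightarrow> ('f, 'v) subst"
  assumes "finite U" "\<theta> \<in> Subst" "finite V"
    and g: "\<And>\<sigma>. \<sigma> \<in> ISubst \<Longrightarrow> Sol U \<sigma> = Sol U \<theta> \<Longrightarrow> g \<sigma> \<in> Subst \<and> Sol V (g \<sigma>) = S"
  shows "represents (Elem {ecls V (g \<sigma>) | \<sigma>. \<sigma> \<in> ISubst \<and> ecls U \<sigma> = ecls U \<theta>} V) V S"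
proof -
  obtain \<sigma>\<^sub>0 where \<sigma>\<^sub>0: "\<sigma>\<^sub>0 \<in> ISubst" "Sol U \<sigma>\<^sub>0 = Sol U \<theta>"
    using fresh_representative[OF assms(2,1,1)] by blast
  have cls: "\<sigma> \<in> ISubst \<and> ecls U \<sigma> = ecls U \<theta> \<longleftrightarrow> \<sigma> \<in> ISubst \<and> Sol U \<sigma> = Sol U \<theta>" for \<sigma>
    using ecls_eq_iff[OF assms(1) ISubst_Subst assms(2)] by blast
  have "ecls V (g \<sigma>) = ecls V (g \<sigma>\<^sub>0)" if "\<sigma> \<in> ISubst" "Sol U \<sigma> = Sol U \<theta>" for \<sigma>
    using g[OF that] g[OF \<sigma>\<^sub>0] assms(3) by (simp add: ecls_eq_iff)
  then have "{ecls V (g \<sigma>) | \<sigma>. \<sigma> \<in> ISubst \<and> ecls U \<sigma> = ecls U \<theta>} = {ecls V (g \<sigma>\<^sub>0)}"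
    unfolding cls using \<sigma>\<^sub>0 by blast
  then show ?thesis using g[OF \<sigma>\<^sub>0] assms(3) unfolding represents_def by auto
qed

text \<open>An instantiation \<delta> of the conjugate becomes
  \<open>\<delta> \<circ>\<^sub>s \<rho>\<close> for \<sigma>, and in the other direction
  \<open>\<delta> \<circ>\<^sub>s ren_inv \<rho>\<close>.\<close>

lemma Sol_rename:
  assumes \<rho>: "\<rho> \<in> Ren"
  shows "Sol (ren_vars \<rho> U) (\<rho> \<circ>\<^sub>s \<sigma> \<circ>\<^sub>s ren_inv \<rho>) = {\<tau> \<in> Subst. \<tau> \<circ>\<^sub>s \<rho> \<in> Sol U \<sigma>}"
proof (intro set_eqI iffI)
  fix \<tau> assume \<tau>: "\<tau> \<in> Sol (ren_vars \<rho> U) (\<rho> \<circ>\<^sub>s \<sigma> \<circ>\<^sub>s ren_inv \<rho>)"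
  then obtain \<delta> where \<delta>: "\<delta> \<in> Subst" "\<forall>x\<in>ren_vars \<rho> U. \<tau> x = (\<delta> \<circ>\<^sub>s (\<rho> \<circ>\<^sub>s \<sigma> \<circ>\<^sub>s ren_inv \<rho>)) x"
    by (rule SolE)
  have "(\<tau> \<circ>\<^sub>s \<rho>) y = app_trm (\<delta> \<circ>\<^sub>s \<rho>) (\<sigma> y)" if "y \<in> U" for y
  proof -
    obtain x where x: "\<rho> y = Var x" using \<rho> by (auto elim: RenE)
    then have "x \<in> ren_vars \<rho> U" using that \<rho> by (auto simp: ren_vars_iff)
    then have "\<tau> x = ((\<delta> \<circ>\<^sub>s \<rho> \<circ>\<^sub>s \<sigma>) \<circ>\<^sub>s ren_inv \<rho>) x" using \<delta>(2) by (simp add: subst_comp_assoc)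
    also have "\<dots> = (\<delta> \<circ>\<^sub>s \<rho> \<circ>\<^sub>s \<sigma>) y" using \<rho> x by (rule comp_ren_inv_apply)
    also have "\<dots> = app_trm (\<delta> \<circ>\<^sub>s \<rho>) (\<sigma> y)" by (simp add: comp_apply app_trm_comp)
    finally show ?thesis by (simp add: comp_apply x)
  qed
  moreover have "\<tau> \<circ>\<^sub>s \<rho> \<in> Subst" "\<delta> \<circ>\<^sub>s \<rho> \<in> Subst" using \<tau> \<delta> \<rho> by (auto dest: Sol_Subst Ren_Subst)
  ultimately show "\<tau> \<in> {\<tau> \<in> Subst. \<tau> \<circ>\<^sub>s \<rho> \<in> Sol U \<sigma>}"
    using Sol_Subst[OF \<tau>] unfolding Sol_def inst_on_def by blast
next
  fix \<tau> assume "\<tau> \<in> {\<tau> \<in> Subst. \<tau> \<circ>\<^sub>s \<rho> \<in> Sol U \<sigma>}"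
  then have \<tau>: "\<tau> \<in> Subst" and "\<tau> \<circ>\<^sub>s \<rho> \<in> Sol U \<sigma>" by blast+
  then obtain \<delta> where \<delta>: "\<delta> \<in> Subst" "\<forall>y\<in>U. (\<tau> \<circ>\<^sub>s \<rho>) y = (\<delta> \<circ>\<^sub>s \<sigma>) y" by (auto elim: SolE)
  have "\<tau> x = app_trm (\<delta> \<circ>\<^sub>s ren_inv \<rho>) ((\<rho> \<circ>\<^sub>s \<sigma> \<circ>\<^sub>s ren_inv \<rho>) x)" if x: "x \<in> ren_vars \<rho> U" for x
  proof -
    obtain y where y: "y \<in> U" "\<rho> y = Var x" using x \<rho> by (auto simp: ren_vars_iff)
    have "app_trm (\<delta> \<circ>\<^sub>s ren_inv \<rho>) ((\<rho> \<circ>\<^sub>s \<sigma> \<circ>\<^sub>s ren_inv \<rho>) x)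
      = ((\<delta> \<circ>\<^sub>s (ren_inv \<rho> \<circ>\<^sub>s \<rho>) \<circ>\<^sub>s \<sigma>) \<circ>\<^sub>s ren_inv \<rho>) x"
      by (simp add: comp_apply app_trm_comp)
    also have "\<dots> = (\<delta> \<circ>\<^sub>s \<sigma>) y" using comp_ren_inv_apply[OF \<rho> y(2)] \<rho> by (simp add: ren_inv)
    also have "\<dots> = \<tau> x" using \<delta>(2) y by (metis comp_apply app_trm.simps(1))
    finally show ?thesis by simp
  qed
  moreover have "\<delta> \<circ>\<^sub>s ren_inv \<rho> \<in> Subst" using \<delta> \<rho> ren_inv(1) Ren_Subst by blast
  ultimately show "\<tau> \<in> Sol (ren_vars \<rho> U) (\<rho> \<circ>\<^sub>s \<sigma> \<circ>\<^sub>s ren_inv \<rho>)"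
    using \<tau> unfolding Sol_def inst_on_def by blast
qed

lemma represents_rename:
  fixes \<chi> :: "('f::ranked, 'v::infinite) psub"
  assumes "represents \<chi> U S" and \<rho>: "\<rho> \<in> Ren"
  shows "represents (rename_ps \<rho> \<chi>) (ren_vars \<rho> U) {\<tau> \<in> Subst. \<tau> \<circ>\<^sub>s \<rho> \<in> S}"
proof -
  obtain \<theta> where U: "finite U" and \<theta>: "\<theta> \<in> Subst" "\<chi> = Elem {ecls U \<theta>} U" "Sol U \<theta> = S"
    using assms by (auto simp: represents_def)
  have "\<rho> \<circ>\<^sub>s \<sigma> \<circ>\<^sub>s ren_inv \<rho> \<in> Subst" if "\<sigma> \<in> ISubst" for \<sigma>
    using \<rho> that by (intro Subst_comp Ren_Subst ren_inv(1) ISubst_Subst)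
  then have "represents (Elem {ecls (ren_vars \<rho> U) (\<rho> \<circ>\<^sub>s \<sigma> \<circ>\<^sub>s ren_inv \<rho>) | \<sigma>. \<sigma> \<in> ISubst \<and> ecls U \<sigma> = ecls U \<theta>}
      (ren_vars \<rho> U)) (ren_vars \<rho> U) {\<tau> \<in> Subst. \<tau> \<circ>\<^sub>s \<rho> \<in> S}"
    using U \<theta> by (intro classes_singleton) (simp_all add: Sol_rename[OF \<rho>])
  then show ?thesis using U \<theta> by (simp add: rename_ps_Elem ecls_ESubst)
qed

lemma Sol_proj:
  assumes "\<sigma> \<in> Subst" "V \<subseteq> U"
  shows "Sol V \<sigma> = {\<tau> \<in> Subst. \<exists>\<tau>'\<in>Sol U \<sigma>. \<forall>u\<in>V. \<tau>' u = \<tau> u}"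
proof (intro set_eqI iffI)
  fix \<tau> assume \<tau>: "\<tau> \<in> Sol V \<sigma>"
  then obtain \<delta> where "\<delta> \<in> Subst" "\<forall>u\<in>V. \<tau> u = (\<delta> \<circ>\<^sub>s \<sigma>) u" by (rule SolE)
  then show "\<tau> \<in> {\<tau> \<in> Subst. \<exists>\<tau>'\<in>Sol U \<sigma>. \<forall>u\<in>V. \<tau>' u = \<tau> u}"
    using Sol_comp[OF assms(1)] Sol_Subst[OF \<tau>] by (auto intro!: bexI[of _ "\<delta> \<circ>\<^sub>s \<sigma>"])
next
  fix \<tau> assume "\<tau> \<in> {\<tau> \<in> Subst. \<exists>\<tau>'\<in>Sol U \<sigma>. \<forall>u\<in>V. \<tau>' u = \<tau> u}"
  then obtain \<tau>' where \<tau>': "\<tau> \<in> Subst" "\<tau>' \<in> Sol U \<sigma>" "\<forall>u\<in>V. \<tau>' u = \<tau> u" by blast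
  then have "\<tau>' \<in> Sol V \<sigma>" using assms(2) unfolding Sol_def inst_on_def by blast
  then show "\<tau> \<in> Sol V \<sigma>" by (rule Sol_cong) (use \<tau>' in auto)
qed

lemma represents_proj:
  fixes \<chi> :: "('f::ranked, 'v::infinite) psub"
  assumes "represents \<chi> U S"
  shows "represents (proj_ps \<chi> V) (U \<inter> V) {\<tau> \<in> Subst. \<exists>\<tau>'\<in>S. \<forall>u\<in>U \<inter> V. \<tau>' u = \<tau> u}"
proof -
  obtain \<theta> where U: "finite U" and \<theta>: "\<theta> \<in> Subst" "\<chi> = Elem {ecls U \<theta>} U" "Sol U \<theta> = S"
    using assms by (auto simp: represents_def)
  have "represents (Elem {ecls (U \<inter> V) \<sigma> | \<sigma>. \<sigma> \<in> ISubst \<and> ecls U \<sigma> = ecls U \<theta>} (U \<inter> V)) (U \<inter> V)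
      {\<tau> \<in> Subst. \<exists>\<tau>'\<in>S. \<forall>u\<in>U \<inter> V. \<tau>' u = \<tau> u}"
    using U \<theta> by (intro classes_singleton) (simp_all add: Sol_proj[of _ "U \<inter> V" U] ISubst_Subst)
  then show ?thesis using U \<theta> by (simp add: proj_ps_Elem ecls_ESubst)
qed

text \<open>The hypothesis \<open>ne\<close> expresses unifiability; with no common solution the
  class would be dropped, leaving an empty set of classes.\<close>

lemma represents_unif:
  fixes \<chi> :: "('f::ranked, 'v::infinite) psub"
  assumes "represents \<chi> U S" and \<delta>: "\<delta> \<in> Subst" and ne: "S \<inter> Sol (subst_vars \<delta>) \<delta> \<noteq> {}"
  shows "represents (unif_ps \<chi> \<delta>) (U \<union> subst_vars \<delta>) (S \<inter> Sol (subst_vars \<delta>) \<delta>)"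
proof -
  obtain \<theta> where U: "finite U" and \<theta>: "\<theta> \<in> Subst" "\<chi> = Elem {ecls U \<theta>} U" "Sol U \<theta> = S"
    using assms by (auto simp: represents_def)
  note fin = U finite_subst_vars[OF \<delta>]
  obtain \<sigma>\<^sub>0 where \<sigma>\<^sub>0: "\<sigma>\<^sub>0 \<in> ISubst" "Sol U \<sigma>\<^sub>0 = Sol U \<theta>"
    using fresh_representative[OF \<theta>(1) U U] by blast
  obtain \<mu> where \<mu>: "\<mu> \<in> ISubst" "Sol (U \<union> subst_vars \<delta>) \<mu> = S \<inter> Sol (subst_vars \<delta>) \<delta>"
      "emgu U \<theta> (subst_vars \<delta>) \<delta> = {ecls (U \<union> subst_vars \<delta>) \<mu>}"
    using emgu_singleton[OF fin \<theta>(1) \<delta>] ne \<theta>(3) by metis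
  have "emgu U \<sigma> (subst_vars \<delta>) \<delta> = emgu U \<theta> (subst_vars \<delta>) \<delta>" if "\<sigma> \<in> ISubst" "ecls U \<sigma> = ecls U \<theta>" for \<sigma>
    using that U \<theta>(1) by (simp add: emgu_eq[OF fin _ \<delta>] ecls_eq_iff ISubst_Subst)
  moreover have "ecls U \<sigma>\<^sub>0 = ecls U \<theta>" using \<sigma>\<^sub>0 U \<theta>(1) by (simp add: ecls_eq_iff ISubst_Subst)
  ultimately have "(\<Union>\<sigma>\<in>{\<sigma> \<in> ISubst. ecls U \<sigma> = ecls U \<theta>}. emgu U \<sigma> (subst_vars \<delta>) \<delta>)
      = {ecls (U \<union> subst_vars \<delta>) \<mu>}"
    using \<sigma>\<^sub>0(1) \<mu>(3) by auto
  then have "unif_ps \<chi> \<delta> = Elem {ecls (U \<union> subst_vars \<delta>) \<mu>} (U \<union> subst_vars \<delta>)"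
    using U \<theta> by (simp add: unif_ps_Elem ecls_ESubst)
  then show ?thesis using \<mu>(1,2) fin unfolding represents_def by (auto simp: ISubst_Subst)
qed

text \<open>Hypothesis \<open>inst\<close> is the instance test of \<open>match_ps\<close> on the
  level of solution sets. All pairs of representatives that pass yield the same class, so it remains
  to exhibit one such pair.\<close>

lemma represents_match:
  fixes \<chi>\<^sub>1 \<chi>\<^sub>2 :: "('f::ranked, 'v::infinite) psub"
  assumes "represents \<chi>\<^sub>1 U\<^sub>1 S\<^sub>1" "represents \<chi>\<^sub>2 U\<^sub>2 S\<^sub>2"
    and inst: "\<And>\<tau>. \<tau> \<in> S\<^sub>1 \<Longrightarrow> \<exists>\<tau>'\<in>S\<^sub>2. \<forall>u\<in>U\<^sub>1 \<inter> U\<^sub>2. \<tau>' u = \<tau> u"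
    and ne: "S\<^sub>1 \<inter> S\<^sub>2 \<noteq> {}"
  shows "represents (match_ps \<chi>\<^sub>1 \<chi>\<^sub>2) (U\<^sub>1 \<union> U\<^sub>2) (S\<^sub>1 \<inter> S\<^sub>2)"
proof -
  obtain \<theta>\<^sub>1 where U\<^sub>1: "finite U\<^sub>1" and \<theta>\<^sub>1: "\<theta>\<^sub>1 \<in> Subst" "\<chi>\<^sub>1 = Elem {ecls U\<^sub>1 \<theta>\<^sub>1} U\<^sub>1" "Sol U\<^sub>1 \<theta>\<^sub>1 = S\<^sub>1"
    using assms(1) by (auto simp: represents_def)
  obtain \<theta>\<^sub>2 where U\<^sub>2: "finite U\<^sub>2" and \<theta>\<^sub>2: "\<theta>\<^sub>2 \<in> Subst" "\<chi>\<^sub>2 = Elem {ecls U\<^sub>2 \<theta>\<^sub>2} U\<^sub>2" "Sol U\<^sub>2 \<theta>\<^sub>2 = S\<^sub>2"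
    using assms(2) by (auto simp: represents_def)
  note fin = U\<^sub>1 U\<^sub>2
  obtain \<sigma>\<^sub>1 where \<sigma>\<^sub>1: "\<sigma>\<^sub>1 \<in> ISubst" "Sol U\<^sub>1 \<sigma>\<^sub>1 = S\<^sub>1"
    using fresh_representative[OF \<theta>\<^sub>1(1) U\<^sub>1 U\<^sub>1] \<theta>\<^sub>1(3) by metis
  obtain \<sigma>\<^sub>2 where \<sigma>\<^sub>2: "\<sigma>\<^sub>2 \<in> ISubst" "Sol U\<^sub>2 \<sigma>\<^sub>2 = S\<^sub>2"
    using fresh_representative[OF \<theta>\<^sub>2(1) U\<^sub>2 U\<^sub>2] \<theta>\<^sub>2(3) by metis
  obtain \<mu> where \<mu>: "\<mu> \<in> ISubst" "Sol (U\<^sub>1 \<union> U\<^sub>2) \<mu> = S\<^sub>1 \<inter> S\<^sub>2" "emgu U\<^sub>1 \<theta>\<^sub>1 U\<^sub>2 \<theta>\<^sub>2 = {ecls (U\<^sub>1 \<union> U\<^sub>2) \<mu>}"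
    using emgu_singleton[OF fin \<theta>\<^sub>1(1) \<theta>\<^sub>2(1)] ne \<theta>\<^sub>1(3) \<theta>\<^sub>2(3) by metis
  have cls\<^sub>1: "ecls U\<^sub>1 a = ecls U\<^sub>1 \<theta>\<^sub>1 \<longleftrightarrow> Sol U\<^sub>1 a = S\<^sub>1" if "a \<in> ISubst" for a
    using that U\<^sub>1 \<theta>\<^sub>1(1,3) by (simp add: ecls_eq_iff ISubst_Subst)
  have cls\<^sub>2: "ecls U\<^sub>2 a = ecls U\<^sub>2 \<theta>\<^sub>2 \<longleftrightarrow> Sol U\<^sub>2 a = S\<^sub>2" if "a \<in> ISubst" for a
    using that U\<^sub>2 \<theta>\<^sub>2(1,3) by (simp add: ecls_eq_iff ISubst_Subst)
  have e: "emgu U\<^sub>1 a U\<^sub>2 b = {ecls (U\<^sub>1 \<union> U\<^sub>2) \<mu>}" 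
    if "a \<in> ISubst" "Sol U\<^sub>1 a = S\<^sub>1" "b \<in> ISubst" "Sol U\<^sub>2 b = S\<^sub>2" for a b
    unfolding \<mu>(3)[symmetric] using that \<theta>\<^sub>1 \<theta>\<^sub>2 by (simp add: emgu_eq[OF fin] ISubst_Subst)
  have "inst_on (U\<^sub>1 \<inter> U\<^sub>2) \<sigma>\<^sub>1 \<sigma>\<^sub>2"
  proof -
    \<comment> \<open>Applied to \<sigma>\<open>\<^sub>1\<close> itself, \<open>inst\<close> gives a
      solution of the second class that agrees with it on the common variables; its instantiation is
      the one sought.\<close>
    have "\<sigma>\<^sub>1 \<in> S\<^sub>1" using \<sigma>\<^sub>1 Sol_self[OF ISubst_Subst] by metis
    then obtain \<tau>' where \<tau>': "\<tau>' \<in> Sol U\<^sub>2 \<sigma>\<^sub>2" "\<forall>u\<in>U\<^sub>1 \<inter> U\<^sub>2. \<tau>' u = \<sigma>\<^sub>1 u" using inst \<sigma>\<^sub>2(2) by metis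
    from \<tau>'(1) obtain \<delta> where \<delta>: "\<delta> \<in> Subst" "\<forall>u\<in>U\<^sub>2. \<tau>' u = (\<delta> \<circ>\<^sub>s \<sigma>\<^sub>2) u" by (rule SolE)
    have "\<sigma>\<^sub>1 u = app_trm \<delta> (\<sigma>\<^sub>2 u)" if "u \<in> U\<^sub>1 \<inter> U\<^sub>2" for u
      using that \<tau>'(2) \<delta>(2) by (simp add: comp_apply)
    then show ?thesis unfolding inst_on_def using \<delta>(1) by blast
  qed
  moreover define K where "K = {(a, b). a \<in> ISubst \<and> ecls U\<^sub>1 a = ecls U\<^sub>1 \<theta>\<^sub>1 \<and>
     b \<in> ISubst \<and> ecls U\<^sub>2 b = ecls U\<^sub>2 \<theta>\<^sub>2 \<and> inst_on (U\<^sub>1 \<inter> U\<^sub>2) a b}"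
  ultimately have K: "(\<sigma>\<^sub>1, \<sigma>\<^sub>2) \<in> K" using \<sigma>\<^sub>1 \<sigma>\<^sub>2 cls\<^sub>1 cls\<^sub>2 by simp
  have "(case p of (a, b) \<Rightarrow> emgu U\<^sub>1 a U\<^sub>2 b) = {ecls (U\<^sub>1 \<union> U\<^sub>2) \<mu>}" if "p \<in> K" for p
  proof (cases p)
    case (Pair a b)
    then have "a \<in> ISubst" "ecls U\<^sub>1 a = ecls U\<^sub>1 \<theta>\<^sub>1" "b \<in> ISubst" "ecls U\<^sub>2 b = ecls U\<^sub>2 \<theta>\<^sub>2"
      using that by (simp_all add: K_def)
    then show ?thesis using e cls\<^sub>1 cls\<^sub>2 by (simp add: Pair)
  qed
  then have "(\<Union>p\<in>K. case p of (a, b) \<Rightarrow> emgu U\<^sub>1 a U\<^sub>2 b) = (\<Union>p\<in>K. {ecls (U\<^sub>1 \<union> U\<^sub>2) \<mu>})"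
    by (rule SUP_cong[OF refl])
  also have "\<dots> = {ecls (U\<^sub>1 \<union> U\<^sub>2) \<mu>}" using K by blast
  finally have "match_classes U\<^sub>1 U\<^sub>2 (ecls U\<^sub>1 \<theta>\<^sub>1) (ecls U\<^sub>2 \<theta>\<^sub>2) = {ecls (U\<^sub>1 \<union> U\<^sub>2) \<mu>}"
    unfolding match_classes_def K_def .
  then have "match_ps \<chi>\<^sub>1 \<chi>\<^sub>2 = Elem {ecls (U\<^sub>1 \<union> U\<^sub>2) \<mu>} (U\<^sub>1 \<union> U\<^sub>2)"
    using fin \<theta>\<^sub>1 \<theta>\<^sub>2 by (simp add: match_ps_Elem ecls_ESubst)
  then show ?thesis using \<mu>(1,2) fin unfolding represents_def by (auto simp: ISubst_Subst)
qed

section \<open>Forward and backward unification on solution sets\<close>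

lemma mgu_apart_vars:
  assumes "is_atom_mgu A B \<delta>" and apart: "vars_atom A \<inter> vars_atom B = {}"
  shows "subst_vars \<delta> = vars_atom A \<union> vars_atom B"
proof
  show "subst_vars \<delta> \<subseteq> vars_atom A \<union> vars_atom B"
    using assms(1) by (simp add: is_atom_mgu_def is_mgu_def)
  have eq: "app_atom \<delta> A = app_atom \<delta> B"
    using assms(1) by (simp add: is_atom_mgu_def is_mgu_def atom_unifiers_def)
  \<comment> \<open>A variable that \<delta> leaves untouched still occurs in the instance of its
    own atom, hence in that of the other. There it must come from the image of a different variable,
    which puts it into the range.\<close>
  have *: "x \<in> subst_vars \<delta>" 
    if "x \<in> vars_atom C" "vars_atom C \<inter> vars_atom D = {}" "app_atom \<delta> C = app_atom \<delta> D" 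
    for x and C D :: "('a, 'b, 'c) atom"
  proof (rule ccontr)
    assume nx: "x \<notin> subst_vars \<delta>"
    then have "x \<in> vars_trm (\<delta> x)" by (simp add: subst_vars_cases)
    then have "x \<in> vars_atom (app_atom \<delta> D)" using that by (auto simp: vars_app_atom simp flip: that(3))
    then obtain y where y: "y \<in> vars_atom D" "x \<in> vars_trm (\<delta> y)" by (auto simp: vars_app_atom)
    then have "\<delta> y \<noteq> Var y" using that(1,2) by auto
    then show False using y(2) nx by (auto simp: subst_vars_def subst_rng_def subst_dom_def)
  qed
  show "vars_atom A \<union> vars_atom B \<subseteq> subst_vars \<delta>"
    using *[of _ A B, OF _ apart eq] *[of _ B A, OF _ _ eq[symmetric]] apart by blast
qed

text \<open>By \<open>mgu_apart_vars\<close> the set \<open>subst_vars \<delta>\<close> covers both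
  atoms, so a unifier that agrees with \<tau> there can be replaced by \<tau>.\<close>

lemma Sol_atom_mgu:
  assumes m: "is_atom_mgu A B \<delta>" and apart: "vars_atom A \<inter> vars_atom B = {}"
  shows "Sol (subst_vars \<delta>) \<delta> = {\<tau> \<in> Subst. app_atom \<tau> A = app_atom \<tau> B}"
proof -
  have "Sol (subst_vars \<delta>) \<delta> = {\<tau> \<in> Subst. \<exists>\<tau>'\<in>atom_unifiers A B. \<forall>u\<in>subst_vars \<delta>. \<tau>' u = \<tau> u}"
    using m unfolding is_atom_mgu_def by (rule Sol_mgu) (rule atom_unifiers_comp)
  also have "\<dots> = {\<tau> \<in> Subst. app_atom \<tau> A = app_atom \<tau> B}"
  proof (intro Collect_cong conj_cong refl iffI)
    fix \<tau> assume "\<exists>\<tau>'\<in>atom_unifiers A B. \<forall>u\<in>subst_vars \<delta>. \<tau>' u = \<tau> u"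
    then obtain \<tau>' where "app_atom \<tau>' A = app_atom \<tau>' B" "\<forall>u\<in>vars_atom A \<union> vars_atom B. \<tau>' u = \<tau> u"
      unfolding mgu_apart_vars[OF assms] atom_unifiers_def by blast
    moreover from this(2) have "app_atom \<tau>' A = app_atom \<tau> A" "app_atom \<tau>' B = app_atom \<tau> B"
      by (simp_all add: app_atom_eq_iff)
    ultimately show "app_atom \<tau> A = app_atom \<tau> B" by simp
  qed (auto simp: atom_unifiers_def)
  finally show ?thesis .
qed

text \<open>
  In terms of solution sets the renaming disappears: it is absorbed by using independent
  substitutions on the two sides.
\<close>

lemma represents_forward:
  fixes \<chi> :: "('f::ranked, 'v::infinite) psub" and A H :: "('p, 'f, 'v) atom"
  assumes \<chi>: "represents \<chi> U S"
    and ne: "\<exists>\<tau>\<in>Subst. \<exists>\<tau>'\<in>S. app_atom \<tau>' A = app_atom \<tau> H"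
  shows "represents (forward_ps \<chi> A H) (vars_atom H)
    {\<tau> \<in> Subst. \<exists>\<tau>'\<in>S. app_atom \<tau>' A = app_atom \<tau> H}"
proof -
  have U: "finite U" "vars_ps \<chi> = U" using \<chi> represents_vars_ps by (auto simp: represents_def)
  define \<rho> :: "('f, 'v) subst" where "\<rho> = apart_ren (U \<union> vars_atom A) (vars_atom H)"
  have \<rho>: "\<rho> \<in> Ren" and apart: "ren_vars \<rho> (U \<union> vars_atom A) \<inter> vars_atom H = {}"
    unfolding \<rho>_def using U by (intro apart_ren; simp)+
  have apart': "vars_atom (app_atom \<rho> A) \<inter> vars_atom H = {}"
    using apart by (auto simp: vars_app_atom_ren ren_vars_Un)
  obtain \<tau> \<tau>' where \<tau>: "\<tau> \<in> Subst" "\<tau>' \<in> S" "app_atom \<tau>' A = app_atom \<tau> H" using ne by blast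
  have \<tau>': "\<tau>' \<in> Subst" using \<chi> \<tau>(2) by (rule represents_Subst)
  have ua: "unifiable_apart A H" unfolding unifiable_apart_def using \<tau> \<tau>' by blast
  define \<delta> where "\<delta> = atom_mgu (app_atom \<rho> A) H"
  have m: "is_atom_mgu (app_atom \<rho> A) H \<delta>"
    unfolding \<delta>_def using unifiable_apart_iff[OF \<rho>, of A H] ua apart'
    by (intro atom_mgu_is_mgu) (simp add: vars_app_atom_ren)
  have \<delta>: "\<delta> \<in> Subst" using m by (simp add: is_atom_mgu_def is_mgu_def ISubst_Subst)
  note v\<delta> = mgu_apart_vars[OF m apart']
  note S\<delta> = Sol_atom_mgu[OF m apart']
  \<comment> \<open>Joint solutions for the renamed caller and the clause head, before projection
    forgets the caller.\<close>
  define T where "T = {\<tau> \<in> Subst. \<tau> \<circ>\<^sub>s \<rho> \<in> S} \<inter> Sol (subst_vars \<delta>) \<delta>"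
  have T: "\<sigma> \<in> T \<longleftrightarrow> \<sigma> \<in> Subst \<and> \<sigma> \<circ>\<^sub>s \<rho> \<in> S \<and> app_atom (\<sigma> \<circ>\<^sub>s \<rho>) A = app_atom \<sigma> H" for \<sigma>
    unfolding T_def S\<delta> by (auto simp: app_atom_comp)
  have glue: "\<exists>\<sigma>\<in>T. \<forall>u\<in>vars_atom H. \<sigma> u = \<alpha> u"
    if \<alpha>: "\<alpha> \<in> Subst" "\<alpha>' \<in> S" "app_atom \<alpha>' A = app_atom \<alpha> H" for \<alpha> \<alpha>'
  proof -
    let ?g = "glue_ren \<rho> (U \<union> vars_atom A) \<alpha>' \<alpha>"
    have \<alpha>': "\<alpha>' \<in> Subst" using \<chi> \<alpha>(2) by (rule represents_Subst)
    then have g: "?g \<in> Subst" using \<rho> \<alpha> by blast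
    have "?g \<circ>\<^sub>s \<rho> \<in> S"
      by (rule represents_cong[OF \<chi> \<alpha>(2)]) (use g \<rho> in \<open>auto simp: glue_ren_in dest: Ren_Subst\<close>)
    moreover have "app_atom (?g \<circ>\<^sub>s \<rho>) A = app_atom ?g H"
      unfolding app_atom_comp using \<rho> apart \<alpha>(3) by (simp add: glue_ren_atom_in glue_ren_atom_out Int_commute)
    ultimately have "?g \<in> T" using g by (simp add: T)
    moreover have "\<forall>u\<in>vars_atom H. ?g u = \<alpha> u" using apart by (auto intro!: glue_ren_out)
    ultimately show ?thesis by blast
  qed
  have "represents (rename_ps \<rho> \<chi>) (ren_vars \<rho> U) {\<tau> \<in> Subst. \<tau> \<circ>\<^sub>s \<rho> \<in> S}"
    using \<chi> \<rho> by (rule represents_rename)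
  then have "represents (unif_ps (rename_ps \<rho> \<chi>) \<delta>) (ren_vars \<rho> U \<union> subst_vars \<delta>) T"
    unfolding T_def using \<delta> by (rule represents_unif) (use glue[OF \<tau>] in \<open>auto simp: T_def\<close>)
  then have "represents (proj_ps (unif_ps (rename_ps \<rho> \<chi>) \<delta>) (vars_atom H))
      ((ren_vars \<rho> U \<union> subst_vars \<delta>) \<inter> vars_atom H)
      {\<tau> \<in> Subst. \<exists>\<tau>'\<in>T. \<forall>u\<in>(ren_vars \<rho> U \<union> subst_vars \<delta>) \<inter> vars_atom H. \<tau>' u = \<tau> u}"
    by (rule represents_proj)
  moreover have "(ren_vars \<rho> U \<union> subst_vars \<delta>) \<inter> vars_atom H = vars_atom H"
    unfolding v\<delta> by blast
  moreover have "{\<tau> \<in> Subst. \<exists>\<tau>'\<in>T. \<forall>u\<in>vars_atom H. \<tau>' u = \<tau> u}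
      = {\<tau> \<in> Subst. \<exists>\<tau>'\<in>S. app_atom \<tau>' A = app_atom \<tau> H}"
  proof (intro Collect_cong conj_cong refl iffI)
    fix \<alpha> assume "\<exists>\<tau>'\<in>T. \<forall>u\<in>vars_atom H. \<tau>' u = \<alpha> u"
    then obtain \<sigma> where "\<sigma> \<in> T" "\<forall>u\<in>vars_atom H. \<sigma> u = \<alpha> u" by blast
    moreover from this(2) have "app_atom \<sigma> H = app_atom \<alpha> H" by (simp add: app_atom_eq_iff)
    ultimately show "\<exists>\<tau>'\<in>S. app_atom \<tau>' A = app_atom \<alpha> H" unfolding T by metis
  qed (use glue in blast)
  ultimately show ?thesis
    unfolding forward_ps_unfold U(2) using ua by (simp add: Let_def flip: \<rho>_def \<delta>_def)
qed

text \<open>\<open>S\<close> holds the caller's solutions and \<open>T\<close> the exit solutions of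
  the clause body. Hypothesis \<open>inst\<close> says that the exit refines what the caller passed
  in; this is what lets the pair through the test of \<open>match_ps\<close>.\<close>

lemma represents_backward:
  fixes \<chi>\<^sub>1 \<chi>\<^sub>2 :: "('f::ranked, 'v::infinite) psub" and A H :: "('p, 'f, 'v) atom"
  assumes \<chi>\<^sub>1: "represents \<chi>\<^sub>1 V T" and H: "vars_atom H \<subseteq> V"
    and \<chi>\<^sub>2: "represents \<chi>\<^sub>2 U S"
    and inst: "\<And>\<tau>. \<tau> \<in> T \<Longrightarrow> \<exists>\<tau>'\<in>S. app_atom \<tau>' A = app_atom \<tau> H"
    and ne: "T \<noteq> {}"
  shows "represents (backward_ps \<chi>\<^sub>1 \<chi>\<^sub>2 H A) (U \<union> vars_atom A)
    {\<tau> \<in> S. \<exists>\<tau>'\<in>T. app_atom \<tau>' H = app_atom \<tau> A}"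
proof -
  have U: "finite U" "vars_ps \<chi>\<^sub>2 = U" using \<chi>\<^sub>2 represents_vars_ps by (auto simp: represents_def)
  have V: "finite V" "vars_ps \<chi>\<^sub>1 = V" using \<chi>\<^sub>1 represents_vars_ps by (auto simp: represents_def)
  have VH: "V \<union> vars_atom H = V" using H by blast
  define \<rho> :: "('f, 'v) subst" where "\<rho> = apart_ren V (U \<union> vars_atom A)"
  have \<rho>: "\<rho> \<in> Ren" and apart: "ren_vars \<rho> V \<inter> (U \<union> vars_atom A) = {}"
    unfolding \<rho>_def using U V by (intro apart_ren; simp)+
  have apart': "vars_atom (app_atom \<rho> H) \<inter> vars_atom A = {}"
    using apart ren_vars_mono[OF H, of \<rho>] by (auto simp: vars_app_atom_ren)
  obtain \<tau> \<tau>' where \<tau>: "\<tau> \<in> T" "\<tau>' \<in> S" "app_atom \<tau>' A = app_atom \<tau> H" using ne inst by blast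
  have ua: "unifiable_apart H A" unfolding unifiable_apart_def 
    using \<tau> represents_Subst[OF \<chi>\<^sub>1] represents_Subst[OF \<chi>\<^sub>2] by metis
  define \<delta> where "\<delta> = atom_mgu (app_atom \<rho> H) A"
  have m: "is_atom_mgu (app_atom \<rho> H) A \<delta>"
    unfolding \<delta>_def using unifiable_apart_iff[OF \<rho>, of H A] ua apart'
    by (intro atom_mgu_is_mgu) (simp add: vars_app_atom_ren)
  have \<delta>: "\<delta> \<in> Subst" using m by (simp add: is_atom_mgu_def is_mgu_def ISubst_Subst)
  note v\<delta> = mgu_apart_vars[OF m apart', unfolded vars_app_atom_ren]
  note S\<delta> = Sol_atom_mgu[OF m apart']
  define R where "R = {\<tau> \<in> Subst. \<tau> \<circ>\<^sub>s \<rho> \<in> T}"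
  define Q where "Q = S \<inter> Sol (subst_vars \<delta>) \<delta>"
  have Q: "\<sigma> \<in> Q \<longleftrightarrow> \<sigma> \<in> S \<and> app_atom (\<sigma> \<circ>\<^sub>s \<rho>) H = app_atom \<sigma> A" for \<sigma>
    unfolding Q_def S\<delta> using represents_Subst[OF \<chi>\<^sub>2] by (auto simp: app_atom_comp)
  have glue: "\<exists>\<sigma>\<in>R \<inter> Q. (\<forall>u\<in>U \<union> vars_atom A. \<sigma> u = \<alpha> u) \<and> (\<forall>v\<in>V. (\<sigma> \<circ>\<^sub>s \<rho>) v = \<alpha>' v)"
    if \<alpha>: "\<alpha> \<in> S" "\<alpha>' \<in> T" "app_atom \<alpha>' H = app_atom \<alpha> A" for \<alpha> \<alpha>'
  proof -
    let ?g = "glue_ren \<rho> V \<alpha>' \<alpha>"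
    have "\<alpha> \<in> Subst" "\<alpha>' \<in> Subst" using \<alpha> represents_Subst[OF \<chi>\<^sub>1] represents_Subst[OF \<chi>\<^sub>2] by auto
    then have g: "?g \<in> Subst" using \<rho> by blast
    have gU: "\<forall>u\<in>U \<union> vars_atom A. ?g u = \<alpha> u" using apart by (auto intro!: glue_ren_out)
    have gV: "\<forall>v\<in>V. (?g \<circ>\<^sub>s \<rho>) v = \<alpha>' v" using \<rho> by (simp add: glue_ren_in)
    have "?g \<in> S" by (rule represents_cong[OF \<chi>\<^sub>2 \<alpha>(1) g]) (use gU in simp)
    moreover have "?g \<circ>\<^sub>s \<rho> \<in> T"
      by (rule represents_cong[OF \<chi>\<^sub>1 \<alpha>(2)]) (use g gV \<rho> in \<open>auto dest: Ren_Subst\<close>)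
    moreover have "app_atom (?g \<circ>\<^sub>s \<rho>) H = app_atom \<alpha>' H" using gV H by (auto simp: app_atom_eq_iff)
    moreover have "app_atom ?g A = app_atom \<alpha> A" using gU by (simp add: app_atom_eq_iff)
    ultimately have "?g \<in> R \<inter> Q" using g \<alpha>(3) by (simp add: R_def Q)
    then show ?thesis using gU gV by blast
  qed
  have r: "represents (rename_ps \<rho> \<chi>\<^sub>1) (ren_vars \<rho> V) R"
    unfolding R_def using \<chi>\<^sub>1 \<rho> by (rule represents_rename)
  have RQ: "R \<inter> Q \<noteq> {}" using glue[OF \<tau>(2,1) \<tau>(3)[symmetric]] by blast
  then have u: "represents (unif_ps \<chi>\<^sub>2 \<delta>) (U \<union> subst_vars \<delta>) Q"
    unfolding Q_def using \<chi>\<^sub>2 \<delta> by (intro represents_unif) auto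
  have "represents (match_ps (rename_ps \<rho> \<chi>\<^sub>1) (unif_ps \<chi>\<^sub>2 \<delta>))
      (ren_vars \<rho> V \<union> (U \<union> subst_vars \<delta>)) (R \<inter> Q)"
    using r u
  proof (rule represents_match)
    \<comment> \<open>The caller solution that \<open>inst\<close> provides for \<beta> is glued to
      it; the result solves the unified caller state and agrees with \<beta> on the renamed
      variables.\<close>
    fix \<beta> assume \<beta>: "\<beta> \<in> R"
    then have \<beta>T: "\<beta> \<circ>\<^sub>s \<rho> \<in> T" by (simp add: R_def)
    then obtain \<alpha> where \<alpha>: "\<alpha> \<in> S" "app_atom \<alpha> A = app_atom (\<beta> \<circ>\<^sub>s \<rho>) H" using inst by blast
    then obtain \<sigma> where \<sigma>: "\<sigma> \<in> R \<inter> Q" "\<forall>v\<in>V. (\<sigma> \<circ>\<^sub>s \<rho>) v = (\<beta> \<circ>\<^sub>s \<rho>) v"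
      using glue[OF \<alpha>(1) \<beta>T] by metis
    have "\<sigma> u = \<beta> u" if u: "u \<in> ren_vars \<rho> V" for u
    proof -
      obtain v where "v \<in> V" "\<rho> v = Var u" using u \<rho> by (auto simp: ren_vars_iff)
      then show ?thesis using \<sigma>(2) by (auto simp: comp_apply)
    qed
    then show "\<exists>\<tau>'\<in>Q. \<forall>u\<in>ren_vars \<rho> V \<inter> (U \<union> subst_vars \<delta>). \<tau>' u = \<beta> u" using \<sigma>(1) by blast
  qed (rule RQ)
  then have "represents (proj_ps (match_ps (rename_ps \<rho> \<chi>\<^sub>1) (unif_ps \<chi>\<^sub>2 \<delta>)) (U \<union> vars_atom A))
      ((ren_vars \<rho> V \<union> (U \<union> subst_vars \<delta>)) \<inter> (U \<union> vars_atom A))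
      {\<tau> \<in> Subst. \<exists>\<tau>'\<in>R \<inter> Q. \<forall>u\<in>(ren_vars \<rho> V \<union> (U \<union> subst_vars \<delta>)) \<inter> (U \<union> vars_atom A). \<tau>' u = \<tau> u}"
    by (rule represents_proj)
  moreover have "(ren_vars \<rho> V \<union> (U \<union> subst_vars \<delta>)) \<inter> (U \<union> vars_atom A) = U \<union> vars_atom A"
    unfolding v\<delta> by blast
  moreover have "{\<tau> \<in> Subst. \<exists>\<tau>'\<in>R \<inter> Q. \<forall>u\<in>U \<union> vars_atom A. \<tau>' u = \<tau> u}
      = {\<tau> \<in> S. \<exists>\<tau>'\<in>T. app_atom \<tau>' H = app_atom \<tau> A}"
  proof (intro set_eqI iffI)
    fix \<alpha> assume "\<alpha> \<in> {\<tau> \<in> Subst. \<exists>\<tau>'\<in>R \<inter> Q. \<forall>u\<in>U \<union> vars_atom A. \<tau>' u = \<tau> u}"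
    then obtain \<sigma> where \<sigma>: "\<alpha> \<in> Subst" "\<sigma> \<in> R" "\<sigma> \<in> Q" "\<forall>u\<in>U \<union> vars_atom A. \<sigma> u = \<alpha> u" by blast
    then have "\<alpha> \<in> S" using represents_cong[OF \<chi>\<^sub>2, of \<sigma> \<alpha>] by (simp add: Q)
    moreover have "app_atom \<sigma> A = app_atom \<alpha> A" using \<sigma>(4) by (simp add: app_atom_eq_iff)
    ultimately show "\<alpha> \<in> {\<tau> \<in> S. \<exists>\<tau>'\<in>T. app_atom \<tau>' H = app_atom \<tau> A}"
      using \<sigma>(2,3) unfolding R_def Q by auto
  next
    fix \<alpha> assume "\<alpha> \<in> {\<tau> \<in> S. \<exists>\<tau>'\<in>T. app_atom \<tau>' H = app_atom \<tau> A}"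
    then show "\<alpha> \<in> {\<tau> \<in> Subst. \<exists>\<tau>'\<in>R \<inter> Q. \<forall>u\<in>U \<union> vars_atom A. \<tau>' u = \<tau> u}"
      using glue represents_Subst[OF \<chi>\<^sub>2] by blast
  qed
  ultimately show ?thesis
    unfolding backward_ps_unfold U(2) V(2) VH using ua by (simp add: Let_def flip: \<rho>_def \<delta>_def)
qed


section \<open>Proof trees\<close>

text \<open>
  Unifiers are not applied but collected as the equations \<open>E\<close> between selected atoms and heads, so
  that no selection order is recorded. \<open>W\<close> is the set of variables of the \<open>n\<close> variants used; it
  need not be disjoint from the variables of \<open>G\<close>, so uses of proof trees assume this separately.
\<close>

inductive proof_tree ::
    "('p, 'f::ranked, 'v) clause set \<Rightarrow> nat \<Rightarrow> ('p, 'f, 'v) atom list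
      \<Rightarrow> (('p, 'f, 'v) atom \<times> ('p, 'f, 'v) atom) set \<Rightarrow> 'v set \<Rightarrow> bool"
  for P :: "('p, 'f, 'v) clause set" where
  Nil: "proof_tree P 0 [] {} {}"
| Cons: "proof_tree P (Suc (m + n)) (A # G) (insert (A, head c) (E\<^sub>1 \<union> E\<^sub>2)) (vars_clause c \<union> W\<^sub>1 \<union> W\<^sub>2)"
    if "cl \<in> P" and "\<rho> \<in> Ren" and "c = app_clause \<rho> cl"
      and "proof_tree P m (body c) E\<^sub>1 W\<^sub>1" and "proof_tree P n G E\<^sub>2 W\<^sub>2"
      and "vars_clause c \<inter> W\<^sub>1 = {}" and "(vars_clause c \<union> W\<^sub>1) \<inter> W\<^sub>2 = {}"

inductive_cases proof_tree_NilE: "proof_tree P n [] E W"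
inductive_cases proof_tree_ConsE: "proof_tree P n (A # G) E W"

lemma proof_tree_append:
  assumes "proof_tree P m G\<^sub>1 E\<^sub>1 W\<^sub>1" "proof_tree P n G\<^sub>2 E\<^sub>2 W\<^sub>2" "W\<^sub>1 \<inter> W\<^sub>2 = {}"
  shows "proof_tree P (m + n) (G\<^sub>1 @ G\<^sub>2) (E\<^sub>1 \<union> E\<^sub>2) (W\<^sub>1 \<union> W\<^sub>2)"
  using assms
proof (induction G\<^sub>1 arbitrary: m E\<^sub>1 W\<^sub>1)
  case Nil
  then show ?case by (auto elim: proof_tree_NilE)
next
  case (Cons A G)
  from Cons.prems(1) obtain cl \<rho> c m' n' E' E'' W' W'' where
    *: "cl \<in> P" "\<rho> \<in> Ren" "c = app_clause \<rho> cl" "proof_tree P m' (body c) E' W'"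
      "proof_tree P n' G E'' W''" "vars_clause c \<inter> W' = {}" "(vars_clause c \<union> W') \<inter> W'' = {}"
    and eq: "m = Suc (m' + n')" "E\<^sub>1 = insert (A, head c) (E' \<union> E'')" "W\<^sub>1 = vars_clause c \<union> W' \<union> W''"
    by (elim proof_tree_ConsE) blast
  have "proof_tree P (n' + n) (G @ G\<^sub>2) (E'' \<union> E\<^sub>2) (W'' \<union> W\<^sub>2)"
    using Cons.prems eq(3) by (intro Cons.IH *(5)) auto
  then have "proof_tree P (Suc (m' + (n' + n))) (A # G @ G\<^sub>2) (insert (A, head c) (E' \<union> (E'' \<union> E\<^sub>2)))
      (vars_clause c \<union> W' \<union> (W'' \<union> W\<^sub>2))"
    using *(1-4,6,7) Cons.prems(3) unfolding eq(3) by (intro proof_tree.Cons) auto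
  then show ?case by (simp add: eq Un_ac add_ac)
qed

text \<open>An SLD step may select an atom anywhere in the goal, so trees have to be cut around the
  replaced body and, by \<open>proof_tree_append\<close>, joined again.\<close>

lemma proof_tree_split:
  assumes "proof_tree P k (G\<^sub>1 @ G\<^sub>2) E W"
  obtains m n E\<^sub>1 E\<^sub>2 W\<^sub>1 W\<^sub>2 where "proof_tree P m G\<^sub>1 E\<^sub>1 W\<^sub>1" "proof_tree P n G\<^sub>2 E\<^sub>2 W\<^sub>2"
    "W\<^sub>1 \<inter> W\<^sub>2 = {}" "E = E\<^sub>1 \<union> E\<^sub>2" "W = W\<^sub>1 \<union> W\<^sub>2"
proof -
  have "\<exists>m n E\<^sub>1 E\<^sub>2 W\<^sub>1 W\<^sub>2. proof_tree P m G\<^sub>1 E\<^sub>1 W\<^sub>1 \<and> proof_tree P n G\<^sub>2 E\<^sub>2 W\<^sub>2 \<and>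
    W\<^sub>1 \<inter> W\<^sub>2 = {} \<and> E = E\<^sub>1 \<union> E\<^sub>2 \<and> W = W\<^sub>1 \<union> W\<^sub>2"
    using assms
  proof (induction G\<^sub>1 arbitrary: k E W)
    case Nil
    then have "proof_tree P k G\<^sub>2 E W" by simp
    then show ?case
      by (intro exI[of _ 0] exI[of _ k] exI[of _ "{}"] exI[of _ E] exI[of _ W])
        (simp add: proof_tree.Nil)
  next
    case (Cons A G)
    then obtain cl \<rho> c m' n' E' E'' W' W'' where
      *: "cl \<in> P" "\<rho> \<in> Ren" "c = app_clause \<rho> cl" "proof_tree P m' (body c) E' W'"
        "proof_tree P n' (G @ G\<^sub>2) E'' W''" "vars_clause c \<inter> W' = {}" "(vars_clause c \<union> W') \<inter> W'' = {}"
      and eq: "E = insert (A, head c) (E' \<union> E'')" "W = vars_clause c \<union> W' \<union> W''"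
      by (simp only: append_Cons) (elim proof_tree_ConsE, blast)
    obtain m n E\<^sub>1 E\<^sub>2 W\<^sub>1 W\<^sub>2 where
      t: "proof_tree P m G E\<^sub>1 W\<^sub>1" "proof_tree P n G\<^sub>2 E\<^sub>2 W\<^sub>2" "W\<^sub>1 \<inter> W\<^sub>2 = {}" "E'' = E\<^sub>1 \<union> E\<^sub>2" "W'' = W\<^sub>1 \<union> W\<^sub>2"
      using Cons.IH[OF *(5)] by metis
    have "proof_tree P (Suc (m' + m)) (A # G) (insert (A, head c) (E' \<union> E\<^sub>1)) (vars_clause c \<union> W' \<union> W\<^sub>1)"
      using * t(1,5) by (intro proof_tree.Cons) auto
    moreover have "(vars_clause c \<union> W' \<union> W\<^sub>1) \<inter> W\<^sub>2 = {}" using *(7) t(3,5) by blast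
    moreover have "E = insert (A, head c) (E' \<union> E\<^sub>1) \<union> E\<^sub>2" "W = vars_clause c \<union> W' \<union> W\<^sub>1 \<union> W\<^sub>2"
      using eq t(4,5) by auto
    ultimately show ?case using t(2) by metis
  qed
  then show ?thesis using that by metis
qed

definition app_eqs ::
    "('f, 'v) subst \<Rightarrow> (('p, 'f, 'v) atom \<times> ('p, 'f, 'v) atom) set \<Rightarrow> (('p, 'f, 'v) atom \<times> ('p, 'f, 'v) atom) set" where
  "app_eqs \<rho> E = (\<lambda>(A, B). (app_atom \<rho> A, app_atom \<rho> B)) ` E"

definition unifies ::
    "('f, 'v) subst \<Rightarrow> (('p, 'f, 'v) atom \<times> ('p, 'f, 'v) atom) set \<Rightarrow> bool" where
  "unifies \<tau> E \<longleftrightarrow> (\<forall>(A, B)\<in>E. app_atom \<tau> A = app_atom \<tau> B)"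

lemma unifies_simps [simp]:
  "unifies \<tau> {}"
  "unifies \<tau> (insert (A, B) E) \<longleftrightarrow> app_atom \<tau> A = app_atom \<tau> B \<and> unifies \<tau> E"
  "unifies \<tau> (E \<union> E') \<longleftrightarrow> unifies \<tau> E \<and> unifies \<tau> E'"
  by (auto simp: unifies_def)

lemma unifies_app_eqs: "unifies \<tau> (app_eqs \<rho> E) \<longleftrightarrow> unifies (\<tau> \<circ>\<^sub>s \<rho>) E"
  by (auto simp: unifies_def app_eqs_def app_atom_comp)

lemma unifies_comp: "unifies \<delta> E \<Longrightarrow> unifies (\<eta> \<circ>\<^sub>s \<delta>) E"
  by (auto simp: unifies_def app_atom_comp)

lemma proof_tree_vars:
  assumes "proof_tree P n G E W" "(A, B) \<in> E"
  shows "vars_atom A \<union> vars_atom B \<subseteq> vars_goal G \<union> W"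
  using assms
proof (induction arbitrary: A B)
  case (Cons cl \<rho> c m E\<^sub>1 W\<^sub>1 n G E\<^sub>2 W\<^sub>2 A')
  have "vars_atom (head c) \<subseteq> vars_clause c" "vars_goal (body c) \<subseteq> vars_clause c"
    by (auto simp: vars_clause_def)
  moreover from Cons.prems consider "A = A'" "B = head c" | "(A, B) \<in> E\<^sub>1" | "(A, B) \<in> E\<^sub>2" by blast
  then have "vars_atom A \<union> vars_atom B \<subseteq> vars_atom A' \<union> vars_atom (head c) \<union>
      (vars_goal (body c) \<union> W\<^sub>1) \<union> (vars_goal G \<union> W\<^sub>2)"
    by cases (use Cons.IH in blast)+
  ultimately show ?case unfolding vars_goal_simps by blast
qed simp

text \<open>The equations mention only variables of the goal and of the variants used; elsewhere a
  unifier may be replaced when gluing.\<close>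

lemma proof_tree_unifies_cong:
  assumes t: "proof_tree P n G E W" and u: "unifies \<tau> E"
    and eq: "\<And>x. x \<in> vars_goal G \<union> W \<Longrightarrow> \<tau>' x = \<tau> x"
  shows "unifies \<tau>' E"
  unfolding unifies_def
proof safe
  fix A B assume AB: "(A, B) \<in> E"
  have "vars_atom A \<union> vars_atom B \<subseteq> vars_goal G \<union> W" using t AB by (rule proof_tree_vars)
  then have "app_atom \<tau>' A = app_atom \<tau> A" "app_atom \<tau>' B = app_atom \<tau> B"
    using eq by (auto simp: app_atom_eq_iff)
  then show "app_atom \<tau>' A = app_atom \<tau>' B" using u AB by (auto simp: unifies_def)
qed

lemma app_goal_comp: "app_goal (a \<circ>\<^sub>s b) G = app_goal a (app_goal b G)"
  by (simp add: app_goal_def app_atom_comp)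

lemma app_goal_idI: "(\<And>x. x \<in> vars_goal G \<Longrightarrow> a x = Var x) \<Longrightarrow> app_goal a G = G"
  by (auto simp: app_goal_def vars_goal_def intro!: map_idI app_atom_idI)

lemma vars_clause_ren: "vars_clause (app_clause \<rho> cl) = ren_vars \<rho> (vars_clause cl)"
  by (auto simp: vars_clause_def app_clause_def vars_goal_def app_goal_def vars_app_atom_ren ren_vars_def)

lemma Ren_comp: 
  assumes "a \<in> Ren" "b \<in> Ren" shows "a \<circ>\<^sub>s b \<in> Ren"
proof -
  obtain f g where fg: "bij f" "bij g" "a = (\<lambda>x. Var (f x))" "b = (\<lambda>x. Var (g x))"
    using assms by (auto elim!: RenE)
  then have "bij (f \<circ> g)" "a \<circ>\<^sub>s b = (\<lambda>x. Var ((f \<circ> g) x))"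
    by (auto simp: comp_apply intro: bij_comp)
  moreover have "a \<circ>\<^sub>s b \<in> Subst" using assms Ren_Subst by blast
  ultimately show ?thesis unfolding Ren_def by blast
qed

text \<open>Moves a tree for the body of a variant to the body of the program clause. The size is
  kept, as the later induction requires.\<close>

lemma proof_tree_rename:
  assumes "proof_tree P n G E W" and \<rho>: "\<rho> \<in> Ren"
  shows "proof_tree P n (app_goal \<rho> G) (app_eqs \<rho> E) (ren_vars \<rho> W)"
  using assms(1)
proof induction
  case Nil
  then show ?case by (simp add: app_goal_def app_eqs_def ren_vars_def proof_tree.Nil)
next
  case (Cons cl \<rho>' c m E\<^sub>1 W\<^sub>1 n G E\<^sub>2 W\<^sub>2 A)
  have c: "app_clause \<rho> c = app_clause (\<rho> \<circ>\<^sub>s \<rho>') cl"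
    unfolding Cons(3) by (simp add: app_clause_def app_goal_comp app_atom_comp)
  have b: "body (app_clause \<rho> c) = app_goal \<rho> (body c)" and h: "head (app_clause \<rho> c) = app_atom \<rho> (head c)"
    by (simp_all add: app_clause_def)
  have "proof_tree P (Suc (m + n)) (app_atom \<rho> A # app_goal \<rho> G)
      (insert (app_atom \<rho> A, head (app_clause \<rho> c)) (app_eqs \<rho> E\<^sub>1 \<union> app_eqs \<rho> E\<^sub>2))
      (vars_clause (app_clause \<rho> c) \<union> ren_vars \<rho> W\<^sub>1 \<union> ren_vars \<rho> W\<^sub>2)"
  proof (rule proof_tree.Cons[OF Cons(1) Ren_comp[OF \<rho> Cons(2)] c])
    show "proof_tree P m (body (app_clause \<rho> c)) (app_eqs \<rho> E\<^sub>1) (ren_vars \<rho> W\<^sub>1)"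
      unfolding b by (rule Cons.IH)
    show "vars_clause (app_clause \<rho> c) \<inter> ren_vars \<rho> W\<^sub>1 = {}"
      unfolding vars_clause_ren using \<rho> Cons(6) by (rule ren_vars_disjoint)
    show "(vars_clause (app_clause \<rho> c) \<union> ren_vars \<rho> W\<^sub>1) \<inter> ren_vars \<rho> W\<^sub>2 = {}"
      unfolding vars_clause_ren ren_vars_Un[symmetric] using \<rho> Cons(7) by (rule ren_vars_disjoint)
  qed (rule Cons.IH)
  then show ?case by (simp add: h app_goal_def app_eqs_def vars_clause_ren ren_vars_Un image_Un)
qed


section \<open>From SLD-derivations to proof trees\<close>

lemma subst_vars_comp: "subst_vars (a \<circ>\<^sub>s b) \<subseteq> subst_vars a \<union> subst_vars b"
proof (rule subst_vars_subsetI)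
  fix x assume ne: "(a \<circ>\<^sub>s b) x \<noteq> Var x"
  let ?X = "subst_vars a \<union> subst_vars b"
  have x: "x \<in> ?X"
  proof (rule ccontr)
    assume "x \<notin> ?X"
    then have "b x = Var x" "a x = Var x" by (auto simp: subst_vars_cases)
    then show False using ne by (simp add: comp_apply)
  qed
  have "vars_trm (b x) \<subseteq> ?X" using vars_subst_le[OF x, of b] by auto
  then have "vars_trm (a y) \<subseteq> ?X" if "y \<in> vars_trm (b x)" for y
    using vars_subst_le[of y ?X a] that by auto
  then show "x \<in> ?X \<and> vars_trm ((a \<circ>\<^sub>s b) x) \<subseteq> ?X"
    using x by (auto simp: comp_apply vars_app_trm)
qed

abbreviation subst_chain :: "('f, 'v) subst list \<Rightarrow> ('f, 'v) subst" where
  "subst_chain \<sigma>s \<equiv> foldl (\<lambda>\<delta> \<sigma>. \<sigma> \<circ>\<^sub>s \<delta>) Var \<sigma>s"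

text \<open>
  The current goal of a derivation is an instance of a goal \<open>R\<close> of yet unresolved, uninstantiated
  atoms, and a proof tree of \<open>R\<close> extends to one of the initial goal.
\<close>

lemma sld_proof_tree:
  assumes "sld P G G' cls \<sigma>s"
  shows "\<exists>R E. G' = app_goal (subst_chain \<sigma>s) R \<and>
    vars_goal R \<subseteq> vars_goal G \<union> (\<Union>c\<in>set cls. vars_clause c) \<and>
    subst_chain \<sigma>s \<in> Subst \<and>
    subst_vars (subst_chain \<sigma>s) \<subseteq> vars_goal G \<union> (\<Union>c\<in>set cls. vars_clause c) \<and>
    unifies (subst_chain \<sigma>s) E \<and>
    (\<forall>\<tau>\<in>Subst. unifies \<tau> E \<longrightarrow> (\<exists>\<eta>\<in>Subst. \<tau> = \<eta> \<circ>\<^sub>s subst_chain \<sigma>s)) \<and>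
    (\<forall>n E' W. proof_tree P n R E' W \<longrightarrow>
       W \<inter> (vars_goal G \<union> (\<Union>c\<in>set cls. vars_clause c)) = {} \<longrightarrow>
       (\<exists>m. proof_tree P m G (E \<union> E') (W \<union> (\<Union>c\<in>set cls. vars_clause c))))"
  using assms
proof induction
  case sld_empty
  show ?case
    by (intro exI[of _ G] exI[of _ "{}"])
      (auto simp: app_goal_idI subst_vars_def subst_dom_def subst_rng_def)
next
  case (sld_snoc G' cls \<sigma>s cl \<rho> \<sigma> G'')
  define \<delta> where "\<delta> = subst_chain \<sigma>s"
  define V where "V = vars_goal G \<union> (\<Union>c\<in>set cls. vars_clause c)"
  define c where "c = app_clause \<rho> cl"
  obtain R E where R: "G' = app_goal \<delta> R" "vars_goal R \<subseteq> V"
    and \<delta>: "\<delta> \<in> Subst" "subst_vars \<delta> \<subseteq> V" "unifies \<delta> E"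
    and mg: "\<And>\<tau>. \<tau> \<in> Subst \<Longrightarrow> unifies \<tau> E \<Longrightarrow> \<exists>\<eta>\<in>Subst. \<tau> = \<eta> \<circ>\<^sub>s \<delta>"
    and ext: "\<And>n E' W. proof_tree P n R E' W \<Longrightarrow> W \<inter> V = {} \<Longrightarrow>
       \<exists>m. proof_tree P m G (E \<union> E') (W \<union> (\<Union>c\<in>set cls. vars_clause c))"
    using sld_snoc.IH unfolding \<delta>_def V_def by auto
  have cV: "vars_clause c \<inter> V = {}" using sld_snoc.hyps(4) by (simp add: c_def V_def)
  obtain G\<^sub>1 g G\<^sub>2 where G': "G' = G\<^sub>1 @ g # G\<^sub>2" and m: "is_atom_mgu g (head c) \<sigma>"
    and G'': "G'' = app_goal \<sigma> (G\<^sub>1 @ body c @ G\<^sub>2)"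
    using sld_snoc.hyps(5) unfolding sld_step_def c_def by blast
  obtain R\<^sub>1 A R\<^sub>2 where RA: "R = R\<^sub>1 @ A # R\<^sub>2" "G\<^sub>1 = app_goal \<delta> R\<^sub>1" "g = app_atom \<delta> A" "G\<^sub>2 = app_goal \<delta> R\<^sub>2"
    using R(1) G' unfolding app_goal_def by (auto simp: map_eq_append_conv append_eq_map_conv map_eq_Cons_conv Cons_eq_map_conv)
  \<comment> \<open>The new variant is apart from everything used so far, so \<delta> leaves it
    alone, and unifying \<open>g\<close> with the head amounts to unifying the uninstantiated
    equation after \<delta>.\<close>
  have id: "\<delta> x = Var x" if "x \<in> vars_clause c" for x
    using that cV \<delta>(2) by (intro subst_vars_cases) blast
  have \<delta>c: "app_goal \<delta> (body c) = body c" "app_atom \<delta> (head c) = head c"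
    using id by (auto simp: vars_clause_def intro!: app_goal_idI app_atom_idI)
  have \<sigma>: "\<sigma> \<in> Subst" "app_atom \<sigma> g = app_atom \<sigma> (head c)" "subst_vars \<sigma> \<subseteq> vars_atom g \<union> vars_atom (head c)"
    and \<sigma>mg: "\<And>\<tau>. \<tau> \<in> Subst \<Longrightarrow> app_atom \<tau> g = app_atom \<tau> (head c) \<Longrightarrow> \<exists>\<eta>\<in>Subst. \<tau> = \<eta> \<circ>\<^sub>s \<sigma>"
    using m by (auto simp: is_atom_mgu_def is_mgu_def atom_unifiers_def ISubst_Subst)
  have chain: "subst_chain (\<sigma>s @ [\<sigma>]) = \<sigma> \<circ>\<^sub>s \<delta>" by (simp add: \<delta>_def)
  have V': "vars_goal G \<union> ((\<Union>c\<in>set cls. vars_clause c) \<union> vars_clause c) = V \<union> vars_clause c"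
    by (auto simp: V_def)
  have cls': "(\<Union>c\<in>set (cls @ [app_clause \<rho> cl]). vars_clause c) = (\<Union>c\<in>set cls. vars_clause c) \<union> vars_clause c"
    by (auto simp: c_def)
  have vA: "vars_atom A \<subseteq> V" using R(2) RA(1) by simp
  have vg: "vars_atom g \<subseteq> V"
    unfolding RA(3) vars_app_atom using vA \<delta>(2) vars_subst_le[of _ V \<delta>] by blast
  let ?R = "R\<^sub>1 @ body c @ R\<^sub>2" and ?E = "insert (A, head c) E"
  show ?case
    unfolding chain cls' V'
  proof (intro exI[of _ ?R] exI[of _ ?E] conjI ballI allI impI)
    show "G'' = app_goal (\<sigma> \<circ>\<^sub>s \<delta>) ?R"
      unfolding G'' app_goal_comp RA(2,4) using \<delta>c(1) by (simp add: app_goal_def)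
    show "vars_goal ?R \<subseteq> V \<union> vars_clause c"
      using R(2) RA(1) by (auto simp: vars_clause_def)
    show "\<sigma> \<circ>\<^sub>s \<delta> \<in> Subst" using \<sigma> \<delta> by blast
    have "vars_atom (head c) \<subseteq> vars_clause c" by (simp add: vars_clause_def)
    then show "subst_vars (\<sigma> \<circ>\<^sub>s \<delta>) \<subseteq> V \<union> vars_clause c"
      using subst_vars_comp[of \<sigma> \<delta>] \<sigma>(3) \<delta>(2) vg by blast
    show "unifies (\<sigma> \<circ>\<^sub>s \<delta>) ?E"
      using \<delta>(3) \<sigma>(2) \<delta>c(2) by (simp add: unifies_comp app_atom_comp RA(3))
    show "\<exists>\<eta>\<in>Subst. \<tau> = \<eta> \<circ>\<^sub>s \<sigma> \<circ>\<^sub>s \<delta>" if \<tau>: "\<tau> \<in> Subst" "unifies \<tau> ?E" for \<tau>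
    proof -
      \<comment> \<open>Most generality composes: \<tau> factors through \<delta>, and the remaining
        factor unifies \<open>g\<close> with the head, so it factors through \<sigma>.\<close>
      obtain \<eta> where \<eta>: "\<eta> \<in> Subst" "\<tau> = \<eta> \<circ>\<^sub>s \<delta>" using mg \<tau> by auto
      then have "app_atom \<eta> g = app_atom \<eta> (head c)"
        using \<tau>(2) \<delta>c(2) by (simp add: app_atom_comp RA(3))
      then obtain \<eta>' where "\<eta>' \<in> Subst" "\<eta> = \<eta>' \<circ>\<^sub>s \<sigma>" using \<sigma>mg \<eta>(1) by blast
      then show ?thesis using \<eta>(2) by (auto simp: subst_comp_assoc)
    qed
    \<comment> \<open>The tree is cut at both ends of the clause body; the middle piece becomes the
      subtree below \<open>A\<close>, giving a tree for \<open>R\<close>, which is then extended to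
      one for \<open>G\<close>.\<close>
    fix n E' W
    assume t: "proof_tree P n ?R E' W" and W: "W \<inter> (V \<union> vars_clause c) = {}"
    obtain n\<^sub>1 E\<^sub>1 W\<^sub>1 n' E'' W' where t\<^sub>1: "proof_tree P n\<^sub>1 R\<^sub>1 E\<^sub>1 W\<^sub>1"
      and t': "proof_tree P n' (body c @ R\<^sub>2) E'' W'" "W\<^sub>1 \<inter> W' = {}" "E' = E\<^sub>1 \<union> E''" "W = W\<^sub>1 \<union> W'"
      using proof_tree_split[OF t] by metis
    obtain n\<^sub>2 E\<^sub>2 W\<^sub>2 n\<^sub>3 E\<^sub>3 W\<^sub>3 where t\<^sub>2: "proof_tree P n\<^sub>2 (body c) E\<^sub>2 W\<^sub>2"
      and t\<^sub>3: "proof_tree P n\<^sub>3 R\<^sub>2 E\<^sub>3 W\<^sub>3" "W\<^sub>2 \<inter> W\<^sub>3 = {}" "E'' = E\<^sub>2 \<union> E\<^sub>3" "W' = W\<^sub>2 \<union> W\<^sub>3"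
      using proof_tree_split[OF t'(1)] by metis
    have "proof_tree P (Suc (n\<^sub>2 + n\<^sub>3)) (A # R\<^sub>2) (insert (A, head c) (E\<^sub>2 \<union> E\<^sub>3)) (vars_clause c \<union> W\<^sub>2 \<union> W\<^sub>3)"
      using W t'(4) t\<^sub>3(2,4)
      by (intro proof_tree.Cons[OF sld_snoc.hyps(2,3) c_def t\<^sub>2 t\<^sub>3(1)]) auto
    then have "proof_tree P (n\<^sub>1 + Suc (n\<^sub>2 + n\<^sub>3)) R (E\<^sub>1 \<union> insert (A, head c) (E\<^sub>2 \<union> E\<^sub>3))
        (W\<^sub>1 \<union> (vars_clause c \<union> W\<^sub>2 \<union> W\<^sub>3))"
      unfolding RA(1) using W t'(2,4) t\<^sub>3(4) by (intro proof_tree_append[OF t\<^sub>1]) auto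
    moreover have "(W\<^sub>1 \<union> (vars_clause c \<union> W\<^sub>2 \<union> W\<^sub>3)) \<inter> V = {}"
      using W t'(4) t\<^sub>3(4) cV by blast
    ultimately obtain m where "proof_tree P m G (E \<union> (E\<^sub>1 \<union> insert (A, head c) (E\<^sub>2 \<union> E\<^sub>3)))
        (W\<^sub>1 \<union> (vars_clause c \<union> W\<^sub>2 \<union> W\<^sub>3) \<union> (\<Union>c\<in>set cls. vars_clause c))"
      using ext by blast
    moreover have "E \<union> (E\<^sub>1 \<union> insert (A, head c) (E\<^sub>2 \<union> E\<^sub>3)) = ?E \<union> E'"
      using t'(3) t\<^sub>3(3) by auto
    moreover have "W\<^sub>1 \<union> (vars_clause c \<union> W\<^sub>2 \<union> W\<^sub>3) \<union> (\<Union>c\<in>set cls. vars_clause c)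
        = W \<union> ((\<Union>c\<in>set cls. vars_clause c) \<union> vars_clause c)"
      using t'(4) t\<^sub>3(4) by auto
    ultimately show "\<exists>m. proof_tree P m G (?E \<union> E') (W \<union> ((\<Union>c\<in>set cls. vars_clause c) \<union> vars_clause c))"
      by metis
  qed
qed


lemma sld_fresh: "sld P G G' cls \<sigma>s \<Longrightarrow> (\<Union>c\<in>set cls. vars_clause c) \<inter> vars_goal G = {}"
  by (induction rule: sld.induct) auto

section \<open>Soundness of the denotational semantics for proof trees\<close>

text \<open>The witness \<tau>' assigns values to the variables of the variants, and these are
  projected away; only the values on \<open>V\<close> are passed on to \<tau>.\<close>

definition answers ::
    "('f::ranked, 'v) subst set \<Rightarrow> (('p, 'f, 'v) atom \<times> ('p, 'f, 'v) atom) set \<Rightarrow> 'v set \<Rightarrow> ('f, 'v) subst set" where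
  "answers S E V = {\<tau> \<in> Subst. \<exists>\<tau>'\<in>S. unifies \<tau>' E \<and> (\<forall>v\<in>V. \<tau>' v = \<tau> v)}"

lemma answersI: "\<tau> \<in> Subst \<Longrightarrow> \<tau>' \<in> S \<Longrightarrow> unifies \<tau>' E \<Longrightarrow> (\<And>v. v \<in> V \<Longrightarrow> \<tau>' v = \<tau> v) \<Longrightarrow> \<tau> \<in> answers S E V"
  unfolding answers_def by blast

lemma answersE:
  assumes "\<tau> \<in> answers S E V"
  obtains \<tau>' where "\<tau> \<in> Subst" "\<tau>' \<in> S" "unifies \<tau>' E" "\<forall>v\<in>V. \<tau>' v = \<tau> v"
  using assms unfolding answers_def by blast

text \<open>The semantics works on \<open>cl\<close>, the tree on its variant \<open>c\<close>, and
  the inverse renaming carries the tree over. Premise \<open>body\<close> is the induction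
  hypothesis of \<open>body_sem_answers\<close>, needed only for trees of size
  \<open>m\<close>.\<close>

lemma clause_sem_answers:
  fixes P :: "('p, 'f::ranked, 'v::infinite) clause set"
  assumes d: "is_denotation d" and \<rho>: "\<rho> \<in> Ren" and c: "c = app_clause \<rho> cl"
    and t: "proof_tree P m (body c) E W" and cW: "vars_clause c \<inter> W = {}"
    and body: "\<And>\<chi> U S E W. proof_tree P m (body cl) E W \<Longrightarrow> represents \<chi> U S \<Longrightarrow>
      W \<inter> (U \<union> vars_goal (body cl)) = {} \<Longrightarrow> answers S E (U \<union> vars_goal (body cl)) \<noteq> {} \<Longrightarrow>
      \<exists>\<chi>'\<le>body_sem (body cl) d \<chi>.
        represents \<chi>' (U \<union> vars_goal (body cl)) (answers S E (U \<union> vars_goal (body cl)))"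
    and \<chi>: "represents \<chi> U S" and apart: "(vars_clause c \<union> W) \<inter> (U \<union> vars_atom A) = {}"
    and ne: "answers S (insert (A, head c) E) (U \<union> vars_atom A) \<noteq> {}"
  shows "\<exists>\<chi>'\<le>clause_sem cl d A \<chi>.
    represents \<chi>' (U \<union> vars_atom A) (answers S (insert (A, head c) E) (U \<union> vars_atom A))"
proof -
  let ?i = "ren_inv \<rho>" and ?H = "head cl" and ?B = "body cl"
  let ?E = "app_eqs ?i E" and ?W = "ren_vars ?i W"
  have i: "?i \<in> Ren" using \<rho> by (rule ren_inv)
  have hc: "head c = app_atom \<rho> ?H" by (simp add: c app_clause_def)
  have "app_goal ?i (body c) = ?B"
    unfolding c using ren_inv(3)[OF \<rho>]
    by (simp add: app_clause_def app_goal_idI flip: app_goal_comp)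
  then have t': "proof_tree P m ?B ?E ?W" using proof_tree_rename[OF t i] by simp
  have vcl: "vars_clause cl = ren_vars ?i (vars_clause c)"
    unfolding c vars_clause_ren using \<rho> by (simp add: ren_inv_ren_vars)
  have HB: "vars_clause cl = vars_atom ?H \<union> vars_goal ?B" by (simp add: vars_clause_def)
  have W': "?W \<inter> (vars_atom ?H \<union> vars_goal ?B) = {}"
    unfolding HB[symmetric] vcl using ren_vars_disjoint[OF i cW] by blast
  have uE: "unifies (\<tau> \<circ>\<^sub>s \<rho>) ?E \<longleftrightarrow> unifies \<tau> E" for \<tau> :: "('f, 'v) subst"
    using ren_inv(2)[OF \<rho>] by (simp add: unifies_app_eqs subst_comp_assoc)
  define T\<^sub>0 where "T\<^sub>0 = {\<tau> \<in> Subst. \<exists>\<tau>'\<in>S. app_atom \<tau>' A = app_atom \<tau> ?H}"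
  define T where "T = answers T\<^sub>0 ?E (vars_atom ?H \<union> vars_goal ?B)"
  \<comment> \<open>A single unifier for caller and variant gives, after composition with \<rho>, a
    solution for \<open>cl\<close> that agrees on the called atom. It serves one inclusion and all
    nonemptiness conditions.\<close>
  have shift: "\<tau> \<circ>\<^sub>s \<rho> \<in> T\<^sub>0 \<and> \<tau> \<circ>\<^sub>s \<rho> \<in> T \<and> app_atom (\<tau> \<circ>\<^sub>s \<rho>) ?H = app_atom \<tau> A"
    if \<tau>: "\<tau> \<in> S" "unifies \<tau> (insert (A, head c) E)" for \<tau>
  proof -
    have "\<tau> \<circ>\<^sub>s \<rho> \<in> Subst" using represents_Subst[OF \<chi> \<tau>(1)] \<rho> Ren_Subst by blast
    moreover have h: "app_atom (\<tau> \<circ>\<^sub>s \<rho>) ?H = app_atom \<tau> A" using \<tau>(2) by (simp add: hc app_atom_comp)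
    ultimately have "\<tau> \<circ>\<^sub>s \<rho> \<in> T\<^sub>0" using \<tau>(1) by (auto simp: T\<^sub>0_def)
    moreover from this have "\<tau> \<circ>\<^sub>s \<rho> \<in> T"
      unfolding T_def using \<tau>(2) uE \<open>\<tau> \<circ>\<^sub>s \<rho> \<in> Subst\<close> by (intro answersI) auto
    ultimately show ?thesis using h by blast
  qed
  obtain \<tau>\<^sub>0 where \<tau>\<^sub>0: "\<tau>\<^sub>0 \<in> S" "unifies \<tau>\<^sub>0 (insert (A, head c) E)"
    using ne unfolding answers_def by blast
  have "represents (forward_ps \<chi> A ?H) (vars_atom ?H) T\<^sub>0"
    unfolding T\<^sub>0_def using shift[OF \<tau>\<^sub>0] by (intro represents_forward[OF \<chi>]) (auto simp: T\<^sub>0_def)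
  moreover have "T \<noteq> {}" using shift[OF \<tau>\<^sub>0] by blast
  ultimately obtain \<chi>\<^sub>1 where \<chi>\<^sub>1: "\<chi>\<^sub>1 \<le> body_sem ?B d (forward_ps \<chi> A ?H)"
      "represents \<chi>\<^sub>1 (vars_atom ?H \<union> vars_goal ?B) T"
    using body[OF t' _ W'] unfolding T_def by blast
  have "represents (backward_ps \<chi>\<^sub>1 \<chi> ?H A) (U \<union> vars_atom A) {\<tau> \<in> S. \<exists>\<tau>'\<in>T. app_atom \<tau>' ?H = app_atom \<tau> A}"
  proof (rule represents_backward[OF \<chi>\<^sub>1(2) _ \<chi> _ \<open>T \<noteq> {}\<close>])
    fix \<tau> assume "\<tau> \<in> T"
    then obtain \<tau>' where "\<tau>' \<in> T\<^sub>0" "\<forall>v\<in>vars_atom ?H \<union> vars_goal ?B. \<tau>' v = \<tau> v"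
      unfolding T_def by (rule answersE)
    moreover from this(2) have "app_atom \<tau>' ?H = app_atom \<tau> ?H" by (simp add: app_atom_eq_iff)
    ultimately show "\<exists>\<tau>'\<in>S. app_atom \<tau>' A = app_atom \<tau> ?H" by (simp add: T\<^sub>0_def)
  qed simp
  moreover have "{\<tau> \<in> S. \<exists>\<tau>'\<in>T. app_atom \<tau>' ?H = app_atom \<tau> A}
      = answers S (insert (A, head c) E) (U \<union> vars_atom A)"
  proof (intro set_eqI iffI)
    fix \<tau> assume "\<tau> \<in> {\<tau> \<in> S. \<exists>\<tau>'\<in>T. app_atom \<tau>' ?H = app_atom \<tau> A}"
    then obtain \<alpha> where \<tau>: "\<tau> \<in> S" and \<alpha>: "\<alpha> \<in> T" "app_atom \<alpha> ?H = app_atom \<tau> A" by blast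
    from \<alpha>(1) obtain \<beta> where \<beta>: "\<beta> \<in> T\<^sub>0" "unifies \<beta> ?E" "\<forall>v\<in>vars_atom ?H \<union> vars_goal ?B. \<beta> v = \<alpha> v"
      unfolding T_def by (rule answersE)
    have S: "\<tau> \<in> Subst" "\<beta> \<in> Subst" using represents_Subst[OF \<chi> \<tau>] \<beta>(1) by (simp_all add: T\<^sub>0_def)
    let ?X = "vars_clause cl \<union> ?W"
    \<comment> \<open>Conversely, the clause solution \<beta> is placed on the variables of the
      variant next to the caller's \<tau>; apartness of the variant from the caller makes the two
      compatible.\<close>
    let ?g = "glue_ren \<rho> ?X \<beta> \<tau>"
    have g: "?g \<in> Subst" using S \<rho> by blast
    have "ren_vars \<rho> ?X = vars_clause c \<union> W"
    proof -
      have "ren_vars \<rho> (ren_vars ?i Y) = Y" for Y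
        using ren_inv(2)[OF \<rho>] by (simp add: ren_vars_def flip: vars_app_trm) (simp flip: comp_apply)
      then show ?thesis unfolding vcl ren_vars_Un by simp
    qed
    then have gU: "?g u = \<tau> u" if "u \<in> U \<union> vars_atom A" for u
      using that apart by (intro glue_ren_out) auto
    have gX: "(?g \<circ>\<^sub>s \<rho>) x = \<beta> x" if "x \<in> ?X" for x using \<rho> that by (rule glue_ren_in)
    have "unifies (?g \<circ>\<^sub>s \<rho>) ?E"
      using gX by (intro proof_tree_unifies_cong[OF t' \<beta>(2)]) (auto simp: HB)
    then have "unifies ?g E" by (simp only: uE)
    moreover have "app_atom ?g (head c) = app_atom ?g A"
    proof -
      have "app_atom ?g (head c) = app_atom \<beta> ?H"
        unfolding hc app_atom_comp[symmetric] using gX by (auto simp: app_atom_eq_iff HB)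
      also have "\<dots> = app_atom \<alpha> ?H" using \<beta>(3) by (simp add: app_atom_eq_iff)
      also have "\<dots> = app_atom ?g A" unfolding \<alpha>(2) using gU by (simp add: app_atom_eq_iff)
      finally show ?thesis .
    qed
    moreover have "?g \<in> S" using represents_cong[OF \<chi> \<tau> g] gU by simp
    ultimately show "\<tau> \<in> answers S (insert (A, head c) E) (U \<union> vars_atom A)"
      using gU S(1) by (intro answersI[of _ ?g]) auto
  next
    fix \<tau> assume "\<tau> \<in> answers S (insert (A, head c) E) (U \<union> vars_atom A)"
    then obtain \<tau>' where \<tau>': "\<tau> \<in> Subst" "\<tau>' \<in> S" "unifies \<tau>' (insert (A, head c) E)"
      "\<forall>u\<in>U \<union> vars_atom A. \<tau>' u = \<tau> u" by (rule answersE)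
    have "\<tau> \<in> S" by (rule represents_cong[OF \<chi> \<tau>'(2,1)]) (use \<tau>'(4) in simp)
    moreover have "app_atom \<tau>' A = app_atom \<tau> A" using \<tau>'(4) by (simp add: app_atom_eq_iff)
    ultimately show "\<tau> \<in> {\<tau> \<in> S. \<exists>\<tau>'\<in>T. app_atom \<tau>' ?H = app_atom \<tau> A}"
      using shift[OF \<tau>'(2,3)] by auto
  qed
  moreover have "backward_ps \<chi>\<^sub>1 \<chi> ?H A \<le> clause_sem cl d A \<chi>"
    unfolding clause_sem_def using \<chi>\<^sub>1(1) by (rule ps_mcont_mono[OF ps_mcont_backward1])
  ultimately show ?thesis by auto
qed

text \<open>Only a lower bound can be claimed, as other clauses contribute classes too. The
  denotation enters through two properties, continuity and being above each clause; minimality is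
  not involved.\<close>

lemma body_sem_answers:
  fixes P :: "('p, 'f::ranked, 'v::infinite) clause set"
  assumes d: "is_denotation d" and clause: "\<And>cl A \<chi>. cl \<in> P \<Longrightarrow> clause_sem cl d A \<chi> \<le> d A \<chi>"
  shows "proof_tree P n G E W \<Longrightarrow> represents \<chi> U S \<Longrightarrow> W \<inter> (U \<union> vars_goal G) = {} \<Longrightarrow>
    answers S E (U \<union> vars_goal G) \<noteq> {} \<Longrightarrow>
    \<exists>\<chi>'\<le>body_sem G d \<chi>. represents \<chi>' (U \<union> vars_goal G) (answers S E (U \<union> vars_goal G))"
proof (induction n arbitrary: G E W \<chi> U S rule: less_induct)
  case (less k)
  note \<chi> = less.prems(2)
  show ?case
  proof (cases G)
    case Nil
    then have "E = {}" using less.prems(1) by (auto elim: proof_tree_NilE)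
    have "answers S E U = S"
    proof (intro set_eqI iffI)
      fix \<tau> assume "\<tau> \<in> answers S E U"
      then obtain \<tau>' where \<tau>': "\<tau> \<in> Subst" "\<tau>' \<in> S" "unifies \<tau>' E" "\<forall>v\<in>U. \<tau>' v = \<tau> v" by (rule answersE)
      show "\<tau> \<in> S" by (rule represents_cong[OF \<chi> \<tau>'(2,1)]) (simp add: \<tau>'(4))
    next
      fix \<tau> assume "\<tau> \<in> S"
      then show "\<tau> \<in> answers S E U"
        using represents_Subst[OF \<chi>] \<open>E = {}\<close> by (intro answersI[of _ \<tau>]) auto
    qed
    then show ?thesis using \<chi> by (intro exI[of _ \<chi>]) (simp add: Nil)
  next
    case (Cons A G')
    from less.prems(1)[unfolded Cons] obtain cl \<rho> c m n E\<^sub>1 E\<^sub>2 W\<^sub>1 W\<^sub>2 where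
      c: "cl \<in> P" "\<rho> \<in> Ren" "c = app_clause \<rho> cl" and t\<^sub>1: "proof_tree P m (body c) E\<^sub>1 W\<^sub>1"
      and t\<^sub>2: "proof_tree P n G' E\<^sub>2 W\<^sub>2" and cW: "vars_clause c \<inter> W\<^sub>1 = {}" "(vars_clause c \<union> W\<^sub>1) \<inter> W\<^sub>2 = {}"
      and eq: "k = Suc (m + n)" "E = insert (A, head c) (E\<^sub>1 \<union> E\<^sub>2)" "W = vars_clause c \<union> W\<^sub>1 \<union> W\<^sub>2"
      by (elim proof_tree_ConsE) blast
    let ?E = "insert (A, head c) E\<^sub>1" and ?V = "U \<union> vars_atom A"
    let ?V' = "?V \<union> vars_goal G'"
    have VG: "U \<union> vars_goal G = ?V'" by (auto simp: Cons)
    have apart: "(vars_clause c \<union> W\<^sub>1) \<inter> ?V' = {}" "W\<^sub>2 \<inter> ?V' = {}"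
      using less.prems(3) eq(3) VG by auto
    define S\<^sub>1 where "S\<^sub>1 = answers S ?E ?V"
    have S\<^sub>1I: "\<tau> \<in> S\<^sub>1" if "\<tau> \<in> S" "unifies \<tau> ?E" for \<tau>
      unfolding S\<^sub>1_def using represents_Subst[OF \<chi> that(1)] that by (intro answersI) auto
    obtain \<tau>\<^sub>0 where \<tau>\<^sub>0: "\<tau>\<^sub>0 \<in> S" "unifies \<tau>\<^sub>0 E" using less.prems(4) unfolding answers_def by blast
    have \<tau>\<^sub>0S: "\<tau>\<^sub>0 \<in> S\<^sub>1" using \<tau>\<^sub>0 eq(2) by (intro S\<^sub>1I) auto
    have "\<exists>\<chi>'\<le>clause_sem cl d A \<chi>. represents \<chi>' ?V S\<^sub>1"
      unfolding S\<^sub>1_def using apart(1) \<tau>\<^sub>0S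
      by (intro clause_sem_answers[OF d c(2,3) t\<^sub>1 cW(1) _ \<chi>] less.IH) (auto simp: eq(1) S\<^sub>1_def)
    then obtain \<chi>\<^sub>1 where \<chi>\<^sub>1: "\<chi>\<^sub>1 \<le> d A \<chi>" "represents \<chi>\<^sub>1 ?V S\<^sub>1"
      using clause[OF c(1)] order_trans by blast
    have same: "answers S\<^sub>1 E\<^sub>2 ?V' = answers S E ?V'"
    proof (intro set_eqI iffI)
      fix \<tau> assume "\<tau> \<in> answers S\<^sub>1 E\<^sub>2 ?V'"
      then obtain \<beta> where \<beta>: "\<tau> \<in> Subst" "\<beta> \<in> S\<^sub>1" "unifies \<beta> E\<^sub>2" "\<forall>v\<in>?V'. \<beta> v = \<tau> v" by (rule answersE)
      from \<beta>(2) obtain \<alpha> where \<alpha>: "\<beta> \<in> Subst" "\<alpha> \<in> S" "unifies \<alpha> ?E" "\<forall>v\<in>?V. \<alpha> v = \<beta> v"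
        unfolding S\<^sub>1_def by (rule answersE)
      \<comment> \<open>The variables in \<open>vars_clause c \<union> W\<^sub>1\<close> are private
        to the first atom: on them the witness for that call counts, elsewhere the one for the
        remaining goal.\<close>
      let ?g = "glue (vars_clause c \<union> W\<^sub>1) \<alpha> \<beta>"
      have g: "?g \<in> Subst" using \<alpha>(1) represents_Subst[OF \<chi> \<alpha>(2)] by blast
      have g\<alpha>: "?g x = \<alpha> x" if "x \<in> vars_clause c \<union> W\<^sub>1 \<union> ?V" for x
        using that \<alpha>(4) by (auto simp: glue_def)
      have g\<beta>: "?g x = \<beta> x" if "x \<in> ?V' \<union> W\<^sub>2" for x
        using that apart(1) cW(2) by (intro glue_simps) blast
      have hb: "vars_atom (head c) \<subseteq> vars_clause c" "vars_goal (body c) \<subseteq> vars_clause c"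
        by (auto simp: vars_clause_def)
      have "app_atom ?g A = app_atom \<alpha> A" using g\<alpha> by (auto simp: app_atom_eq_iff)
      moreover have "app_atom ?g (head c) = app_atom \<alpha> (head c)"
        using g\<alpha> hb(1) by (auto simp: app_atom_eq_iff)
      moreover have "unifies ?g E\<^sub>1"
        by (rule proof_tree_unifies_cong[OF t\<^sub>1, of \<alpha>]) (use \<alpha>(3) g\<alpha> hb(2) in auto)
      moreover have "unifies ?g E\<^sub>2"
        using g\<beta> by (intro proof_tree_unifies_cong[OF t\<^sub>2 \<beta>(3)]) auto
      ultimately have "unifies ?g E" using \<alpha>(3) by (simp add: eq(2))
      moreover have "?g \<in> S" using represents_cong[OF \<chi> \<alpha>(2) g] g\<alpha> by simp
      ultimately show "\<tau> \<in> answers S E ?V'"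
        using g\<beta> \<beta>(1,4) by (intro answersI[of _ ?g]) auto
    next
      fix \<tau> assume "\<tau> \<in> answers S E ?V'"
      then obtain \<beta> where \<beta>: "\<tau> \<in> Subst" "\<beta> \<in> S" "unifies \<beta> E" "\<forall>v\<in>?V'. \<beta> v = \<tau> v" by (rule answersE)
      then show "\<tau> \<in> answers S\<^sub>1 E\<^sub>2 ?V'"
        using S\<^sub>1I[of \<beta>] eq(2) by (intro answersI[of _ \<beta>]) auto
    qed
    obtain \<chi>' where "\<chi>' \<le> body_sem G' d \<chi>\<^sub>1" "represents \<chi>' ?V' (answers S E ?V')"
      using less.IH[OF _ t\<^sub>2 \<chi>\<^sub>1(2) apart(2)] less.prems(4) unfolding same VG eq(1) by auto
    moreover have "body_sem G' d \<chi>\<^sub>1 \<le> body_sem G d \<chi>"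
      using body_sem_mono[OF d order_refl \<chi>\<^sub>1(1)] by (simp add: Cons)
    ultimately show ?thesis unfolding VG using order_trans by blast
  qed
qed

text \<open>The empty substitution imposes no constraint, so the input has all of
  \<open>Subst\<close> as solutions. Its answers under the equations of the tree are the solutions
  of their most general unifier, the composition of the unifiers in the derivation.\<close>

theorem theorem4p7:
  fixes P :: "('p::ranked, 'f::func_symbols, 'v::infinite) clause set"
    and G :: "('p, 'f, 'v) atom list"
    and \<theta> :: "('f, 'v) subst"
  assumes "wf_program P"
    and "wf_goal G"
    and "computed_answer P G \<theta>"
  shows "body_sem G (prog_sem P) (Elem {ecls (vars_goal G) Var} (vars_goal G))
           \<ge> Elem {ecls (vars_goal G) \<theta>} (vars_goal G)"
proof -
  let ?U = "vars_goal G"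
  obtain cls \<sigma>s where sld: "sld P G [] cls \<sigma>s" and \<theta>: "\<theta> = subst_restrict (subst_chain \<sigma>s) ?U"
    using assms(3) by (auto simp: computed_answer_def)
  define \<delta> where "\<delta> = subst_chain \<sigma>s"
  define X where "X = (\<Union>c\<in>set cls. vars_clause c)"
  obtain R E where R: "[] = app_goal \<delta> R" and \<delta>: "\<delta> \<in> Subst" "unifies \<delta> E"
    and mg: "\<And>\<tau>. \<tau> \<in> Subst \<Longrightarrow> unifies \<tau> E \<Longrightarrow> \<exists>\<eta>\<in>Subst. \<tau> = \<eta> \<circ>\<^sub>s \<delta>"
    and ext: "\<And>n E' W. proof_tree P n R E' W \<Longrightarrow> W \<inter> (?U \<union> X) = {} \<Longrightarrow>
       \<exists>m. proof_tree P m G (E \<union> E') (W \<union> X)"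
    using sld_proof_tree[OF sld] unfolding \<delta>_def X_def by auto
  \<comment> \<open>The derivation ends in the empty goal, so nothing is left unresolved and the
    empty tree is the one to extend.\<close>
  have "R = []" using R by (simp add: app_goal_def)
  then obtain m where t: "proof_tree P m G E X"
    using ext[of 0 "{}" "{}"] proof_tree.Nil[of P] by auto
  have apart: "X \<inter> (?U \<union> ?U) = {}" using sld_fresh[OF sld] by (simp add: X_def)
  have \<chi>: "represents (Elem {ecls ?U Var} ?U) ?U (Subst :: ('f, 'v) subst set)"
  proof -
    have "Sol ?U (Var :: ('f, 'v) subst) = Subst" using Sol_comp[of Var _ ?U] Sol_Subst by fastforce
    then show ?thesis using representsI[of ?U "Var :: ('f, 'v) subst"] by simp
  qed
  have "answers Subst E (?U \<union> ?U) = Sol ?U \<delta>"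
  proof (intro set_eqI iffI)
    fix \<tau> assume "\<tau> \<in> answers Subst E (?U \<union> ?U)"
    then obtain \<tau>' where \<tau>': "\<tau> \<in> Subst" "\<tau>' \<in> Subst" "unifies \<tau>' E" "\<forall>v\<in>?U \<union> ?U. \<tau>' v = \<tau> v"
      by (rule answersE)
    then obtain \<eta> where "\<eta> \<in> Subst" "\<tau>' = \<eta> \<circ>\<^sub>s \<delta>" using mg by blast
    then have "\<tau>' \<in> Sol ?U \<delta>" using Sol_comp \<delta>(1) by blast
    then show "\<tau> \<in> Sol ?U \<delta>" by (rule Sol_cong) (use \<tau>' in auto)
  next
    fix \<tau> assume \<tau>: "\<tau> \<in> Sol ?U \<delta>"
    then obtain \<eta> where "\<eta> \<in> Subst" "\<forall>u\<in>?U. \<tau> u = (\<eta> \<circ>\<^sub>s \<delta>) u" by (rule SolE)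
    then show "\<tau> \<in> answers Subst E (?U \<union> ?U)"
      using \<delta> Sol_Subst[OF \<tau>] by (intro answersI[of _ "\<eta> \<circ>\<^sub>s \<delta>"]) (auto simp: unifies_comp)
  qed
  moreover have "\<delta> \<in> Sol ?U \<delta>" using \<delta>(1) by (rule Sol_self)
  ultimately obtain \<chi>' where \<chi>': "\<chi>' \<le> body_sem G (prog_sem P) (Elem {ecls ?U Var} ?U)"
      "represents \<chi>' ?U (Sol ?U \<delta>)"
    using body_sem_answers[OF prog_sem_fixpoint(1) clause_sem_le_prog_sem t \<chi> apart] by auto
  obtain \<mu> where \<mu>: "\<mu> \<in> Subst" "\<chi>' = Elem {ecls ?U \<mu>} ?U" "Sol ?U \<mu> = Sol ?U \<delta>"
    using \<chi>'(2) by (auto simp: represents_def)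
  \<comment> \<open>A class over the goal variables sees only values there, and restriction leaves
    these unchanged.\<close>
  have "ecls ?U \<theta> = ecls ?U \<delta>"
    by (simp add: \<theta> \<delta>_def ecls_def sim_on_def subst_restrict_def)
  also have "\<dots> = ecls ?U \<mu>" using \<mu> \<delta>(1) by (simp add: ecls_eq_iff)
  finally show ?thesis using \<chi>'(1) \<mu>(2) by simp
qed

end
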